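(* The category $\mathbb{M}$ of multisets is dually equivalent to the category $\mathbb{P}$ of profinite MV-algebras and homomorphisms that reflect principal maximal ideals; that is, $\mathbb{M}$ is equivalent to $\mathbb{P}^{op}$.
   Context: An MV-algebra is an Abelian monoid $(A,\oplus,0)$ with an involution $\neg:A\to A$ such that $\neg 0\oplus x=\neg 0$ and $\neg(\neg x\oplus y)\oplus y=\neg(\neg y\oplus x)\oplus x$ for all $x,y\in A$; its order is $x\le y$ iff $\neg x\oplus y=\neg 0$. An MV-algebra is profinite if it is isomorphic to an inverse limit of an inverse system of finite MV-algebras indexed by a directed poset. An ideal is a nonempty subset closed under $\oplus$ and downward closed; a maximal ideal is a proper ideal maximal under inclusion; an ideal is principal if it is generated by a single element $a$ (i.e. it equals $\{x: x\le na \text{ for some integer } n\ge 1\}$, where $na=a\oplus\cdots\oplus a$, $n$ times). A homomorphism $\varphi:A\to B$ reflects principal maximal ideals if for every principal maximal ideal $J$ of $B$, $\varphi^{-1}(J)$ is a principal maximal ideal of $A$. $\mathbb{P}$ is the category whose objects are profinite MV-algebras and whose morphisms are the MV-homomorphisms reflecting principal maximal ideals. A multiset is a pair $\langle X,\sigma\rangle$ with $X$ a set and $\sigma:X\to\mathbb{N}$ a map, where $\mathbb{N}=\{1,2,3,\dots\}$. A morphism $\langle X,\sigma\rangle\to\langle Y,\mu\rangle$ is a map $\varphi:X\to Y$ such that $\mu(\varphi(x))$ divides $\sigma(x)$ for all $x\in X$. These form the category $\mathbb{M}$. *)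

theory Defs
  imports "HOL-Algebra.Group" "HOL-Library.Equipollence"
begin

section \<open>Categories and equivalence of categories\<close>

text \<open>
  Hom-sets of different pairs of objects need not be disjoint; therefore composition and the
  action of a functor on arrows take the objects as arguments. Composition is written in
  applicative order: if \<open>f \<in> Hom C x y\<close> and \<open>g \<in> Hom C y z\<close> then \<open>g\<close> after \<open>f\<close> is
  \<open>Comp C x y z g f\<close>.
\<close>

record ('o, 'm) category =
  Obj :: "'o set"
  Hom :: "'o \<Rightarrow> 'o \<Rightarrow> 'm set"
  Comp :: "'o \<Rightarrow> 'o \<Rightarrow> 'o \<Rightarrow> 'm \<Rightarrow> 'm \<Rightarrow> 'm"
  Id :: "'o \<Rightarrow> 'm"

definition is_category :: "('o, 'm) category \<Rightarrow> bool" where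
  "is_category C \<longleftrightarrow>
    (\<forall>x\<in>Obj C. Id C x \<in> Hom C x x) \<and>
    (\<forall>x\<in>Obj C. \<forall>y\<in>Obj C. \<forall>z\<in>Obj C. \<forall>f\<in>Hom C x y. \<forall>g\<in>Hom C y z.
        Comp C x y z g f \<in> Hom C x z) \<and>
    (\<forall>x\<in>Obj C. \<forall>y\<in>Obj C. \<forall>f\<in>Hom C x y.
        Comp C x x y f (Id C x) = f \<and> Comp C x y y (Id C y) f = f) \<and>
    (\<forall>w\<in>Obj C. \<forall>x\<in>Obj C. \<forall>y\<in>Obj C. \<forall>z\<in>Obj C.
      \<forall>f\<in>Hom C w x. \<forall>g\<in>Hom C x y. \<forall>h\<in>Hom C y z.
        Comp C w x z (Comp C x y z h g) f = Comp C w y z h (Comp C w x y g f))"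

definition op_category :: "('o, 'm) category \<Rightarrow> ('o, 'm) category" where
  "op_category C =
    \<lparr> Obj = Obj C,
      Hom = (\<lambda>x y. Hom C y x),
      Comp = (\<lambda>x y z g f. Comp C z y x f g),
      Id = Id C \<rparr>"

definition iso_arrow :: "('o, 'm) category \<Rightarrow> 'o \<Rightarrow> 'o \<Rightarrow> 'm \<Rightarrow> bool" where
  "iso_arrow C x y f \<longleftrightarrow>
    f \<in> Hom C x y \<and>
    (\<exists>g\<in>Hom C y x. Comp C x y x g f = Id C x \<and> Comp C y x y f g = Id C y)"

record ('o, 'm, 'p, 'n) cat_functor =
  omap :: "'o \<Rightarrow> 'p"
  amap :: "'o \<Rightarrow> 'o \<Rightarrow> 'm \<Rightarrow> 'n"

definition is_functor ::
  "('o, 'm) category \<Rightarrow> ('p, 'n) category \<Rightarrow> ('o, 'm, 'p, 'n) cat_functor \<Rightarrow> bool" where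
  "is_functor C D F \<longleftrightarrow>
    (\<forall>x\<in>Obj C. omap F x \<in> Obj D) \<and>
    (\<forall>x\<in>Obj C. \<forall>y\<in>Obj C. \<forall>f\<in>Hom C x y. amap F x y f \<in> Hom D (omap F x) (omap F y)) \<and>
    (\<forall>x\<in>Obj C. amap F x x (Id C x) = Id D (omap F x)) \<and>
    (\<forall>x\<in>Obj C. \<forall>y\<in>Obj C. \<forall>z\<in>Obj C. \<forall>f\<in>Hom C x y. \<forall>g\<in>Hom C y z.
        amap F x z (Comp C x y z g f) =
        Comp D (omap F x) (omap F y) (omap F z) (amap F y z g) (amap F x y f))"

definition id_functor :: "('o, 'm, 'o, 'm) cat_functor" where
  "id_functor = \<lparr> omap = (\<lambda>x. x), amap = (\<lambda>x y f. f) \<rparr>"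

definition comp_functor ::
  "('p, 'n, 'q, 'k) cat_functor \<Rightarrow> ('o, 'm, 'p, 'n) cat_functor \<Rightarrow> ('o, 'm, 'q, 'k) cat_functor"
  where
  "comp_functor G F =
    \<lparr> omap = (\<lambda>x. omap G (omap F x)),
      amap = (\<lambda>x y f. amap G (omap F x) (omap F y) (amap F x y f)) \<rparr>"

definition natural_iso ::
  "('o, 'm) category \<Rightarrow> ('p, 'n) category \<Rightarrow> ('o, 'm, 'p, 'n) cat_functor \<Rightarrow>
    ('o, 'm, 'p, 'n) cat_functor \<Rightarrow> ('o \<Rightarrow> 'n) \<Rightarrow> bool" where
  "natural_iso C D F G \<eta> \<longleftrightarrow>
    (\<forall>x\<in>Obj C. iso_arrow D (omap F x) (omap G x) (\<eta> x)) \<and>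
    (\<forall>x\<in>Obj C. \<forall>y\<in>Obj C. \<forall>f\<in>Hom C x y.
        Comp D (omap F x) (omap F y) (omap G y) (\<eta> y) (amap F x y f) =
        Comp D (omap F x) (omap G x) (omap G y) (amap G x y f) (\<eta> x))"

definition equivalent_categories :: "('o, 'm) category \<Rightarrow> ('p, 'n) category \<Rightarrow> bool" where
  "equivalent_categories C D \<longleftrightarrow>
    is_category C \<and> is_category D \<and>
    (\<exists>F G \<eta> \<epsilon>.
      is_functor C D F \<and> is_functor D C G \<and>
      natural_iso C C id_functor (comp_functor G F) \<eta> \<and>
      natural_iso D D (comp_functor F G) id_functor \<epsilon>)"

definition dually_equivalent :: "('o, 'm) category \<Rightarrow> ('p, 'n) category \<Rightarrow> bool" where
  "dually_equivalent C D \<longleftrightarrow> equivalent_categories C (op_category D)"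


section \<open>MV-algebras\<close>

record 'a mv_algebra = "'a partial_object" +
  mv_plus :: "'a \<Rightarrow> 'a \<Rightarrow> 'a"  (infixl \<open>\<boxplus>\<index>\<close> 65)
  mv_zero :: 'a
  mv_neg :: "'a \<Rightarrow> 'a"

abbreviation mv_monoid :: "'a mv_algebra \<Rightarrow> 'a monoid" where
  "mv_monoid A \<equiv> \<lparr> carrier = carrier A, mult = mv_plus A, one = mv_zero A \<rparr>"

locale mv_algebra =
  fixes A :: "'a mv_algebra" (structure)
  assumes plus_monoid: "comm_monoid (mv_monoid A)"
    and neg_closed: "x \<in> carrier A \<Longrightarrow> mv_neg A x \<in> carrier A"
    and neg_neg: "x \<in> carrier A \<Longrightarrow> mv_neg A (mv_neg A x) = x"
    and neg_zero_plus: "x \<in> carrier A \<Longrightarrow> mv_neg A (mv_zero A) \<boxplus> x = mv_neg A (mv_zero A)"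
    and lukasiewicz: "x \<in> carrier A \<Longrightarrow> y \<in> carrier A \<Longrightarrow>
      mv_neg A (mv_neg A x \<boxplus> y) \<boxplus> y = mv_neg A (mv_neg A y \<boxplus> x) \<boxplus> x"

definition mv_le :: "'a mv_algebra \<Rightarrow> 'a \<Rightarrow> 'a \<Rightarrow> bool" where
  "mv_le A x y \<longleftrightarrow> mv_neg A x \<boxplus>\<^bsub>A\<^esub> y = mv_neg A (mv_zero A)"

definition mv_multiple :: "'a mv_algebra \<Rightarrow> nat \<Rightarrow> 'a \<Rightarrow> 'a" where
  "mv_multiple A n a = a [^]\<^bsub>mv_monoid A\<^esub> n"

text \<open>
  Homomorphisms are extensional (\<open>undefined\<close> outside the carrier of the domain), so that
  equality of homomorphisms is equality on the carrier.
\<close>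

definition mv_hom :: "'a mv_algebra \<Rightarrow> 'b mv_algebra \<Rightarrow> ('a \<Rightarrow> 'b) set" where
  "mv_hom A B = {h \<in> carrier A \<rightarrow>\<^sub>E carrier B.
    h (mv_zero A) = mv_zero B \<and>
    (\<forall>x\<in>carrier A. \<forall>y\<in>carrier A. h (x \<boxplus>\<^bsub>A\<^esub> y) = h x \<boxplus>\<^bsub>B\<^esub> h y) \<and>
    (\<forall>x\<in>carrier A. h (mv_neg A x) = mv_neg B (h x))}"

definition mv_isomorphic :: "'a mv_algebra \<Rightarrow> 'b mv_algebra \<Rightarrow> bool" where
  "mv_isomorphic A B \<longleftrightarrow> (\<exists>h\<in>mv_hom A B. bij_betw h (carrier A) (carrier B))"


subsection \<open>Ideals\<close>

definition mv_ideal :: "'a mv_algebra \<Rightarrow> 'a set \<Rightarrow> bool" where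
  "mv_ideal A J \<longleftrightarrow>
    J \<subseteq> carrier A \<and> J \<noteq> {} \<and>
    (\<forall>x\<in>J. \<forall>y\<in>J. x \<boxplus>\<^bsub>A\<^esub> y \<in> J) \<and>
    (\<forall>x\<in>carrier A. \<forall>y\<in>J. mv_le A x y \<longrightarrow> x \<in> J)"

definition mv_maximal_ideal :: "'a mv_algebra \<Rightarrow> 'a set \<Rightarrow> bool" where
  "mv_maximal_ideal A J \<longleftrightarrow>
    mv_ideal A J \<and> J \<noteq> carrier A \<and>
    (\<forall>K. mv_ideal A K \<longrightarrow> K \<noteq> carrier A \<longrightarrow> J \<subseteq> K \<longrightarrow> K = J)"

definition mv_principal_ideal :: "'a mv_algebra \<Rightarrow> 'a set \<Rightarrow> bool" where
  "mv_principal_ideal A J \<longleftrightarrow>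
    (\<exists>a\<in>carrier A. J = {x \<in> carrier A. \<exists>n\<ge>1. mv_le A x (mv_multiple A n a)})"

definition mv_principal_maximal_ideal :: "'a mv_algebra \<Rightarrow> 'a set \<Rightarrow> bool" where
  "mv_principal_maximal_ideal A J \<longleftrightarrow> mv_maximal_ideal A J \<and> mv_principal_ideal A J"

definition reflects_principal_maximal_ideals ::
  "'a mv_algebra \<Rightarrow> 'b mv_algebra \<Rightarrow> ('a \<Rightarrow> 'b) \<Rightarrow> bool" where
  "reflects_principal_maximal_ideals A B h \<longleftrightarrow>
    (\<forall>J. mv_principal_maximal_ideal B J \<longrightarrow>
      mv_principal_maximal_ideal A {x \<in> carrier A. h x \<in> J})"


subsection \<open>Profinite MV-algebras\<close>

text \<open>
  Here \<open>(i, j) \<in> r\<close> means \<open>i \<le> j\<close>, and \<open>\<phi> i j\<close> is the transition map from \<open>B j\<close> to \<open>B i\<close>.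
\<close>

definition mv_inverse_system ::
  "'i set \<Rightarrow> 'i rel \<Rightarrow> ('i \<Rightarrow> 'b mv_algebra) \<Rightarrow> ('i \<Rightarrow> 'i \<Rightarrow> 'b \<Rightarrow> 'b) \<Rightarrow> bool" where
  "mv_inverse_system I r B \<phi> \<longleftrightarrow>
    partial_order_on I r \<and> I \<noteq> {} \<and>
    (\<forall>i\<in>I. \<forall>j\<in>I. \<exists>k\<in>I. (i, k) \<in> r \<and> (j, k) \<in> r) \<and>
    (\<forall>i\<in>I. mv_algebra (B i)) \<and>
    (\<forall>(i, j)\<in>r. \<phi> i j \<in> mv_hom (B j) (B i)) \<and>
    (\<forall>i\<in>I. \<phi> i i = (\<lambda>x\<in>carrier (B i). x)) \<and>
    (\<forall>i j k. (i, j) \<in> r \<longrightarrow> (j, k) \<in> r \<longrightarrow> \<phi> i k = compose (carrier (B k)) (\<phi> i j) (\<phi> j k))"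

definition mv_inverse_limit ::
  "'i set \<Rightarrow> 'i rel \<Rightarrow> ('i \<Rightarrow> 'b mv_algebra) \<Rightarrow> ('i \<Rightarrow> 'i \<Rightarrow> 'b \<Rightarrow> 'b) \<Rightarrow> ('i \<Rightarrow> 'b) mv_algebra"
  where
  "mv_inverse_limit I r B \<phi> =
    \<lparr> carrier = {x \<in> \<Pi>\<^sub>E i\<in>I. carrier (B i). \<forall>(i, j)\<in>r. \<phi> i j (x j) = x i},
      mv_plus = (\<lambda>x y. \<lambda>i\<in>I. x i \<boxplus>\<^bsub>B i\<^esub> y i),
      mv_zero = (\<lambda>i\<in>I. mv_zero (B i)),
      mv_neg = (\<lambda>x. \<lambda>i\<in>I. mv_neg (B i) (x i)) \<rparr>"

text \<open>
  The type argument \<open>'i\<close> is the universe from which index sets are taken. Letting the finite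
  algebras of the system live on subsets of \<^typ>\<open>nat\<close> is no restriction up to isomorphism.
\<close>

definition mv_profinite :: "'i itself \<Rightarrow> 'a mv_algebra \<Rightarrow> bool" where
  "mv_profinite (_ :: 'i itself) A \<longleftrightarrow>
    mv_algebra A \<and>
    (\<exists>(I :: 'i set) r (B :: 'i \<Rightarrow> nat mv_algebra) \<phi>.
      mv_inverse_system I r B \<phi> \<and> (\<forall>i\<in>I. finite (carrier (B i))) \<and>
      mv_isomorphic A (mv_inverse_limit I r B \<phi>))"


section \<open>The two categories\<close>

text \<open>
  Sets and index posets are both taken from a universe \<open>'a\<close>, and MV-algebras have their carriers
  in a type \<open>'c\<close>. The algebra of a multiset \<open>(X, \<sigma>)\<close> is a product indexed by \<open>X\<close>, so \<open>'c\<close> has to be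
  at least as large as the power set of \<open>'a\<close> for the universes to match. Bounding only the
  cardinality of the carriers would not give corresponding universes, since \<open>2\<^sup>\<kappa> = 2\<^sup>\<lambda>\<close> is
  consistent for distinct infinite cardinals.
\<close>

definition profinite_mv_category ::
  "'i itself \<Rightarrow> ('c mv_algebra, 'c \<Rightarrow> 'c) category" where
  "profinite_mv_category (_ :: 'i itself) =
    \<lparr> Obj = {A. mv_profinite TYPE('i) A},
      Hom = (\<lambda>A B. {h \<in> mv_hom A B. reflects_principal_maximal_ideals A B h}),
      Comp = (\<lambda>A B C g f. compose (carrier A) g f),
      Id = (\<lambda>A. \<lambda>x\<in>carrier A. x) \<rparr>"

text \<open>
  A multiset is a set with a positive multiplicity at each of its points; the multiplicity
  function is extensional.
\<close>

type_synonym 'a mset_obj = "'a set \<times> ('a \<Rightarrow> nat)"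

definition multiset_category :: "('a mset_obj, 'a \<Rightarrow> 'a) category" where
  "multiset_category =
    \<lparr> Obj = {(X, \<sigma>). \<sigma> \<in> X \<rightarrow>\<^sub>E {1..}},
      Hom = (\<lambda>(X, \<sigma>) (Y, \<mu>). {\<phi> \<in> X \<rightarrow>\<^sub>E Y. \<forall>x\<in>X. \<mu> (\<phi> x) dvd \<sigma> x}),
      Comp = (\<lambda>(X, \<sigma>) (Y, \<mu>) (Z, \<nu>) g f. compose X g f),
      Id = (\<lambda>(X, \<sigma>). \<lambda>x\<in>X. x) \<rparr>"

end

theory Submission
  imports Defs "HOL-Algebra.Free_Abelian_Groups"
begin

text \<open>
  A multiset \<open>(X, \<sigma>)\<close> is sent to the product over \<open>X\<close> of the finite chains with \<open>\<sigma> x + 1\<close> elements.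
  The principal maximal ideals of such a product are exactly the kernels of its projections, so a
  homomorphism between two products reflects them iff every coordinate of it factors through a single
  projection; a homomorphism between finite chains exists only under divisibility and is then
  multiplication by the quotient. This makes the functor fully faithful.

  It is essentially surjective because every profinite MV-algebra is such a product: take as
  coordinates all homomorphisms onto finite chains that factor through a member of the inverse
  system. They separate points, since in a finite MV-algebra every atom \<open>t\<close> yields the homomorphism
  that counts how many copies of \<open>t\<close> fit below an element. Finitely many of them take arbitrary
  prescribed values simultaneously, and by separation these interpolants form a compatible family,
  that is, a point of the limit.
\<close>

section \<open>Categories\<close>

text \<open>On an infinite \<open>X\<close> the product also has maximal ideals lying over
  nonprincipal ultrafilters. A homomorphism that pulls a projection kernel back to one of them has a
  coordinate read off no single point of the other index set; the condition on morphisms excludes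
  this, because those ideals are not principal.

  Divisibility comes from negation: a homomorphism between chains is fixed by the image
  \<open>c\<close> of 1, and the predecessor of the top must go to the top minus \<open>c\<close>,
  so the multiples of \<open>c\<close> arrive at the top without truncation.

  The universes match because \<open>'a\<close> is infinite. An inverse system indexed in
  \<open>'a\<close> has finitely many characters at each index, so elements of \<open>'a\<close> can
  name them all; conversely elements of \<open>'a\<close> can name the finite subsets of
  \<open>X\<close>, which index a system with the product as limit. Since products consist of
  functions from \<open>'a\<close> to \<open>nat\<close>, the functor takes values in copies of them
  along a fixed injection into \<open>'c\<close>.\<close>

lemma is_category_op:
  assumes "is_category C" shows "is_category (op_category C)"
  using assms unfolding is_category_def op_category_def by simp

lemma iso_arrow_op:
  "iso_arrow (op_category C) x y f \<longleftrightarrow> iso_arrow C y x f"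
  unfolding iso_arrow_def op_category_def by auto

lemma category_idI: "is_category C \<Longrightarrow> x \<in> Obj C \<Longrightarrow> Id C x \<in> Hom C x x"
  unfolding is_category_def by blast

lemma category_compI:
  "is_category C \<Longrightarrow> x \<in> Obj C \<Longrightarrow> y \<in> Obj C \<Longrightarrow> z \<in> Obj C \<Longrightarrow> f \<in> Hom C x y \<Longrightarrow> g \<in> Hom C y z
    \<Longrightarrow> Comp C x y z g f \<in> Hom C x z"
  unfolding is_category_def by blast

lemma category_id_left:
  "is_category C \<Longrightarrow> x \<in> Obj C \<Longrightarrow> y \<in> Obj C \<Longrightarrow> f \<in> Hom C x y \<Longrightarrow> Comp C x y y (Id C y) f = f"
  unfolding is_category_def by blast

lemma category_id_right:
  "is_category C \<Longrightarrow> x \<in> Obj C \<Longrightarrow> y \<in> Obj C \<Longrightarrow> f \<in> Hom C x y \<Longrightarrow> Comp C x x y f (Id C x) = f"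
  unfolding is_category_def by blast

lemma category_assoc:
  "is_category C \<Longrightarrow> w \<in> Obj C \<Longrightarrow> x \<in> Obj C \<Longrightarrow> y \<in> Obj C \<Longrightarrow> z \<in> Obj C
    \<Longrightarrow> f \<in> Hom C w x \<Longrightarrow> g \<in> Hom C x y \<Longrightarrow> h \<in> Hom C y z
    \<Longrightarrow> Comp C w x z (Comp C x y z h g) f = Comp C w y z h (Comp C w x y g f)"
  unfolding is_category_def by blast

lemma functor_obj: "is_functor C D F \<Longrightarrow> x \<in> Obj C \<Longrightarrow> omap F x \<in> Obj D"
  unfolding is_functor_def by blast

lemma functor_arr:
  "is_functor C D F \<Longrightarrow> x \<in> Obj C \<Longrightarrow> y \<in> Obj C \<Longrightarrow> f \<in> Hom C x y
    \<Longrightarrow> amap F x y f \<in> Hom D (omap F x) (omap F y)"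
  unfolding is_functor_def by blast

lemma functor_id: "is_functor C D F \<Longrightarrow> x \<in> Obj C \<Longrightarrow> amap F x x (Id C x) = Id D (omap F x)"
  unfolding is_functor_def by blast

lemma functor_comp:
  "is_functor C D F \<Longrightarrow> x \<in> Obj C \<Longrightarrow> y \<in> Obj C \<Longrightarrow> z \<in> Obj C \<Longrightarrow> f \<in> Hom C x y \<Longrightarrow> g \<in> Hom C y z
    \<Longrightarrow> amap F x z (Comp C x y z g f) =
        Comp D (omap F x) (omap F y) (omap F z) (amap F y z g) (amap F x y f)"
  unfolding is_functor_def by blast

text \<open>The inverse functor chooses for every \<open>d\<close> an object \<open>G0 d\<close> and
  an isomorphism \<open>e d\<close> from its image to \<open>d\<close>, conjugates arrows of
  \<open>D\<close> by these isomorphisms and lifts the result through the hom-set bijections.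
  Equations in \<open>C\<close> are proved by applying \<open>F\<close> and using
  faithfulness.\<close>

theorem fully_faithful_essentially_surjective_imp_equivalent:
  fixes C :: "('o, 'm) category" and D :: "('p, 'n) category"
  assumes C: "is_category C" and D: "is_category D" and F: "is_functor C D F"
    and ff: "\<And>x y. x \<in> Obj C \<Longrightarrow> y \<in> Obj C \<Longrightarrow>
      bij_betw (amap F x y) (Hom C x y) (Hom D (omap F x) (omap F y))"
    and es: "\<And>d. d \<in> Obj D \<Longrightarrow> \<exists>c\<in>Obj C. \<exists>f. iso_arrow D (omap F c) d f"
  shows "equivalent_categories C D"
proof -
  from es obtain G0 e where G0: "\<And>d. d \<in> Obj D \<Longrightarrow> G0 d \<in> Obj C"
    and e: "\<And>d. d \<in> Obj D \<Longrightarrow> iso_arrow D (omap F (G0 d)) d (e d)" by metis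
  define FG where "FG d = omap F (G0 d)" for d
  have FGo [simp]: "d \<in> Obj D \<Longrightarrow> FG d \<in> Obj D" for d
    using functor_obj[OF F G0] by (simp add: FG_def)
  have eh: "\<And>d. d \<in> Obj D \<Longrightarrow> e d \<in> Hom D (FG d) d"
    and "\<And>d. d \<in> Obj D \<Longrightarrow> \<exists>e'\<in>Hom D d (FG d).
       Comp D (FG d) d (FG d) e' (e d) = Id D (FG d) \<and> Comp D d (FG d) d (e d) e' = Id D d"
    using e unfolding iso_arrow_def FG_def by blast+
  then obtain e' where e'h: "\<And>d. d \<in> Obj D \<Longrightarrow> e' d \<in> Hom D d (FG d)"
    and e'e: "\<And>d. d \<in> Obj D \<Longrightarrow> Comp D (FG d) d (FG d) (e' d) (e d) = Id D (FG d)"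
    and ee': "\<And>d. d \<in> Obj D \<Longrightarrow> Comp D d (FG d) d (e d) (e' d) = Id D d"
    by metis
  \<comment> \<open>The conjugate of \<open>g\<close> by the chosen isomorphisms. \<open>G\<close>
    will be its lift, so \<open>M\<close> describes \<open>F\<close> after \<open>G\<close>, and
    functoriality of \<open>G\<close> reduces to that of \<open>M\<close>.\<close>
  define M where "M d d' g = Comp D (FG d) d' (FG d') (e' d') (Comp D (FG d) d d' g (e d))" for d d' g
  define lift where "lift x y = inv_into (Hom C x y) (amap F x y)" for x y
  define G where "G = \<lparr> omap = G0, amap = (\<lambda>d d' g. lift (G0 d) (G0 d') (M d d' g)) \<rparr>"
  have lift_h: "lift x y g \<in> Hom C x y" and F_lift: "amap F x y (lift x y g) = g"
    if "x \<in> Obj C" "y \<in> Obj C" "g \<in> Hom D (omap F x) (omap F y)" for x y g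
    using bij_betw_inv_into_right[OF ff] bij_betwE[OF bij_betw_inv_into[OF ff]] that
    unfolding lift_def by blast+
  have faithful: "f = f'" if "x \<in> Obj C" "y \<in> Obj C" "f \<in> Hom C x y" "f' \<in> Hom C x y"
      "amap F x y f = amap F x y f'" for x y f f'
    using ff[of x y] that unfolding bij_betw_def inj_on_def by blast
  have Mh: "M d d' g \<in> Hom D (FG d) (FG d')" if "d \<in> Obj D" "d' \<in> Obj D" "g \<in> Hom D d d'" for d d' g
    unfolding M_def using that by (intro category_compI[OF D _ _ _ _ e'h] category_compI[OF D _ _ _ eh]) auto
  have Gh: "amap G d d' g \<in> Hom C (G0 d) (G0 d')" and FGa: "amap F (G0 d) (G0 d') (amap G d d' g) = M d d' g"
    if "d \<in> Obj D" "d' \<in> Obj D" "g \<in> Hom D d d'" for d d' g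
    using lift_h[OF G0 G0] F_lift[OF G0 G0] Mh that unfolding G_def FG_def by auto
  \<comment> \<open>Naturality of \<open>e\<close>; it also yields \<open>M_comp\<close>, where it
    moves \<open>e\<close> past the inner conjugate.\<close>
  have eM: "Comp D (FG d) (FG d') d' (e d') (M d d' g) = Comp D (FG d) d d' g (e d)"
    if d: "d \<in> Obj D" "d' \<in> Obj D" and g: "g \<in> Hom D d d'" for d d' g
  proof -
    have c: "Comp D (FG d) d d' g (e d) \<in> Hom D (FG d) d'"
      using category_compI[OF D _ _ _ eh g] d by auto
    have "Comp D (FG d) (FG d') d' (e d') (M d d' g) =
        Comp D (FG d) d' d' (Comp D d' (FG d') d' (e d') (e' d')) (Comp D (FG d) d d' g (e d))"
      unfolding M_def using category_assoc[OF D _ _ _ _ c e'h eh] d by auto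
    then show ?thesis using category_id_left[OF D _ _ c] d by (simp add: ee')
  qed
  have M_id: "M d d (Id D d) = Id D (FG d)" if d: "d \<in> Obj D" for d
    unfolding M_def using d category_id_left[OF D _ _ eh] e'e by auto
  have M_comp: "M x z (Comp D x y z g f) = Comp D (FG x) (FG y) (FG z) (M y z g) (M x y f)"
    if o: "x \<in> Obj D" "y \<in> Obj D" "z \<in> Obj D" and f: "f \<in> Hom D x y" and g: "g \<in> Hom D y z" for x y z f g
  proof -
    have "Comp D (FG x) (FG y) (FG z) (M y z g) (M x y f) =
      Comp D (FG x) z (FG z) (e' z) (Comp D (FG x) (FG y) z (Comp D (FG y) y z g (e y)) (M x y f))"
      unfolding M_def[of y z g] using category_assoc[OF D _ _ _ _ Mh category_compI[OF D _ _ _ eh g] e'h] o f by auto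
    also have "Comp D (FG x) (FG y) z (Comp D (FG y) y z g (e y)) (M x y f) =
      Comp D (FG x) y z g (Comp D (FG x) (FG y) y (e y) (M x y f))"
      using category_assoc[OF D _ _ _ _ Mh eh g] o f by auto
    also have "\<dots> = Comp D (FG x) y z g (Comp D (FG x) x y f (e x))"
      using eM o f by auto
    also have "\<dots> = Comp D (FG x) x z (Comp D x y z g f) (e x)"
      using category_assoc[OF D _ _ _ _ eh f g] o by auto
    finally show ?thesis unfolding M_def by simp
  qed
  have GF: "is_functor D C G"
    unfolding is_functor_def
  proof (intro conjI ballI)
    fix x assume x: "x \<in> Obj D"
    then show "omap G x \<in> Obj C" by (simp add: G_def G0)
    have i: "Id D x \<in> Hom D x x" using category_idI[OF D x] .
    show "amap G x x (Id D x) = Id C (omap G x)"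
      using Gh[OF x x i] FGa[OF x x i] M_id[OF x] functor_id[OF F G0[OF x]] x
      by (intro faithful[of "G0 x" "G0 x"]) (auto simp: G0 G_def FG_def category_idI[OF C])
  next
    fix x y f assume "x \<in> Obj D" "y \<in> Obj D" "f \<in> Hom D x y"
    then show "amap G x y f \<in> Hom C (omap G x) (omap G y)" using Gh by (simp add: G_def)
  next
    fix x y z f g assume o: "x \<in> Obj D" "y \<in> Obj D" "z \<in> Obj D" and f: "f \<in> Hom D x y" and g: "g \<in> Hom D y z"
    have gf: "Comp D x y z g f \<in> Hom D x z" using category_compI[OF D o f g] .
    have "amap F (G0 x) (G0 z) (Comp C (G0 x) (G0 y) (G0 z) (amap G y z g) (amap G x y f))
        = Comp D (FG x) (FG y) (FG z) (M y z g) (M x y f)"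
      using functor_comp[OF F G0 G0 G0 Gh Gh] FGa o f g by (simp add: FG_def)
    also have "\<dots> = amap F (G0 x) (G0 z) (amap G x z (Comp D x y z g f))"
      using M_comp[OF o f g] FGa o gf by simp
    finally show "amap G x z (Comp D x y z g f) =
        Comp C (omap G x) (omap G y) (omap G z) (amap G y z g) (amap G x y f)"
      using category_compI[OF C _ _ _ Gh Gh] Gh o f g gf
      by (intro faithful[of "G0 x" "G0 z"]) (auto simp: G0 G_def)
  qed
  have eps: "natural_iso D D (comp_functor F G) id_functor e"
    unfolding natural_iso_def
  proof (intro conjI ballI)
    fix x assume "x \<in> Obj D"
    then show "iso_arrow D (omap (comp_functor F G) x) (omap id_functor x) (e x)"
      using e by (simp add: comp_functor_def id_functor_def G_def)
  next
    fix x y f assume "x \<in> Obj D" "y \<in> Obj D" "f \<in> Hom D x y"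
    then show "Comp D (omap (comp_functor F G) x) (omap (comp_functor F G) y) (omap id_functor y) (e y)
            (amap (comp_functor F G) x y f) =
           Comp D (omap (comp_functor F G) x) (omap id_functor x) (omap id_functor y)
            (amap id_functor x y f) (e x)"
      using eM FGa by (simp add: comp_functor_def id_functor_def G_def FG_def)
  qed
  \<comment> \<open>The arrow \<open>e' (omap F x)\<close> runs from \<open>omap F x\<close> to the
    image of \<open>G0 (omap F x)\<close>, so fullness lifts it to a unit. The lift
    \<open>\<theta>\<close> of \<open>e (omap F x)\<close> is its inverse because the two are
    inverse after applying \<open>F\<close>.\<close>
  define \<eta> where "\<eta> x = lift x (G0 (omap F x)) (e' (omap F x))" for x
  define \<theta> where "\<theta> x = lift (G0 (omap F x)) x (e (omap F x))" for x
  have Fx: "omap F x \<in> Obj D" "G0 (omap F x) \<in> Obj C" if "x \<in> Obj C" for x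
    using functor_obj[OF F that] G0 by auto
  have \<eta>: "\<eta> x \<in> Hom C x (G0 (omap F x))" "amap F x (G0 (omap F x)) (\<eta> x) = e' (omap F x)"
    and \<theta>: "\<theta> x \<in> Hom C (G0 (omap F x)) x" "amap F (G0 (omap F x)) x (\<theta> x) = e (omap F x)"
    if x: "x \<in> Obj C" for x
    using lift_h[OF x Fx(2)[OF x], of "e' (omap F x)"] F_lift[OF x Fx(2)[OF x], of "e' (omap F x)"] e'h[OF Fx(1)[OF x]]
      lift_h[OF Fx(2)[OF x] x, of "e (omap F x)"] F_lift[OF Fx(2)[OF x] x, of "e (omap F x)"] eh[OF Fx(1)[OF x]]
    unfolding \<eta>_def \<theta>_def FG_def by auto
  have eta: "natural_iso C C id_functor (comp_functor G F) \<eta>"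
    unfolding natural_iso_def
  proof (intro conjI ballI)
    fix x assume x: "x \<in> Obj C"
    note Fx = Fx[OF x] and \<eta> = \<eta>[OF x] and \<theta> = \<theta>[OF x]
    have "Comp C x (G0 (omap F x)) x (\<theta> x) (\<eta> x) = Id C x"
      using functor_comp[OF F x Fx(2) x \<eta>(1) \<theta>(1)] \<eta>(2) \<theta>(2) ee'[OF Fx(1)] functor_id[OF F x]
      by (intro faithful[OF x x]) (auto simp: FG_def category_idI[OF C x] category_compI[OF C x Fx(2) x \<eta>(1) \<theta>(1)])
    moreover have "Comp C (G0 (omap F x)) x (G0 (omap F x)) (\<eta> x) (\<theta> x) = Id C (G0 (omap F x))"
      using functor_comp[OF F Fx(2) x Fx(2) \<theta>(1) \<eta>(1)] \<eta>(2) \<theta>(2) e'e[OF Fx(1)] functor_id[OF F Fx(2)]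
      by (intro faithful[OF Fx(2) Fx(2)])
        (auto simp: FG_def category_idI[OF C Fx(2)] category_compI[OF C Fx(2) x Fx(2) \<theta>(1) \<eta>(1)])
    ultimately show "iso_arrow C (omap id_functor x) (omap (comp_functor G F) x) (\<eta> x)"
      unfolding iso_arrow_def using \<eta>(1) \<theta>(1) by (auto simp: id_functor_def comp_functor_def G_def)
  next
    fix x y f assume x: "x \<in> Obj C" and y: "y \<in> Obj C" and f: "f \<in> Hom C x y"
    let ?x = "omap F x" and ?y = "omap F y" and ?f = "amap F x y f"
    have Ff: "?f \<in> Hom D ?x ?y" using functor_arr[OF F x y f] .
    note gf = Gh[OF Fx(1)[OF x] Fx(1)[OF y] Ff]
    have "amap F x (G0 ?y) (Comp C x (G0 ?x) (G0 ?y) (amap G ?x ?y ?f) (\<eta> x))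
       = Comp D ?x (FG ?x) (FG ?y) (M ?x ?y ?f) (e' ?x)"
      using functor_comp[OF F x Fx(2)[OF x] Fx(2)[OF y] \<eta>(1)[OF x] gf] \<eta>(2)[OF x] FGa[OF Fx(1)[OF x] Fx(1)[OF y] Ff]
      by (simp add: FG_def)
    also have "\<dots> = Comp D ?x ?y (FG ?y) (e' ?y) (Comp D ?x (FG ?x) ?y (Comp D (FG ?x) ?x ?y ?f (e ?x)) (e' ?x))"
      unfolding M_def using category_assoc[OF D _ _ _ _ e'h category_compI[OF D _ _ _ eh Ff] e'h] Fx x y by auto
    also have "Comp D ?x (FG ?x) ?y (Comp D (FG ?x) ?x ?y ?f (e ?x)) (e' ?x)
       = Comp D ?x ?x ?y ?f (Comp D ?x (FG ?x) ?x (e ?x) (e' ?x))"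
      using category_assoc[OF D _ _ _ _ e'h eh Ff] Fx x y by auto
    also have "\<dots> = ?f"
      using category_id_right[OF D _ _ Ff] ee' Fx x y by simp
    also have "Comp D ?x ?y (FG ?y) (e' ?y) ?f = amap F x (G0 ?y) (Comp C x y (G0 ?y) (\<eta> y) f)"
      using functor_comp[OF F x y Fx(2)[OF y] f \<eta>(1)[OF y]] \<eta>(2)[OF y] by (simp add: FG_def)
    finally have "Comp C x y (G0 ?y) (\<eta> y) f = Comp C x (G0 ?x) (G0 ?y) (amap G ?x ?y ?f) (\<eta> x)"
      using category_compI[OF C x y Fx(2)[OF y] f \<eta>(1)[OF y]]
        category_compI[OF C x Fx(2)[OF x] Fx(2)[OF y] \<eta>(1)[OF x] gf]
      by (intro faithful[OF x Fx(2)[OF y]]) auto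
    then show "Comp C (omap id_functor x) (omap id_functor y) (omap (comp_functor G F) y) (\<eta> y)
            (amap id_functor x y f) =
           Comp C (omap id_functor x) (omap (comp_functor G F) x) (omap (comp_functor G F) y)
            (amap (comp_functor G F) x y f) (\<eta> x)"
      by (simp add: id_functor_def comp_functor_def G_def)
  qed
  show ?thesis
    unfolding equivalent_categories_def using C D F GF eps eta by blast
qed

section \<open>Arithmetic of MV-algebras\<close>

context mv_algebra
begin

abbreviation "zro \<equiv> mv_zero A"
abbreviation "neg \<equiv> mv_neg A"
abbreviation mv_less_eq (infix \<open>\<preceq>\<close> 50) where "x \<preceq> y \<equiv> mv_le A x y"
abbreviation minus (infixl \<open>\<ominus>\<close> 65) where "x \<ominus> y \<equiv> neg (neg x \<boxplus> y)"
abbreviation "mul \<equiv> mv_multiple A"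

lemma plus_closed [simp]: "x \<in> carrier A \<Longrightarrow> y \<in> carrier A \<Longrightarrow> x \<boxplus> y \<in> carrier A"
  using comm_monoid.axioms(1)[OF plus_monoid] monoid.m_closed by fastforce

lemma zero_closed [simp]: "zro \<in> carrier A"
  using comm_monoid.axioms(1)[OF plus_monoid] monoid.one_closed by fastforce

declare neg_closed [simp] neg_neg [simp]

lemma plus_assoc:
  "x \<in> carrier A \<Longrightarrow> y \<in> carrier A \<Longrightarrow> z \<in> carrier A \<Longrightarrow> x \<boxplus> y \<boxplus> z = x \<boxplus> (y \<boxplus> z)"
  using monoid.m_assoc[OF comm_monoid.axioms(1)[OF plus_monoid]] by fastforce

lemma plus_comm: "x \<in> carrier A \<Longrightarrow> y \<in> carrier A \<Longrightarrow> x \<boxplus> y = y \<boxplus> x"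
  using comm_monoid.m_comm[OF plus_monoid] by fastforce

lemma plus_left_comm:
  "x \<in> carrier A \<Longrightarrow> y \<in> carrier A \<Longrightarrow> z \<in> carrier A \<Longrightarrow> x \<boxplus> (y \<boxplus> z) = y \<boxplus> (x \<boxplus> z)"
  by (metis plus_assoc plus_comm)

lemma zero_plus [simp]: "x \<in> carrier A \<Longrightarrow> zro \<boxplus> x = x"
  using monoid.l_one[OF comm_monoid.axioms(1)[OF plus_monoid]] by fastforce

lemma plus_zero [simp]: "x \<in> carrier A \<Longrightarrow> x \<boxplus> zro = x"
  using plus_comm by force

lemma top_plus [simp]: "x \<in> carrier A \<Longrightarrow> neg zro \<boxplus> x = neg zro"
  by (rule neg_zero_plus)

lemma plus_top [simp]: "x \<in> carrier A \<Longrightarrow> x \<boxplus> neg zro = neg zro"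
  using plus_comm by force

text \<open>The Lukasiewicz axiom with the top as second argument: one side collapses to the top,
  the other to \<open>neg x \<boxplus> x\<close>.\<close>

lemma neg_plus_self [simp]: "x \<in> carrier A \<Longrightarrow> neg x \<boxplus> x = neg zro"
  using lukasiewicz[of x "neg zro"] by simp

lemma self_plus_neg [simp]: "x \<in> carrier A \<Longrightarrow> x \<boxplus> neg x = neg zro"
  using plus_comm by force

lemma le_refl: "x \<in> carrier A \<Longrightarrow> x \<preceq> x"
  by (simp add: mv_le_def)

lemma le_plus: "x \<in> carrier A \<Longrightarrow> y \<in> carrier A \<Longrightarrow> x \<preceq> x \<boxplus> y"
  by (simp add: mv_le_def flip: plus_assoc)

lemma le_plus2: "x \<in> carrier A \<Longrightarrow> y \<in> carrier A \<Longrightarrow> x \<preceq> y \<boxplus> x"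
  using le_plus plus_comm by simp

text \<open>Both sides of the Lukasiewicz axiom are the join of \<open>x\<close> and
  \<open>y\<close>. The witness \<open>y \<ominus> x\<close> turns inequalities into sums, which is
  how \<open>le_trans\<close> and \<open>plus_mono\<close> are obtained.\<close>

lemma le_eq_plus_minus: "x \<in> carrier A \<Longrightarrow> y \<in> carrier A \<Longrightarrow> x \<preceq> y \<Longrightarrow> y = x \<boxplus> (y \<ominus> x)"
  using lukasiewicz[of x y] by (simp add: mv_le_def plus_comm)

lemma le_antisym: "x \<in> carrier A \<Longrightarrow> y \<in> carrier A \<Longrightarrow> x \<preceq> y \<Longrightarrow> y \<preceq> x \<Longrightarrow> x = y"
  using lukasiewicz[of x y] by (simp add: mv_le_def)

lemma le_trans:
  assumes "x \<in> carrier A" "y \<in> carrier A" "z \<in> carrier A" "x \<preceq> y" "y \<preceq> z" shows "x \<preceq> z"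
proof -
  have "z = x \<boxplus> ((y \<ominus> x) \<boxplus> (z \<ominus> y))"
    using assms le_eq_plus_minus[of x y] le_eq_plus_minus[of y z] by (simp flip: plus_assoc)
  then show ?thesis using assms le_plus[of x "(y \<ominus> x) \<boxplus> (z \<ominus> y)"] by simp
qed

lemma plus_mono:
  assumes "x \<in> carrier A" "y \<in> carrier A" "x' \<in> carrier A" "y' \<in> carrier A" "x \<preceq> x'" "y \<preceq> y'"
  shows "x \<boxplus> y \<preceq> x' \<boxplus> y'"
proof -
  have "x' \<boxplus> y' = x \<boxplus> y \<boxplus> ((x' \<ominus> x) \<boxplus> (y' \<ominus> y))"
    by (subst le_eq_plus_minus[of x x'], (simp add: assms)+, subst le_eq_plus_minus[of y y'],
        (simp add: assms)+, simp add: assms plus_assoc plus_left_comm)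
  then show ?thesis using assms le_plus[of "x \<boxplus> y"] by simp
qed

text \<open>Residuation: unfolding the order turns both sides into the same equation up to
  associativity.\<close>

lemma minus_le_iff:
  "x \<in> carrier A \<Longrightarrow> y \<in> carrier A \<Longrightarrow> z \<in> carrier A \<Longrightarrow> x \<ominus> y \<preceq> z \<longleftrightarrow> x \<preceq> y \<boxplus> z"
  by (simp add: mv_le_def plus_assoc)

lemma minus_le: "x \<in> carrier A \<Longrightarrow> y \<in> carrier A \<Longrightarrow> x \<ominus> y \<preceq> x"
  by (simp add: minus_le_iff le_plus2)

lemma zero_le [simp]: "x \<in> carrier A \<Longrightarrow> zro \<preceq> x"
  by (simp add: mv_le_def)

lemma le_top: "x \<in> carrier A \<Longrightarrow> x \<preceq> neg zro"
  by (simp add: mv_le_def)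

lemma le_zeroD: "x \<in> carrier A \<Longrightarrow> x \<preceq> zro \<Longrightarrow> x = zro"
  by (simp add: le_antisym)

lemma minus_eq_zero_iff: "x \<in> carrier A \<Longrightarrow> y \<in> carrier A \<Longrightarrow> x \<ominus> y = zro \<longleftrightarrow> x \<preceq> y"
  unfolding mv_le_def by (metis neg_closed neg_neg plus_closed zero_closed)

lemma le_neg: "x \<in> carrier A \<Longrightarrow> y \<in> carrier A \<Longrightarrow> x \<preceq> y \<Longrightarrow> neg y \<preceq> neg x"
  by (simp add: mv_le_def plus_comm)

text \<open>The premise \<open>x \<preceq> neg z\<close> says that the sum
  \<open>x \<boxplus> z\<close> is not truncated. In general the left side is the meet of
  \<open>x\<close> and \<open>neg z\<close>.\<close>

lemma plus_minus_cancel: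
  assumes "x \<in> carrier A" "z \<in> carrier A" "x \<preceq> neg z" shows "(x \<boxplus> z) \<ominus> z = x"
proof -
  have "neg x \<boxplus> neg z = neg zro" using assms by (simp add: mv_le_def)
  then have "neg (neg z \<boxplus> neg x) \<boxplus> neg x = neg x"
    using assms plus_comm[of "neg x" "neg z"] by simp
  then show ?thesis using lukasiewicz[of "neg x" z] assms by simp
qed

lemma plus_cancel:
  assumes "x \<in> carrier A" "y \<in> carrier A" "z \<in> carrier A" "x \<preceq> neg z" "y \<preceq> neg z" "x \<boxplus> z = y \<boxplus> z"
  shows "x = y"
  using plus_minus_cancel[of x z] plus_minus_cancel[of y z] assms by metis

text \<open>Expresses that the meet is zero, without introducing the lattice operations.\<close>

definition disj :: "'a \<Rightarrow> 'a \<Rightarrow> bool" where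
  "disj x y \<longleftrightarrow> (\<forall>w\<in>carrier A. w \<preceq> x \<longrightarrow> w \<preceq> y \<longrightarrow> w = zro)"

lemma disj_sym: "disj x y \<longleftrightarrow> disj y x"
  by (auto simp: disj_def)

lemma disj_zero: "disj zro x"
  by (simp add: disj_def le_zeroD)

text \<open>If \<open>w\<close> lies below \<open>r \<boxplus> s\<close> and \<open>t\<close>, then
  \<open>w \<ominus> r\<close> lies below \<open>s\<close> and \<open>t\<close> by residuation,
  hence is zero; so \<open>w\<close> lies below \<open>r\<close> already.\<close>

lemma disj_plus:
  assumes "r \<in> carrier A" "s \<in> carrier A" "t \<in> carrier A" "disj r t" "disj s t"
  shows "disj (r \<boxplus> s) t"
  unfolding disj_def
proof (intro ballI impI)
  fix w assume w: "w \<in> carrier A" "w \<preceq> r \<boxplus> s" "w \<preceq> t"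
  have "w \<ominus> r \<preceq> s" using w assms by (simp add: minus_le_iff)
  moreover have "w \<ominus> r \<preceq> t" using le_trans[of _ w t] minus_le w assms by simp
  ultimately have "w \<ominus> r = zro" using assms w by (simp add: disj_def)
  then show "w = zro" using assms w by (simp add: minus_eq_zero_iff disj_def)
qed

text \<open>A common lower bound \<open>w\<close> can be added to \<open>e\<close> without
  truncation, yet the sum stays below \<open>e \<boxplus> e = e\<close>; cancelling \<open>e\<close>
  leaves \<open>w = zro\<close>.\<close>

lemma idempotent_disj_neg:
  assumes "e \<in> carrier A" "e \<boxplus> e = e" shows "disj (neg e) e"
  unfolding disj_def
proof (intro ballI impI)
  fix w assume w: "w \<in> carrier A" "w \<preceq> neg e" "w \<preceq> e"
  have "w \<boxplus> e \<preceq> e" using plus_mono[of w e e e] w assms le_refl by simp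
  then have "w \<boxplus> e = zro \<boxplus> e" using le_plus2[of e w] le_antisym w assms by simp
  then show "w = zro" using plus_cancel[of w zro e] w assms by simp
qed

lemma mult_0 [simp]: "mul 0 x = zro" and mult_Suc: "mul (Suc n) x = mul n x \<boxplus> x"
  by (simp_all add: mv_multiple_def)

lemma mult_closed [simp]: "x \<in> carrier A \<Longrightarrow> mul n x \<in> carrier A"
  by (induction n) (simp_all add: mult_Suc)

lemma mult_add: "x \<in> carrier A \<Longrightarrow> mul (m + n) x = mul m x \<boxplus> mul n x"
  by (induction n) (simp_all add: mult_Suc plus_assoc)

lemma mult_le_mult: "x \<in> carrier A \<Longrightarrow> m \<le> n \<Longrightarrow> mul m x \<preceq> mul n x"
  using mult_add[of x m "n - m"] le_plus by simp

lemma disj_mult: "x \<in> carrier A \<Longrightarrow> t \<in> carrier A \<Longrightarrow> disj x t \<Longrightarrow> disj (mul n x) t"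
  by (induction n) (simp_all add: mult_Suc disj_zero disj_plus)

end


section \<open>Finite MV-algebras\<close>

text \<open>The Lukasiewicz chain of multiples of \<open>1/n\<close> in the unit interval, scaled by
  \<open>n\<close>. At \<open>n = 0\<close> it is the trivial algebra, hence the conditions
  \<open>n \<ge> 1\<close> below.\<close>

definition mv_chain :: "nat \<Rightarrow> nat mv_algebra" where
  "mv_chain n = \<lparr> carrier = {..n}, mv_plus = (\<lambda>x y. min n (x + y)), mv_zero = 0, mv_neg = (\<lambda>x. n - x) \<rparr>"

lemma mv_chain_simps [simp]:
  "carrier (mv_chain n) = {..n}" "mv_plus (mv_chain n) x y = min n (x + y)"
  "mv_zero (mv_chain n) = 0" "mv_neg (mv_chain n) x = n - x"
  by (simp_all add: mv_chain_def)

lemma mv_algebra_mv_chain: "mv_algebra (mv_chain n)"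
  unfolding mv_algebra_def
proof (intro conjI allI impI)
  show "comm_monoid (mv_monoid (mv_chain n))"
    by (intro comm_monoidI) (simp_all add: add_ac)
  fix x y assume "x \<in> carrier (mv_chain n)" "y \<in> carrier (mv_chain n)"
  then show "mv_neg (mv_chain n) (mv_neg (mv_chain n) x \<boxplus>\<^bsub>mv_chain n\<^esub> y) \<boxplus>\<^bsub>mv_chain n\<^esub> y =
       mv_neg (mv_chain n) (mv_neg (mv_chain n) y \<boxplus>\<^bsub>mv_chain n\<^esub> x) \<boxplus>\<^bsub>mv_chain n\<^esub> x"
    by simp
qed simp_all

text \<open>Every \<open>x\<close> splits as \<open>kt + r\<close> with \<open>r\<close> disjoint from the atom \<open>t\<close>, and \<open>x \<mapsto> k\<close> is a
  homomorphism onto a finite chain.\<close>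

locale finite_mv_atom = mv_algebra +
  fixes t
  assumes fin: "finite (carrier A)"
    and t: "t \<in> carrier A" "t \<noteq> mv_zero A"
    and atom: "\<And>w. w \<in> carrier A \<Longrightarrow> mv_le A w t \<Longrightarrow> w = mv_zero A \<or> w = t"
begin

text \<open>The multiples of \<open>t\<close> ascend strictly until they become stationary;
  \<open>N\<close> is the point where this happens and will be the length of the chain.\<close>

definition "N = (LEAST n. mul (Suc n) t = mul n t)"

text \<open>By finiteness two multiples of \<open>t\<close> coincide, and monotonicity squeezes the
  multiples between them.\<close>

lemma mult_N: "mul (Suc N) t = mul N t"
proof -
  have "\<not> inj (\<lambda>n. mul n t)"
  proof
    assume "inj (\<lambda>n. mul n t)"
    then have "finite (UNIV :: nat set)"
      by (rule inj_on_finite[of _ _ "carrier A"]) (use t fin in auto)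
    then show False by simp
  qed
  then obtain m n where mn: "m < n" "mul m t = mul n t"
    unfolding inj_def by (metis linorder_neqE_nat)
  have "mul (Suc m) t \<preceq> mul m t"
    using mult_le_mult[OF t(1), of "Suc m" n] mn by simp
  moreover have "mul m t \<preceq> mul (Suc m) t"
    using mult_le_mult[OF t(1)] by simp
  ultimately have "mul (Suc m) t = mul m t"
    using t le_antisym by simp
  then show ?thesis unfolding N_def by (rule LeastI)
qed

lemma mult_ge_N: "mul (N + k) t = mul N t"
proof (induction k)
  case (Suc k)
  have "mul (N + Suc k) t = mul (N + k) t \<boxplus> t" by (simp add: mult_Suc)
  also have "\<dots> = mul (Suc N) t" using Suc by (simp add: mult_Suc)
  finally show ?case using mult_N by simp
qed simp

lemma mult_min: "mul (min N k) t = mul k t"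
proof (cases "N \<le> k")
  case True
  then have "mul k t = mul (N + (k - N)) t" by simp
  then show ?thesis using True by (simp only: mult_ge_N min_absorb1)
next
  case False
  then have "min N k = k" by simp
  then show ?thesis by (simp only:)
qed

text \<open>If \<open>k < j\<close>, the multiples would be stationary from \<open>k\<close> on, and
  minimality of \<open>N\<close> would give \<open>N \<le> k < j\<close>.\<close>

lemma mult_le_multD: "mul j t \<preceq> mul k t \<Longrightarrow> j \<le> N \<Longrightarrow> j \<le> k"
proof (rule ccontr)
  assume j: "mul j t \<preceq> mul k t" "j \<le> N" "\<not> j \<le> k"
  then have "mul (Suc k) t \<preceq> mul k t"
    using mult_le_mult[OF t(1), of "Suc k" j] le_trans[of "mul (Suc k) t" "mul j t" "mul k t"] t by simp
  then have "mul (Suc k) t = mul k t"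
    using mult_le_mult[OF t(1), of k "Suc k"] t le_antisym by simp
  then have "N \<le> k" unfolding N_def by (rule Least_le)
  with j show False by simp
qed

lemma N_pos: "N \<ge> 1"
proof (rule ccontr)
  assume "\<not> N \<ge> 1"
  then have "N = 0" by simp
  then show False using mult_N t by (simp add: mult_Suc)
qed

lemma disj_atom: "x \<in> carrier A \<Longrightarrow> \<not> t \<preceq> x \<Longrightarrow> disj x t"
  unfolding disj_def using atom by blast

text \<open>Take for \<open>k\<close> the largest number up to \<open>N\<close> of copies of
  \<open>t\<close> that fit below \<open>x\<close>. If \<open>k < N\<close>, one more copy below the
  remainder would contradict maximality. If \<open>k = N\<close>, maximality says nothing; instead
  \<open>mul N t\<close> is idempotent, hence disjoint from its complement, and the remainder lies
  below that complement.\<close>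

lemma decomposition:
  assumes x: "x \<in> carrier A"
  obtains k r where "k \<le> N" "r \<in> carrier A" "disj r t" "x = mul k t \<boxplus> r"
proof -
  define k where "k = (GREATEST k. k \<le> N \<and> mul k t \<preceq> x)"
  have k: "k \<le> N \<and> mul k t \<preceq> x"
    unfolding k_def by (rule GreatestI_nat[of _ 0 N]) (use x in auto)
  have max: "j \<le> k" if "j \<le> N" "mul j t \<preceq> x" for j
    unfolding k_def by (rule Greatest_le_nat[of _ _ N]) (use that in auto)
  let ?r = "x \<ominus> mul k t"
  have eq: "mul k t \<boxplus> ?r = x" using le_eq_plus_minus[of "mul k t" x] k x t by simp
  have "disj ?r t"
  proof (cases "k = N")
    case True
    let ?e = "mul N t"
    have "?e \<boxplus> ?e = ?e" by (metis mult_add[OF t(1)] mult_ge_N)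
    then have "disj (neg ?e) ?e" using idempotent_disj_neg t by simp
    moreover have "?r \<preceq> neg ?e"
      using x t True le_neg[of "mul N t" "neg x \<boxplus> mul N t"] le_plus2 by simp
    moreover have "t \<preceq> ?e" using mult_le_mult[OF t(1), of 1 N] N_pos t mult_Suc[of 0 t] by simp
    ultimately show ?thesis
      unfolding disj_def using x t le_trans[of _ ?r "neg ?e"] le_trans[of _ t ?e] by simp
  next
    case False
    show ?thesis
    proof (rule disj_atom)
      show "\<not> t \<preceq> ?r"
      proof
        assume "t \<preceq> ?r"
        then have "mul (Suc k) t \<preceq> x"
          using plus_mono[of "mul k t" t "mul k t" ?r] x t le_refl eq by (simp add: mult_Suc)
        then show False using max[of "Suc k"] k False by simp
      qed
    qed (use x t in simp)
  qed
  then show ?thesis using that[of k ?r] k eq x t by simp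
qed

text \<open>The difference \<open>?d\<close> lies below \<open>r\<close> and below a multiple of
  \<open>t\<close>, and these are disjoint; so \<open>?d\<close> is zero. Applied in both directions
  this makes the coefficient of \<open>t\<close> unique.\<close>

lemma decomposition_le:
  assumes "r \<in> carrier A" "disj r t" "s \<in> carrier A" "j \<le> N" "mul j t \<boxplus> s = mul k t \<boxplus> r"
  shows "j \<le> k"
proof -
  let ?d = "mul j t \<ominus> mul k t"
  have "mul j t \<preceq> mul k t \<boxplus> r" using le_plus[of "mul j t" s] assms t by simp
  then have "?d \<preceq> r" using assms t by (simp add: minus_le_iff)
  moreover have "?d \<preceq> mul j t" using t minus_le by simp
  moreover have "disj (mul j t) r" using assms t disj_mult[of t r] disj_sym by simp
  ultimately have "?d = zro" using t unfolding disj_def by simp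
  then show ?thesis using t mult_le_multD assms by (simp add: minus_eq_zero_iff)
qed

definition height :: "'a \<Rightarrow> nat" where
  "height = (\<lambda>x\<in>carrier A. THE k. k \<le> N \<and> (\<exists>r\<in>carrier A. disj r t \<and> x = mul k t \<boxplus> r))"

lemma height_eq:
  assumes "k \<le> N" "r \<in> carrier A" "disj r t" shows "height (mul k t \<boxplus> r) = k"
proof -
  have "(THE j. j \<le> N \<and> (\<exists>s\<in>carrier A. disj s t \<and> mul k t \<boxplus> r = mul j t \<boxplus> s)) = k"
  proof (rule the_equality)
    show "k \<le> N \<and> (\<exists>s\<in>carrier A. disj s t \<and> mul k t \<boxplus> r = mul k t \<boxplus> s)" using assms by blast
  next
    fix j assume "j \<le> N \<and> (\<exists>s\<in>carrier A. disj s t \<and> mul k t \<boxplus> r = mul j t \<boxplus> s)"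
    then obtain s where "j \<le> N" "s \<in> carrier A" "disj s t" "mul k t \<boxplus> r = mul j t \<boxplus> s" by blast
    then show "j = k" using decomposition_le[of r s j k] decomposition_le[of s r k j] assms by simp
  qed
  then show ?thesis using assms t by (simp add: height_def)
qed

lemma height_mult: "k \<le> N \<Longrightarrow> height (mul k t) = k"
  using height_eq[of k zro] disj_zero t by simp

lemma height_le_N: "x \<in> carrier A \<Longrightarrow> height x \<le> N"
  using decomposition[of x] height_eq by metis

lemma height_plus:
  assumes x: "x \<in> carrier A" and y: "y \<in> carrier A"
  shows "height (x \<boxplus> y) = min N (height x + height y)"
proof -
  obtain k r where k: "k \<le> N" "r \<in> carrier A" "disj r t" "x = mul k t \<boxplus> r" using decomposition[OF x] .
  obtain l s where l: "l \<le> N" "s \<in> carrier A" "disj s t" "y = mul l t \<boxplus> s" using decomposition[OF y] .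
  have xy: "x \<boxplus> y = mul (min N (k + l)) t \<boxplus> (r \<boxplus> s)"
    using k l t by (simp add: mult_min mult_add plus_assoc plus_left_comm)
  then show ?thesis using k l height_eq[of "min N (k + l)" "r \<boxplus> s"] height_eq[of k r] height_eq[of l s]
    by (simp add: disj_plus t)
qed

lemma height_top: "height (neg zro) = N"
proof -
  have "height (mul N t \<boxplus> neg zro) = min N (N + height (neg zro))"
    using height_plus[of "mul N t" "neg zro"] height_mult[of N] t by simp
  then show ?thesis using t by simp
qed

lemma mult_height_le: "x \<in> carrier A \<Longrightarrow> mul (height x) t \<preceq> x"
  using decomposition[of x] height_eq le_plus t mult_closed by metis

text \<open>Since \<open>x\<close> and \<open>neg x\<close> add up to the top, their heights add up
  to at least \<open>N\<close>. If they exceeded \<open>N\<close>, then \<open>N - ?k\<close> and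
  \<open>?l\<close> copies of \<open>t\<close> would give the same sum with \<open>mul ?k t\<close>,
  namely \<open>mul N t\<close>. Both can be added to it without truncation, so cancellation
  contradicts the strict ascent of the multiples up to \<open>N\<close>.\<close>

lemma height_neg:
  assumes x: "x \<in> carrier A" shows "height (neg x) = N - height x"
proof -
  let ?k = "height x" and ?l = "height (neg x)"
  have "min N (?k + ?l) = N" using height_plus[of x "neg x"] height_top x by simp
  moreover have "?k + ?l \<le> N"
  proof (rule ccontr)
    assume c: "\<not> ?k + ?l \<le> N"
    have kN: "?k \<le> N" using height_le_N x by simp
    have l: "mul ?l t \<preceq> neg (mul ?k t)"
      using le_trans[of "mul ?l t" "neg x" "neg (mul ?k t)"] le_neg[of "mul ?k t" x] mult_height_le x t
      by simp
    have le: "N - ?k \<le> ?l" using c by simp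
    have l': "mul (N - ?k) t \<preceq> neg (mul ?k t)"
      using le_trans[of _ "mul ?l t"] mult_le_mult[OF t(1) le] l t by simp
    have "mul (N - ?k) t \<boxplus> mul ?k t = mul ?l t \<boxplus> mul ?k t"
      using mult_add[OF t(1), of "N - ?k" ?k] mult_add[OF t(1), of ?l ?k] mult_min[of "?l + ?k"] c kN by simp
    then have "mul (N - ?k) t = mul ?l t"
      using plus_cancel[of _ _ "mul ?k t"] l l' t by simp
    then have "?l \<le> N - ?k"
      using mult_le_multD[of ?l "N - ?k"] le_refl[of "mul ?l t"] height_le_N x t by simp
    then show False using c kN by simp
  qed
  ultimately show ?thesis by (simp add: min_def split: if_splits)
qed

lemma height_hom: "height \<in> mv_hom A (mv_chain N)"
  unfolding mv_hom_def
  using height_le_N height_plus height_neg height_mult[of 0] by (auto simp: height_def PiE_def)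

lemma height_surj: "height ` carrier A = {..N}"
proof
  show "{..N} \<subseteq> height ` carrier A"
    using height_mult t mult_closed by (metis atMost_iff imageI subsetI)
qed (use height_le_N in auto)

lemma height_pos:
  assumes "x \<in> carrier A" "t \<preceq> x" shows "height x \<noteq> 0"
proof
  assume "height x = 0"
  then obtain r where "r \<in> carrier A" "disj r t" "x = zro \<boxplus> r"
    using decomposition[of x] height_eq assms by (metis mult_0)
  then show False using assms t le_refl[of t] by (auto simp: disj_def)
qed

end

text \<open>Among the nonzero elements below \<open>d\<close>, one with the fewest elements below it
  is an atom.\<close>

lemma (in mv_algebra) finite_atom_below:
  assumes fin: "finite (carrier A)" and d: "d \<in> carrier A" "d \<noteq> zro"
  obtains t where "finite_mv_atom A t" "t \<preceq> d"
proof -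
  let ?S = "\<lambda>x. {w \<in> carrier A. w \<preceq> x}"
  define P where "P t \<longleftrightarrow> t \<in> carrier A \<and> t \<noteq> zro \<and> t \<preceq> d" for t
  define t where "t = arg_min (\<lambda>x. card (?S x)) P"
  have "P d" using d le_refl by (simp add: P_def)
  then have t: "P t" and min: "\<And>w. P w \<Longrightarrow> card (?S t) \<le> card (?S w)"
    unfolding t_def by (auto intro: arg_min_natI arg_min_nat_le)
  have "finite_mv_atom A t"
  proof
    fix w assume w: "w \<in> carrier A" "w \<preceq> t"
    show "w = zro \<or> w = t"
    proof (rule ccontr)
      assume "\<not> (w = zro \<or> w = t)"
      then have ne: "w \<noteq> zro" "w \<noteq> t" by auto
      then have Pw: "P w" using t w d le_trans[of w t d] by (auto simp: P_def)
      have tc: "t \<in> carrier A" using t by (simp add: P_def)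
      have "?S w \<subseteq> ?S t" using w tc le_trans[of _ w t] by auto
      moreover have "t \<in> ?S t" "t \<notin> ?S w" using tc le_refl le_antisym w ne by auto
      ultimately have "?S w \<subset> ?S t" by blast
      then have "card (?S w) < card (?S t)" using fin by (intro psubset_card_mono) auto
      then show False using min[OF Pw] by simp
    qed
  qed (use fin t in \<open>auto simp: P_def\<close>)
  then show ?thesis using that t by (simp add: P_def)
qed

lemma (in mv_algebra) finite_separating_hom:
  assumes "finite (carrier A)" "d \<in> carrier A" "d \<noteq> zro"
  obtains n h where "n \<ge> 1" "h \<in> mv_hom A (mv_chain n)" "h ` carrier A = {..n}" "h d \<noteq> 0"
proof -
  obtain t where a: "finite_mv_atom A t" "t \<preceq> d" using finite_atom_below assms by blast
  interpret finite_mv_atom A t by fact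
  show ?thesis using that[of N height] N_pos height_hom height_surj height_pos assms a(2) by blast
qed

section \<open>Homomorphisms\<close>

lemma mv_homD:
  assumes "h \<in> mv_hom A B"
  shows "x \<in> carrier A \<Longrightarrow> h x \<in> carrier B"
    and "h (mv_zero A) = mv_zero B"
    and "x \<in> carrier A \<Longrightarrow> y \<in> carrier A \<Longrightarrow> h (x \<boxplus>\<^bsub>A\<^esub> y) = h x \<boxplus>\<^bsub>B\<^esub> h y"
    and "x \<in> carrier A \<Longrightarrow> h (mv_neg A x) = mv_neg B (h x)"
    and "h \<in> extensional (carrier A)"
  using assms by (auto simp: mv_hom_def PiE_def)

lemma mv_homI:
  assumes "mv_algebra A" "\<And>x. x \<in> carrier A \<Longrightarrow> h x \<in> carrier B" "h (mv_zero A) = mv_zero B"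
    "\<And>x y. x \<in> carrier A \<Longrightarrow> y \<in> carrier A \<Longrightarrow> h (x \<boxplus>\<^bsub>A\<^esub> y) = h x \<boxplus>\<^bsub>B\<^esub> h y"
    "\<And>x. x \<in> carrier A \<Longrightarrow> h (mv_neg A x) = mv_neg B (h x)"
  shows "restrict h (carrier A) \<in> mv_hom A B"
  using assms mv_algebra.plus_closed[OF assms(1)] mv_algebra.zero_closed[OF assms(1)]
    mv_algebra.neg_closed[OF assms(1)]
  unfolding mv_hom_def by auto

lemma mv_hom_ext:
  assumes "h \<in> mv_hom A B" "g \<in> mv_hom A C" "\<And>x. x \<in> carrier A \<Longrightarrow> h x = g x"
  shows "h = g"
  using assms mv_homD(5) extensionalityI by metis

lemma mv_hom_compose:
  assumes "mv_algebra A" "f \<in> mv_hom A B" "g \<in> mv_hom B C"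
  shows "compose (carrier A) g f \<in> mv_hom A C"
  unfolding compose_def
  by (rule mv_homI) (simp_all add: assms(1) mv_homD[OF assms(2)] mv_homD[OF assms(3)])

lemma mv_hom_id: "mv_algebra A \<Longrightarrow> (\<lambda>x\<in>carrier A. x) \<in> mv_hom A A"
  by (rule mv_homI) simp_all

lemma mv_hom_le:
  assumes "mv_algebra A" "h \<in> mv_hom A B" "x \<in> carrier A" "y \<in> carrier A" "mv_le A x y"
  shows "mv_le B (h x) (h y)"
proof -
  interpret mv_algebra A by fact
  have "h (neg x \<boxplus>\<^bsub>A\<^esub> y) = h (neg zro)" using assms(5) by (simp add: mv_le_def)
  then show ?thesis using assms by (simp add: mv_le_def mv_homD[OF assms(2)])
qed

lemma mv_hom_multiple:
  assumes "mv_algebra A" "h \<in> mv_hom A B" "a \<in> carrier A"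
  shows "h (mv_multiple A n a) = mv_multiple B n (h a)"
proof -
  interpret mv_algebra A by fact
  show ?thesis
  proof (induction n)
    case 0
    then show ?case by (simp add: mv_multiple_def mv_homD[OF assms(2)])
  next
    case (Suc n)
    have "mv_multiple B (Suc n) (h a) = mv_multiple B n (h a) \<boxplus>\<^bsub>B\<^esub> h a"
      by (simp add: mv_multiple_def)
    then show ?case using Suc by (simp add: mult_Suc mv_homD[OF assms(2)] assms(3))
  qed
qed

text \<open>The axioms are equations, so they pass to images. \<open>B\<close> is merely a structure
  with the right operations; this is how transported copies, and the image of a limit projection,
  are recognised as MV-algebras.\<close>

lemma mv_algebra_hom_image:
  assumes "mv_algebra A" and h: "h \<in> mv_hom A B" and onto: "h ` carrier A = carrier B"
  shows "mv_algebra B"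
proof -
  interpret mv_algebra A by fact
  note [simp] = mv_homD(2-4)[OF h, symmetric]
  have c: "\<And>x. x \<in> carrier A \<Longrightarrow> h x \<in> carrier B" using mv_homD[OF h] by blast
  have ex: "\<exists>x\<in>carrier A. b = h x" if "b \<in> carrier B" for b using that onto by blast
  have cm: "comm_monoid (mv_monoid B)"
  proof (rule comm_monoidI)
    fix x y z assume "x \<in> carrier (mv_monoid B)" "y \<in> carrier (mv_monoid B)" "z \<in> carrier (mv_monoid B)"
    then obtain x' y' z' where "x' \<in> carrier A" "x = h x'" "y' \<in> carrier A" "y = h y'" "z' \<in> carrier A" "z = h z'"
      using ex by (metis partial_object.select_convs(1))
    then show "x \<otimes>\<^bsub>mv_monoid B\<^esub> y \<otimes>\<^bsub>mv_monoid B\<^esub> z = x \<otimes>\<^bsub>mv_monoid B\<^esub> (y \<otimes>\<^bsub>mv_monoid B\<^esub> z)"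
      by (simp add: plus_assoc)
  next
    fix x y assume "x \<in> carrier (mv_monoid B)" "y \<in> carrier (mv_monoid B)"
    then obtain x' y' where "x' \<in> carrier A" "x = h x'" "y' \<in> carrier A" "y = h y'"
      using ex by (metis partial_object.select_convs(1))
    then show "x \<otimes>\<^bsub>mv_monoid B\<^esub> y \<in> carrier (mv_monoid B)"
      and "x \<otimes>\<^bsub>mv_monoid B\<^esub> y = y \<otimes>\<^bsub>mv_monoid B\<^esub> x"
      using plus_comm[of x' y'] by (simp_all add: c)
  next
    fix x assume "x \<in> carrier (mv_monoid B)"
    then obtain x' where "x' \<in> carrier A" "x = h x'"
      using ex by (metis partial_object.select_convs(1))
    then show "\<one>\<^bsub>mv_monoid B\<^esub> \<otimes>\<^bsub>mv_monoid B\<^esub> x = x" by simp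
  next
    show "\<one>\<^bsub>mv_monoid B\<^esub> \<in> carrier (mv_monoid B)" by (simp add: c)
  qed
  show ?thesis
    unfolding mv_algebra_def
  proof (intro conjI allI impI cm)
    fix x assume "x \<in> carrier B"
    then obtain x' where x: "x' \<in> carrier A" "x = h x'" using ex by blast
    then show "mv_neg B x \<in> carrier B" "mv_neg B (mv_neg B x) = x"
        "mv_neg B (mv_zero B) \<boxplus>\<^bsub>B\<^esub> x = mv_neg B (mv_zero B)"
      by (simp_all add: c)
    fix y assume "y \<in> carrier B"
    then obtain y' where y: "y' \<in> carrier A" "y = h y'" using ex by blast
    show "mv_neg B (mv_neg B x \<boxplus>\<^bsub>B\<^esub> y) \<boxplus>\<^bsub>B\<^esub> y = mv_neg B (mv_neg B y \<boxplus>\<^bsub>B\<^esub> x) \<boxplus>\<^bsub>B\<^esub> x"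
      using x y lukasiewicz[of x' y'] by simp
  qed
qed

section \<open>Isomorphisms and transport of structure\<close>

definition mv_iso :: "'a mv_algebra \<Rightarrow> 'b mv_algebra \<Rightarrow> ('a \<Rightarrow> 'b) set" where
  "mv_iso A B = {h \<in> mv_hom A B. bij_betw h (carrier A) (carrier B)}"

lemma mv_isoD: "h \<in> mv_iso A B \<Longrightarrow> h \<in> mv_hom A B" "h \<in> mv_iso A B \<Longrightarrow> bij_betw h (carrier A) (carrier B)"
  by (simp_all add: mv_iso_def)

definition mv_inverse :: "'a mv_algebra \<Rightarrow> 'b mv_algebra \<Rightarrow> ('a \<Rightarrow> 'b) \<Rightarrow> 'b \<Rightarrow> 'a" where
  "mv_inverse A B h = (\<lambda>y\<in>carrier B. inv_into (carrier A) h y)"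

lemma mv_inverse_apply:
  assumes "h \<in> mv_iso A B"
  shows "x \<in> carrier A \<Longrightarrow> mv_inverse A B h (h x) = x"
    and "y \<in> carrier B \<Longrightarrow> h (mv_inverse A B h y) = y"
    and "y \<in> carrier B \<Longrightarrow> mv_inverse A B h y \<in> carrier A"
  using assms bij_betw_inv_into_left bij_betw_inv_into_right bij_betwE[OF bij_betw_inv_into] bij_betwE
  unfolding mv_iso_def mv_inverse_def by fastforce+

lemma mv_inverse_iso:
  assumes A: "mv_algebra A" and h: "h \<in> mv_iso A B"
  shows "mv_inverse A B h \<in> mv_iso B A"
proof -
  note iv = mv_inverse_apply[OF h] and hom = mv_homD[OF mv_isoD(1)[OF h]]
  interpret mv_algebra A by fact
  have B: "mv_algebra B"
    using mv_algebra_hom_image[OF A mv_isoD(1)[OF h]] mv_isoD(2)[OF h] by (simp add: bij_betw_def)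
  have "restrict (mv_inverse A B h) (carrier B) \<in> mv_hom B A"
  proof (rule mv_homI[OF B])
    show "mv_inverse A B h (mv_zero B) = zro" using iv(1)[of zro] hom by simp
  next
    fix x y assume xy: "x \<in> carrier B" "y \<in> carrier B"
    then have "h (mv_inverse A B h x \<boxplus>\<^bsub>A\<^esub> mv_inverse A B h y) = x \<boxplus>\<^bsub>B\<^esub> y" using hom iv by simp
    then show "mv_inverse A B h (x \<boxplus>\<^bsub>B\<^esub> y) = mv_inverse A B h x \<boxplus>\<^bsub>A\<^esub> mv_inverse A B h y"
      using iv xy by (metis plus_closed)
  next
    fix x assume x: "x \<in> carrier B"
    then have "h (neg (mv_inverse A B h x)) = mv_neg B x" using hom iv by simp
    then show "mv_inverse A B h (mv_neg B x) = neg (mv_inverse A B h x)"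
      using iv x by (metis neg_closed)
  qed (use iv in simp)
  moreover have "restrict (mv_inverse A B h) (carrier B) = mv_inverse A B h"
    by (auto simp: mv_inverse_def)
  moreover have "bij_betw (mv_inverse A B h) (carrier B) (carrier A)"
    using bij_betw_inv_into[OF mv_isoD(2)[OF h]] by (simp add: mv_inverse_def cong: bij_betw_cong)
  ultimately show ?thesis by (simp add: mv_iso_def)
qed

lemma mv_algebra_iso_image: "mv_algebra A \<Longrightarrow> h \<in> mv_iso A B \<Longrightarrow> mv_algebra B"
  using mv_algebra_hom_image mv_isoD by (metis bij_betw_imp_surj_on)

lemma mv_iso_compose:
  assumes "mv_algebra A" "f \<in> mv_iso A B" "g \<in> mv_iso B C"
  shows "compose (carrier A) g f \<in> mv_iso A C"
  using assms mv_hom_compose[of A f B g C] bij_betw_compose unfolding mv_iso_def by fast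

text \<open>Serves two purposes: to place finite products on \<open>nat\<close>, as the definition
  of profinite algebras asks, and to place arbitrary products in the carrier type
  \<open>'c\<close>.\<close>

definition mv_transport :: "('a \<Rightarrow> 'b) \<Rightarrow> 'a mv_algebra \<Rightarrow> 'b mv_algebra" where
  "mv_transport e A = (let d = inv_into (carrier A) e in
    \<lparr> carrier = e ` carrier A, mv_plus = (\<lambda>x y. e (d x \<boxplus>\<^bsub>A\<^esub> d y)), mv_zero = e (mv_zero A),
      mv_neg = (\<lambda>x. e (mv_neg A (d x))) \<rparr>)"

lemma mv_transport_iso:
  assumes "mv_algebra A" "inj_on e (carrier A)"
  shows "restrict e (carrier A) \<in> mv_iso A (mv_transport e A)"
proof -
  have "restrict e (carrier A) \<in> mv_hom A (mv_transport e A)"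
    using assms by (intro mv_homI) (auto simp: mv_transport_def Let_def)
  moreover have "bij_betw (restrict e (carrier A)) (carrier A) (carrier (mv_transport e A))"
    using assms by (simp add: mv_transport_def Let_def bij_betw_def inj_on_def)
  ultimately show ?thesis by (simp add: mv_iso_def)
qed


section \<open>Ideals\<close>

lemma mv_idealD:
  assumes "mv_ideal A J"
  shows "x \<in> J \<Longrightarrow> x \<in> carrier A" "x \<in> J \<Longrightarrow> y \<in> J \<Longrightarrow> x \<boxplus>\<^bsub>A\<^esub> y \<in> J"
    "x \<in> carrier A \<Longrightarrow> y \<in> J \<Longrightarrow> mv_le A x y \<Longrightarrow> x \<in> J"
  using assms unfolding mv_ideal_def by blast+

lemma (in mv_algebra) ideal_zero: "mv_ideal A J \<Longrightarrow> zro \<in> J"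
  unfolding mv_ideal_def using zero_le zero_closed by blast

lemma (in mv_algebra) ideal_top:
  assumes J: "mv_ideal A J" shows "neg zro \<in> J \<longleftrightarrow> J = carrier A"
  using le_top mv_idealD(1,3)[OF J] neg_closed[OF zero_closed] by blast

lemma (in mv_algebra) ideal_mult: "mv_ideal A J \<Longrightarrow> x \<in> J \<Longrightarrow> mul n x \<in> J"
  by (induction n) (simp_all add: mult_Suc ideal_zero mv_idealD)

lemma mv_ideal_vimage:
  assumes A: "mv_algebra A" and B: "mv_algebra B" and h: "h \<in> mv_hom A B" and J: "mv_ideal B J"
  shows "mv_ideal A {x \<in> carrier A. h x \<in> J}"
proof -
  interpret mv_algebra A by fact
  have "h zro \<in> J" using mv_algebra.ideal_zero[OF B J] mv_homD[OF h] by simp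
  then have "{x \<in> carrier A. h x \<in> J} \<noteq> {}" using zero_closed by blast
  then show ?thesis
    using mv_idealD[OF J] mv_hom_le[OF A h] mv_homD[OF h] unfolding mv_ideal_def by auto
qed

lemma reflects_principal_maximal_ideals_iso:
  assumes A: "mv_algebra A" and h: "h \<in> mv_iso A B"
  shows "reflects_principal_maximal_ideals A B h"
  unfolding reflects_principal_maximal_ideals_def
proof (intro allI impI)
  fix J assume J: "mv_principal_maximal_ideal B J"
  define g where "g = mv_inverse A B h"
  have B: "mv_algebra B" using mv_algebra_iso_image[OF A h] .
  have g: "g \<in> mv_iso B A" unfolding g_def using mv_inverse_iso[OF A h] .
  note iv = mv_inverse_apply[OF h, folded g_def]
  note hom = mv_homD[OF mv_isoD(1)[OF h]] and gom = mv_homD[OF mv_isoD(1)[OF g]]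
  let ?J = "{x \<in> carrier A. h x \<in> J}"
  have id: "mv_ideal B J" and ne: "J \<noteq> carrier B"
    and max: "\<And>K. mv_ideal B K \<Longrightarrow> K \<noteq> carrier B \<Longrightarrow> J \<subseteq> K \<Longrightarrow> K = J"
    and "mv_principal_ideal B J"
    using J unfolding mv_principal_maximal_ideal_def mv_maximal_ideal_def by auto
  then obtain b where b: "b \<in> carrier B" "J = {x \<in> carrier B. \<exists>n\<ge>1. mv_le B x (mv_multiple B n b)}"
    unfolding mv_principal_ideal_def by blast
  have "?J \<noteq> carrier A"
  proof
    assume "?J = carrier A"
    then have "carrier B \<subseteq> J" using iv by (metis (mono_tags, lifting) mem_Collect_eq subsetI)
    then show False using ne mv_idealD(1)[OF id] by blast
  qed
  moreover have "K = ?J" if K: "mv_ideal A K" "K \<noteq> carrier A" "?J \<subseteq> K" for K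
  proof -
    let ?K = "{y \<in> carrier B. g y \<in> K}"
    have "mv_ideal B ?K" using mv_ideal_vimage[OF B A mv_isoD(1)[OF g] K(1)] .
    moreover have "?K \<noteq> carrier B"
    proof
      assume "?K = carrier B"
      then have "carrier A \<subseteq> K" using iv hom by (metis (mono_tags, lifting) mem_Collect_eq subsetI)
      then show False using K mv_idealD(1)[OF K(1)] by blast
    qed
    moreover have "J \<subseteq> ?K" using K(3) iv mv_idealD(1)[OF id] by auto
    ultimately have "?K = J" by (rule max)
    then show ?thesis using K(3) iv hom mv_idealD(1)[OF K(1)] by auto
  qed
  \<comment> \<open>The preimage is generated by the preimage \<open>g b\<close> of the generator,
    since \<open>h\<close> and \<open>g\<close> both preserve multiples and order.\<close>
  moreover have "?J = {x \<in> carrier A. \<exists>n\<ge>1. mv_le A x (mv_multiple A n (g b))}"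
  proof -
    have "mv_le A x (mv_multiple A n (g b)) \<longleftrightarrow> mv_le B (h x) (mv_multiple B n b)"
      if x: "x \<in> carrier A" for x n
    proof -
      have c: "mv_multiple A n (g b) \<in> carrier A" "mv_multiple B n b \<in> carrier B"
        using mv_algebra.mult_closed[OF A] mv_algebra.mult_closed[OF B] gom b by auto
      have "h (mv_multiple A n (g b)) = mv_multiple B n b" "g (mv_multiple B n b) = mv_multiple A n (g b)"
        using mv_hom_multiple[OF A mv_isoD(1)[OF h]] mv_hom_multiple[OF B mv_isoD(1)[OF g]] gom b iv by auto
      then show ?thesis
        using mv_hom_le[OF A mv_isoD(1)[OF h] x c(1)] mv_hom_le[OF B mv_isoD(1)[OF g] hom(1)[OF x] c(2)] iv x
        by auto
    qed
    then show ?thesis using b hom by auto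
  qed
  ultimately show "mv_principal_maximal_ideal A ?J"
    using mv_ideal_vimage[OF A B mv_isoD(1)[OF h] id] gom(1)[OF b(1)]
    unfolding mv_principal_maximal_ideal_def mv_maximal_ideal_def mv_principal_ideal_def by blast
qed

lemma reflects_principal_maximal_ideals_compose:
  assumes "f \<in> mv_hom A B" "reflects_principal_maximal_ideals A B f" "reflects_principal_maximal_ideals B C g"
  shows "reflects_principal_maximal_ideals A C (compose (carrier A) g f)"
proof -
  have "{x \<in> carrier A. compose (carrier A) g f x \<in> J} = {x \<in> carrier A. f x \<in> {y \<in> carrier B. g y \<in> J}}" for J
    using mv_homD(1)[OF assms(1)] by (auto simp: compose_def)
  then show ?thesis
    using assms(2,3) unfolding reflects_principal_maximal_ideals_def by presburger
qed

lemma reflects_principal_maximal_ideals_id: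
  "reflects_principal_maximal_ideals A A (\<lambda>x\<in>carrier A. x)"
proof -
  have "{x \<in> carrier A. (\<lambda>x\<in>carrier A. x) x \<in> J} = J" if "mv_principal_maximal_ideal A J" for J
    using that unfolding mv_principal_maximal_ideal_def mv_maximal_ideal_def mv_ideal_def by auto
  then show ?thesis unfolding reflects_principal_maximal_ideals_def by simp
qed


section \<open>Products of finite chains\<close>

definition chain_product :: "'i set \<Rightarrow> ('i \<Rightarrow> nat) \<Rightarrow> ('i \<Rightarrow> nat) mv_algebra" where
  "chain_product X \<sigma> =
    \<lparr> carrier = \<Pi>\<^sub>E x\<in>X. {..\<sigma> x}, mv_plus = (\<lambda>f g. \<lambda>x\<in>X. min (\<sigma> x) (f x + g x)),
      mv_zero = (\<lambda>x\<in>X. 0), mv_neg = (\<lambda>f. \<lambda>x\<in>X. \<sigma> x - f x) \<rparr>"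

lemma chain_product_simps [simp]:
  "carrier (chain_product X \<sigma>) = (\<Pi>\<^sub>E x\<in>X. {..\<sigma> x})"
  "mv_plus (chain_product X \<sigma>) f g = (\<lambda>x\<in>X. min (\<sigma> x) (f x + g x))"
  "mv_zero (chain_product X \<sigma>) = (\<lambda>x\<in>X. 0)"
  "mv_neg (chain_product X \<sigma>) f = (\<lambda>x\<in>X. \<sigma> x - f x)"
  by (simp_all add: chain_product_def)

lemma chain_product_le: "f \<in> (\<Pi>\<^sub>E x\<in>X. {..\<sigma> x}) \<Longrightarrow> x \<in> X \<Longrightarrow> f x \<le> \<sigma> x"
  by (auto simp: PiE_def)

lemma mv_algebra_chain_product: "mv_algebra (chain_product X \<sigma>)"
  unfolding mv_algebra_def
proof (intro conjI allI impI)
  show "comm_monoid (mv_monoid (chain_product X \<sigma>))"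
  proof (rule comm_monoidI)
    fix x assume "x \<in> carrier (mv_monoid (chain_product X \<sigma>))"
    then show "\<one>\<^bsub>mv_monoid (chain_product X \<sigma>)\<^esub> \<otimes>\<^bsub>mv_monoid (chain_product X \<sigma>)\<^esub> x = x"
      by (auto simp: fun_eq_iff PiE_def extensional_def Pi_def)
  qed (auto simp: restrict_def fun_eq_iff add_ac)
next
  fix f assume f: "f \<in> carrier (chain_product X \<sigma>)"
  show "mv_neg (chain_product X \<sigma>) (mv_neg (chain_product X \<sigma>) f) = f"
    using f by (auto simp: fun_eq_iff PiE_def extensional_def Pi_def)
  fix g assume g: "g \<in> carrier (chain_product X \<sigma>)"
  show "mv_neg (chain_product X \<sigma>) (mv_neg (chain_product X \<sigma>) f \<boxplus>\<^bsub>chain_product X \<sigma>\<^esub> g) \<boxplus>\<^bsub>chain_product X \<sigma>\<^esub> g =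
       mv_neg (chain_product X \<sigma>) (mv_neg (chain_product X \<sigma>) g \<boxplus>\<^bsub>chain_product X \<sigma>\<^esub> f) \<boxplus>\<^bsub>chain_product X \<sigma>\<^esub> f"
    using f g by (auto simp: fun_eq_iff dest!: chain_product_le)
qed (auto simp: fun_eq_iff)

lemma chain_product_mv_le:
  assumes "f \<in> (\<Pi>\<^sub>E x\<in>X. {..\<sigma> x})" "g \<in> (\<Pi>\<^sub>E x\<in>X. {..\<sigma> x})"
  shows "mv_le (chain_product X \<sigma>) f g \<longleftrightarrow> (\<forall>x\<in>X. f x \<le> g x)"
proof -
  have "min (\<sigma> x) (\<sigma> x - f x + g x) = \<sigma> x \<longleftrightarrow> f x \<le> g x" if "x \<in> X" for x
    using chain_product_le[OF assms(1) that] chain_product_le[OF assms(2) that] by linarith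
  then show ?thesis unfolding mv_le_def by (auto simp: fun_eq_iff)
qed

lemma chain_product_multiple:
  assumes "f \<in> (\<Pi>\<^sub>E x\<in>X. {..\<sigma> x})"
  shows "mv_multiple (chain_product X \<sigma>) n f = (\<lambda>x\<in>X. min (\<sigma> x) (n * f x))"
proof (induction n)
  case (Suc n)
  have "mv_multiple (chain_product X \<sigma>) (Suc n) f = mv_multiple (chain_product X \<sigma>) n f \<boxplus>\<^bsub>chain_product X \<sigma>\<^esub> f"
    by (simp add: mv_multiple_def)
  then show ?case by (auto simp: Suc fun_eq_iff add_ac)
qed (simp add: mv_multiple_def)

definition vanishing :: "'i set \<Rightarrow> ('i \<Rightarrow> nat) \<Rightarrow> 'i \<Rightarrow> ('i \<Rightarrow> nat) set" where
  "vanishing X \<sigma> x = {f \<in> carrier (chain_product X \<sigma>). f x = 0}"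

text \<open>These are the idempotents of the product, that is, characteristic functions scaled to
  the top of each chain. On them, membership in an ideal becomes a property of subsets of
  \<open>X\<close>.\<close>

definition chain_idem :: "'i set \<Rightarrow> ('i \<Rightarrow> nat) \<Rightarrow> 'i set \<Rightarrow> 'i \<Rightarrow> nat" where
  "chain_idem X \<sigma> S = (\<lambda>x\<in>X. if x \<in> S then \<sigma> x else 0)"

lemma chain_idem_closed: "chain_idem X \<sigma> S \<in> carrier (chain_product X \<sigma>)"
  by (auto simp: chain_idem_def)

lemma mv_ideal_vanishing: "x \<in> X \<Longrightarrow> mv_ideal (chain_product X \<sigma>) (vanishing X \<sigma> x)"
proof -
  assume x: "x \<in> X"
  have "(\<lambda>x\<in>X. 0) \<in> vanishing X \<sigma> x" using x by (auto simp: vanishing_def)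
  then have "vanishing X \<sigma> x \<noteq> {}" by blast
  moreover have "f x = 0" if "f \<in> (\<Pi>\<^sub>E x\<in>X. {..\<sigma> x})" "g \<in> (\<Pi>\<^sub>E x\<in>X. {..\<sigma> x})" "g x = 0"
      "mv_le (chain_product X \<sigma>) f g" for f g
    using chain_product_mv_le[OF that(1,2)] that(3,4) x by force
  ultimately show ?thesis
    unfolding mv_ideal_def using x by (auto simp: vanishing_def)
qed

text \<open>If an ideal above the kernel contains \<open>f\<close> with \<open>f x \<ge> 1\<close>,
  then \<open>\<sigma> x\<close> copies of \<open>f\<close> reach the top at \<open>x\<close>, while
  the idempotent of \<open>X - {x}\<close> is in the kernel and is the top elsewhere; their sum is
  the top.\<close>

lemma vanishing_maximal:
  assumes x: "x \<in> X" and "\<sigma> x \<ge> 1"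
  shows "mv_maximal_ideal (chain_product X \<sigma>) (vanishing X \<sigma> x)"
  unfolding mv_maximal_ideal_def
proof (intro conjI allI impI)
  interpret mv_algebra "chain_product X \<sigma>" by (rule mv_algebra_chain_product)
  show "mv_ideal (chain_product X \<sigma>) (vanishing X \<sigma> x)" using mv_ideal_vanishing[OF x] .
  have "chain_idem X \<sigma> X \<notin> vanishing X \<sigma> x" using assms by (simp add: vanishing_def chain_idem_def)
  then show "vanishing X \<sigma> x \<noteq> carrier (chain_product X \<sigma>)" using chain_idem_closed by metis
  fix K assume K: "mv_ideal (chain_product X \<sigma>) K" "K \<noteq> carrier (chain_product X \<sigma>)" "vanishing X \<sigma> x \<subseteq> K"
  show "K = vanishing X \<sigma> x"
  proof (rule ccontr)
    assume "K \<noteq> vanishing X \<sigma> x"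
    then obtain f where f: "f \<in> K" "f \<notin> vanishing X \<sigma> x" using K by blast
    have fc: "f \<in> (\<Pi>\<^sub>E x\<in>X. {..\<sigma> x})" using f(1) mv_idealD(1)[OF K(1)] by simp
    have fx: "f x \<ge> 1" using f fc by (simp add: vanishing_def)
    have "chain_idem X \<sigma> (X - {x}) \<in> vanishing X \<sigma> x"
      using x chain_idem_closed[of X \<sigma> "X - {x}"] by (simp add: vanishing_def chain_idem_def)
    then have "mul (\<sigma> x) f \<boxplus>\<^bsub>chain_product X \<sigma>\<^esub> chain_idem X \<sigma> (X - {x}) \<in> K"
      using ideal_mult[OF K(1) f(1)] mv_idealD(2)[OF K(1)] K(3) by blast
    moreover have "mul (\<sigma> x) f \<boxplus>\<^bsub>chain_product X \<sigma>\<^esub> chain_idem X \<sigma> (X - {x}) = neg zro"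
      using fx by (auto simp: chain_product_multiple[OF fc] chain_idem_def fun_eq_iff)
    ultimately show False using ideal_top[OF K(1)] K(2) by simp
  qed
qed

text \<open>The idempotent of \<open>X - {x}\<close> generates the kernel; all its positive
  multiples coincide.\<close>

lemma vanishing_principal:
  assumes x: "x \<in> X"
  shows "mv_principal_ideal (chain_product X \<sigma>) (vanishing X \<sigma> x)"
proof -
  let ?e = "chain_idem X \<sigma> (X - {x})"
  have e: "?e \<in> (\<Pi>\<^sub>E x\<in>X. {..\<sigma> x})" using chain_idem_closed[of X \<sigma> "X - {x}"] by simp
  have "(\<exists>n\<ge>1. mv_le (chain_product X \<sigma>) f (mv_multiple (chain_product X \<sigma>) n ?e)) \<longleftrightarrow> f x = 0"
    if f: "f \<in> (\<Pi>\<^sub>E x\<in>X. {..\<sigma> x})" for f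
  proof -
    have "mv_le (chain_product X \<sigma>) f (mv_multiple (chain_product X \<sigma>) n ?e) \<longleftrightarrow> f x = 0" if n: "n \<ge> 1" for n :: nat
    proof -
      have "f y \<le> min (\<sigma> y) (n * ?e y) \<longleftrightarrow> (y = x \<longrightarrow> f x = 0)" if y: "y \<in> X" for y
      proof (cases "y = x")
        case False
        moreover have "\<sigma> y \<le> n * \<sigma> y" using n by simp
        ultimately show ?thesis using chain_product_le[OF f y] y by (simp add: chain_idem_def)
      qed (use y in \<open>simp add: chain_idem_def\<close>)
      then have "(\<forall>y\<in>X. f y \<le> min (\<sigma> y) (n * ?e y)) \<longleftrightarrow> f x = 0" using x by blast
      moreover have "(\<lambda>y\<in>X. min (\<sigma> y) (n * ?e y)) \<in> (\<Pi>\<^sub>E x\<in>X. {..\<sigma> x})" by auto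
      ultimately show ?thesis
        unfolding chain_product_multiple[OF e] using chain_product_mv_le[OF f] by simp
    qed
    then show ?thesis by auto
  qed
  then show ?thesis
    unfolding mv_principal_ideal_def vanishing_def using e by (intro bexI[of _ ?e]) auto
qed

text \<open>If \<open>?e'\<close> is not in \<open>J\<close>, then \<open>J\<close> and
  \<open>?e'\<close> generate the whole algebra, so the top lies below
  \<open>g \<boxplus> ?e'\<close> for some \<open>g\<close> in \<open>J\<close>. On \<open>S\<close>
  the summand \<open>?e'\<close> is zero, hence \<open>g\<close> is the top there and dominates
  \<open>?e\<close>.\<close>

lemma maximal_idem:
  assumes J: "mv_maximal_ideal (chain_product X \<sigma>) J"
  shows "chain_idem X \<sigma> S \<in> J \<or> chain_idem X \<sigma> (X - S) \<in> J"
proof (rule disjCI)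
  interpret mv_algebra "chain_product X \<sigma>" by (rule mv_algebra_chain_product)
  let ?P = "chain_product X \<sigma>" and ?e = "chain_idem X \<sigma> S" and ?e' = "chain_idem X \<sigma> (X - S)"
  have J': "mv_ideal ?P J" "J \<noteq> carrier ?P"
    and max: "\<And>K. mv_ideal ?P K \<Longrightarrow> K \<noteq> carrier ?P \<Longrightarrow> J \<subseteq> K \<Longrightarrow> K = J"
    using J unfolding mv_maximal_ideal_def by auto
  note c = mv_idealD(1)[OF J'(1)]
  assume ne: "?e' \<notin> J"
  \<comment> \<open>The ideal generated by \<open>J\<close> and \<open>?e'\<close>; one copy of
    \<open>?e'\<close> suffices because it is idempotent.\<close>
  let ?K = "{f \<in> carrier ?P. \<exists>g\<in>J. mv_le ?P f (g \<boxplus>\<^bsub>?P\<^esub> ?e')}"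
  have ee: "?e' \<boxplus>\<^bsub>?P\<^esub> ?e' = ?e'" by (auto simp: chain_idem_def fun_eq_iff)
  have e'c: "?e' \<in> carrier ?P" and ec: "?e \<in> carrier ?P" by (rule chain_idem_closed)+
  have "mv_ideal ?P ?K"
    unfolding mv_ideal_def
  proof (intro conjI ballI impI)
    have "zro \<in> ?K" using ideal_zero[OF J'(1)] zero_le[OF plus_closed[OF zero_closed e'c]] zero_closed by blast
    then show "?K \<noteq> {}" by blast
  next
    fix f g assume "f \<in> ?K" "g \<in> ?K"
    then obtain f' g' where f': "f \<in> carrier ?P" "g \<in> carrier ?P" "f' \<in> J" "g' \<in> J"
      "mv_le ?P f (f' \<boxplus>\<^bsub>?P\<^esub> ?e')" "mv_le ?P g (g' \<boxplus>\<^bsub>?P\<^esub> ?e')" by blast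
    have "mv_le ?P (f \<boxplus>\<^bsub>?P\<^esub> g) ((f' \<boxplus>\<^bsub>?P\<^esub> ?e') \<boxplus>\<^bsub>?P\<^esub> (g' \<boxplus>\<^bsub>?P\<^esub> ?e'))"
      using f' c e'c by (intro plus_mono plus_closed) auto
    also have "(f' \<boxplus>\<^bsub>?P\<^esub> ?e') \<boxplus>\<^bsub>?P\<^esub> (g' \<boxplus>\<^bsub>?P\<^esub> ?e') = (f' \<boxplus>\<^bsub>?P\<^esub> g') \<boxplus>\<^bsub>?P\<^esub> (?e' \<boxplus>\<^bsub>?P\<^esub> ?e')"
      using c[OF f'(3)] c[OF f'(4)] e'c by (metis plus_assoc plus_left_comm plus_closed)
    finally show "f \<boxplus>\<^bsub>?P\<^esub> g \<in> ?K"
      using mv_idealD(2)[OF J'(1) f'(3,4)] plus_closed[OF f'(1,2)] unfolding ee by blast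
  next
    fix f g assume f: "f \<in> carrier ?P" and "g \<in> ?K" and le: "mv_le ?P f g"
    then obtain g' where "g \<in> carrier ?P" "g' \<in> J" "mv_le ?P g (g' \<boxplus>\<^bsub>?P\<^esub> ?e')" by blast
    then show "f \<in> ?K" using f le le_trans[of f g "g' \<boxplus>\<^bsub>?P\<^esub> ?e'"] plus_closed[OF c e'c] by blast
  qed blast
  moreover have "J \<subseteq> ?K" using c le_plus e'c by blast
  moreover have "?e' \<in> ?K"
    using ideal_zero[OF J'(1)] le_plus2[OF e'c zero_closed] e'c by blast
  ultimately have "?K = carrier ?P" using max ne by blast
  then have "neg zro \<in> ?K" using neg_closed[OF zero_closed] by blast
  then obtain g where g: "g \<in> J" "mv_le ?P (neg zro) (g \<boxplus>\<^bsub>?P\<^esub> ?e')" by blast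
  have gc: "g \<in> (\<Pi>\<^sub>E x\<in>X. {..\<sigma> x})" using c[OF g(1)] by simp
  have le: "\<forall>x\<in>X. neg zro x \<le> (g \<boxplus>\<^bsub>?P\<^esub> ?e') x"
    using chain_product_mv_le[of "neg zro" X \<sigma> "g \<boxplus>\<^bsub>?P\<^esub> ?e'"] g(2) neg_closed[OF zero_closed] plus_closed[OF c[OF g(1)] e'c]
    by (simp only: chain_product_simps(1))
  have "\<forall>x\<in>X. ?e x \<le> g x"
  proof
    fix x assume x: "x \<in> X"
    then show "?e x \<le> g x"
      using le[rule_format, OF x] by (simp add: chain_idem_def split: if_splits)
  qed
  then have "mv_le ?P ?e g" using chain_product_mv_le[OF _ gc] ec by simp
  then show "?e \<in> J" using mv_idealD(3)[OF J'(1) ec g(1)] by simp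
qed

text \<open>The point is found as a zero of the generator \<open>a\<close>: there \<open>J\<close>
  is contained in the kernel of the projection, and maximality of \<open>J\<close> gives
  equality.\<close>

lemma principal_maximal_ideal_chain_product:
  assumes \<sigma>: "\<And>x. x \<in> X \<Longrightarrow> \<sigma> x \<ge> 1"
  shows "mv_principal_maximal_ideal (chain_product X \<sigma>) J \<longleftrightarrow> (\<exists>x\<in>X. J = vanishing X \<sigma> x)"
proof
  assume "\<exists>x\<in>X. J = vanishing X \<sigma> x"
  then obtain x where x: "x \<in> X" "J = vanishing X \<sigma> x" by blast
  then show "mv_principal_maximal_ideal (chain_product X \<sigma>) J"
    unfolding mv_principal_maximal_ideal_def
    using vanishing_maximal[OF x(1), of \<sigma>] vanishing_principal[OF x(1), of \<sigma>] \<sigma> by simp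
next
  interpret mv_algebra "chain_product X \<sigma>" by (rule mv_algebra_chain_product)
  let ?P = "chain_product X \<sigma>"
  assume "mv_principal_maximal_ideal ?P J"
  then have J: "mv_maximal_ideal ?P J" and "mv_principal_ideal ?P J"
    unfolding mv_principal_maximal_ideal_def by auto
  then obtain a where a: "a \<in> (\<Pi>\<^sub>E x\<in>X. {..\<sigma> x})"
    and Ja: "J = {f \<in> carrier ?P. \<exists>n\<ge>1. mv_le ?P f (mv_multiple ?P n a)}"
    unfolding mv_principal_ideal_def by auto
  have J': "mv_ideal ?P J" "J \<noteq> carrier ?P"
    and max: "\<And>K. mv_ideal ?P K \<Longrightarrow> K \<noteq> carrier ?P \<Longrightarrow> J \<subseteq> K \<Longrightarrow> K = J"
    using J unfolding mv_maximal_ideal_def by auto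
  have le: "mv_le ?P f (mv_multiple ?P n a) \<longleftrightarrow> (\<forall>x\<in>X. f x \<le> n * a x)" if f: "f \<in> (\<Pi>\<^sub>E x\<in>X. {..\<sigma> x})" for f n
    using f chain_product_le[OF f]
    by (subst chain_product_multiple[OF a], subst chain_product_mv_le[OF f]) auto
  \<comment> \<open>For the idempotent of \<open>S\<close>, membership in \<open>J\<close> means
    that a single multiple of \<open>a\<close> dominates \<open>\<sigma>\<close> on all of
    \<open>S\<close>.\<close>
  have idem: "chain_idem X \<sigma> S \<in> J \<longleftrightarrow> (\<exists>n. \<forall>x\<in>S. \<sigma> x \<le> n * a x)" if S: "S \<subseteq> X" for S
  proof -
    have "chain_idem X \<sigma> S \<in> J \<longleftrightarrow> (\<exists>n\<ge>1. \<forall>x\<in>X. chain_idem X \<sigma> S x \<le> n * a x)"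
      using chain_idem_closed[of X \<sigma> S] le by (simp add: Ja)
    also have "\<dots> \<longleftrightarrow> (\<exists>n\<ge>1. \<forall>x\<in>S. \<sigma> x \<le> n * a x)"
      using S by (intro ex_cong1 conj_cong refl) (auto simp: chain_idem_def)
    also have "\<dots> \<longleftrightarrow> (\<exists>n. \<forall>x\<in>S. \<sigma> x \<le> n * a x)"
    proof
      assume "\<exists>n. \<forall>x\<in>S. \<sigma> x \<le> n * a x"
      then obtain n where "\<forall>x\<in>S. \<sigma> x \<le> n * a x" by blast
      then have "\<forall>x\<in>S. \<sigma> x \<le> Suc n * a x" by (auto intro: trans_le_add2)
      then show "\<exists>n\<ge>1. \<forall>x\<in>S. \<sigma> x \<le> n * a x" by (intro exI[of _ "Suc n"]) simp
    qed blast
    finally show ?thesis .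
  qed
  have "\<exists>x\<in>X. a x = 0"
  proof (rule ccontr)
    assume "\<not> (\<exists>x\<in>X. a x = 0)"
    then have pos: "a x \<ge> 1" if "x \<in> X" for x using that by force
    \<comment> \<open>\<open>q\<close> is unbounded because \<open>J\<close> is proper; splitting \<open>X\<close> into two parts on which \<open>q\<close> is
      unbounded yields two complementary idempotents outside \<open>J\<close>.\<close>
    define q where "q x = (LEAST n. \<sigma> x \<le> n * a x)" for x
    have q: "q x \<le> n \<longleftrightarrow> \<sigma> x \<le> n * a x" if x: "x \<in> X" for x n
    proof
      assume "q x \<le> n"
      moreover have "\<sigma> x \<le> q x * a x"
        unfolding q_def by (rule LeastI[of _ "\<sigma> x"]) (use pos[OF x] in simp)
      ultimately show "\<sigma> x \<le> n * a x" using mult_le_mono1 order_trans by blast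
    qed (simp add: q_def Least_le)
    have fin: "chain_idem X \<sigma> S \<in> J \<longleftrightarrow> finite (q ` S)" if S: "S \<subseteq> X" for S
      using idem[OF S] q S unfolding finite_nat_set_iff_bounded_le by (auto simp: subset_iff)
    have "chain_idem X \<sigma> X = neg zro" by (auto simp: chain_idem_def fun_eq_iff)
    then have inf: "infinite (q ` X)" using fin[of X] ideal_top[OF J'(1)] J'(2) by simp
    obtain C :: "nat \<Rightarrow> nat set" where C: "pairwise (\<lambda>i j. disjnt (C i) (C j)) UNIV"
      "(\<Union>i. C i) \<subseteq> q ` X" "\<And>i. infinite (C i)"
      using infinite_infinite_partition[OF inf] by blast
    define S where "S = {x \<in> X. q x \<in> C 0}"
    have "C 0 \<subseteq> q ` S" using C(2) by (auto simp: S_def)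
    then have S: "infinite (q ` S)" using C(3) finite_subset by blast
    have "C 1 \<inter> C 0 = {}" using C(1) by (auto simp: pairwise_def disjnt_def)
    have "C 1 \<subseteq> q ` (X - S)"
    proof
      fix c assume c: "c \<in> C 1"
      then obtain x where "x \<in> X" "c = q x" using C(2) by blast
      with c \<open>C 1 \<inter> C 0 = {}\<close> show "c \<in> q ` (X - S)" unfolding S_def by blast
    qed
    then have "infinite (q ` (X - S))" using C(3) finite_subset by blast
    then show False using S maximal_idem[OF J, of S] fin[of S] fin[of "X - S"] by (auto simp: S_def)
  qed
  then obtain x where x: "x \<in> X" "a x = 0" by blast
  have "J \<subseteq> vanishing X \<sigma> x" unfolding Ja vanishing_def using le x by fastforce
  then have "vanishing X \<sigma> x = J"
    using max[OF mv_ideal_vanishing[OF x(1)]] vanishing_maximal[OF x(1), of \<sigma>] \<sigma>[OF x(1)]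
    unfolding mv_maximal_ideal_def by blast
  then show "\<exists>x\<in>X. J = vanishing X \<sigma> x" using x by blast
qed

section \<open>Morphisms of multisets and homomorphisms of products\<close>

text \<open>The image \<open>c\<close> of 1 determines \<open>g\<close> as truncated multiplication
  by \<open>c\<close>. Compatibility with negation at 1 gives \<open>m * c = n\<close>, so no
  truncation ever occurs.\<close>

lemma mv_chain_hom:
  assumes g: "g \<in> mv_hom (mv_chain m) (mv_chain n)" and m: "m \<ge> 1" and n: "n \<ge> 1"
  shows "m dvd n" and "k \<le> m \<Longrightarrow> g k = k * (n div m)"
proof -
  note hom = mv_homD[OF g, simplified]
  define c where "c = g 1"
  have c: "c \<le> n" using hom(1)[of 1] m by (simp add: c_def)
  have mulc: "k \<le> m \<Longrightarrow> g k = min n (k * c)" for k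
  proof (induction k)
    case 0
    then show ?case using hom(2) by simp
  next
    case (Suc k)
    have "min m (k + 1) = Suc k" using Suc.prems by simp
    then have "g (Suc k) = min n (g k + c)" using hom(3)[of k 1] m Suc.prems by (simp add: c_def)
    then show ?case using Suc by simp
  qed
  have top: "g m = n" using hom(4)[of 0] hom(2) by simp
  \<comment> \<open>\<open>m - 1\<close> is the negation of 1. As \<open>c\<close> is nonzero,
    \<open>n - c\<close> is below the top, so the truncated multiple
    \<open>min n ((m - 1) * c)\<close> equals \<open>(m - 1) * c\<close>.\<close>
  have "g (m - 1) = n - c" using hom(4)[of 1] m by (simp add: c_def)
  moreover have "c \<noteq> 0"
  proof
    assume "c = 0"
    then have "g m = 0" using mulc[of m] by simp
    then show False using top n by simp
  qed
  ultimately have "(m - 1) * c = n - c" using mulc[of "m - 1"] n c by (simp add: min_def split: if_splits)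
  moreover have "c \<le> m * c" using m by simp
  ultimately have "m * c = n" using c eq_diff_iff[of c "m * c" n] by (simp only: diff_mult_distrib mult_1)
  then show "m dvd n" and "k \<le> m \<Longrightarrow> g k = k * (n div m)"
    using mulc[of k] mult_le_mono1[of k m c] m by (auto simp: min_def)
qed

section \<open>Pullback along a morphism of multisets\<close>

definition chain_pullback ::
  "'i set \<Rightarrow> ('i \<Rightarrow> nat) \<Rightarrow> 'j set \<Rightarrow> ('j \<Rightarrow> nat) \<Rightarrow> ('i \<Rightarrow> 'j) \<Rightarrow> ('j \<Rightarrow> nat) \<Rightarrow> 'i \<Rightarrow> nat" where
  "chain_pullback X \<sigma> Y \<mu> \<phi> =
    (\<lambda>f\<in>carrier (chain_product Y \<mu>). \<lambda>x\<in>X. f (\<phi> x) * (\<sigma> x div \<mu> (\<phi> x)))"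

locale multiset_morphism =
  fixes X :: "'i set" and \<sigma> :: "'i \<Rightarrow> nat" and Y :: "'j set" and \<mu> :: "'j \<Rightarrow> nat" and \<phi> :: "'i \<Rightarrow> 'j"
  assumes \<sigma>_pos: "x \<in> X \<Longrightarrow> \<sigma> x \<ge> 1" and \<mu>_pos: "y \<in> Y \<Longrightarrow> \<mu> y \<ge> 1"
    and \<phi>_closed: "x \<in> X \<Longrightarrow> \<phi> x \<in> Y" and \<phi>_dvd: "x \<in> X \<Longrightarrow> \<mu> (\<phi> x) dvd \<sigma> x"
begin

lemma factor:
  assumes "x \<in> X" obtains c where "c \<ge> 1" "\<sigma> x = \<mu> (\<phi> x) * c" "\<sigma> x div \<mu> (\<phi> x) = c"
proof -
  obtain c where c: "\<sigma> x = \<mu> (\<phi> x) * c" using \<phi>_dvd[OF assms] by blast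
  then show ?thesis using that[of c] \<sigma>_pos[OF assms] \<mu>_pos[OF \<phi>_closed[OF assms]] by (cases c) auto
qed

lemma pullback_hom: "chain_pullback X \<sigma> Y \<mu> \<phi> \<in> mv_hom (chain_product Y \<mu>) (chain_product X \<sigma>)"
  unfolding chain_pullback_def
proof (rule mv_homI[OF mv_algebra_chain_product])
  fix f assume f: "f \<in> carrier (chain_product Y \<mu>)"
  note fle = chain_product_le[OF f[simplified] \<phi>_closed]
  have "f (\<phi> x) * (\<sigma> x div \<mu> (\<phi> x)) \<le> \<sigma> x" if x: "x \<in> X" for x
    using factor[OF x] fle[OF x] mult_le_mono1 by metis
  then show "(\<lambda>x\<in>X. f (\<phi> x) * (\<sigma> x div \<mu> (\<phi> x))) \<in> carrier (chain_product X \<sigma>)" by auto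
  have "(\<mu> (\<phi> x) - f (\<phi> x)) * (\<sigma> x div \<mu> (\<phi> x)) = \<sigma> x - f (\<phi> x) * (\<sigma> x div \<mu> (\<phi> x))" if x: "x \<in> X" for x
    using factor[OF x] diff_mult_distrib by metis
  then show "(\<lambda>x\<in>X. mv_neg (chain_product Y \<mu>) f (\<phi> x) * (\<sigma> x div \<mu> (\<phi> x))) =
      mv_neg (chain_product X \<sigma>) (\<lambda>x\<in>X. f (\<phi> x) * (\<sigma> x div \<mu> (\<phi> x)))"
    using \<phi>_closed by (auto simp: fun_eq_iff)
  fix g assume g: "g \<in> carrier (chain_product Y \<mu>)"
  have "min (\<mu> (\<phi> x)) (a + b) * (\<sigma> x div \<mu> (\<phi> x)) =
      min (\<sigma> x) (a * (\<sigma> x div \<mu> (\<phi> x)) + b * (\<sigma> x div \<mu> (\<phi> x)))" if x: "x \<in> X" for x a b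
    using factor[OF x] nat_mult_min_left add_mult_distrib by metis
  then show "(\<lambda>x\<in>X. (f \<boxplus>\<^bsub>chain_product Y \<mu>\<^esub> g) (\<phi> x) * (\<sigma> x div \<mu> (\<phi> x))) =
      (\<lambda>x\<in>X. f (\<phi> x) * (\<sigma> x div \<mu> (\<phi> x))) \<boxplus>\<^bsub>chain_product X \<sigma>\<^esub> (\<lambda>x\<in>X. g (\<phi> x) * (\<sigma> x div \<mu> (\<phi> x)))"
    using \<phi>_closed by (auto simp: fun_eq_iff)
qed (use \<phi>_closed in auto)

lemma pullback_vanishing:
  assumes x: "x \<in> X"
  shows "{f \<in> carrier (chain_product Y \<mu>). chain_pullback X \<sigma> Y \<mu> \<phi> f \<in> vanishing X \<sigma> x} = vanishing Y \<mu> (\<phi> x)"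
proof -
  have "\<sigma> x div \<mu> (\<phi> x) \<noteq> 0" using factor[OF x] by (metis not_one_le_zero)
  then have "chain_pullback X \<sigma> Y \<mu> \<phi> f x = 0 \<longleftrightarrow> f (\<phi> x) = 0" if "f \<in> carrier (chain_product Y \<mu>)" for f
    using x that by (simp add: chain_pullback_def)
  then show ?thesis
    using mv_homD(1)[OF pullback_hom] unfolding vanishing_def by blast
qed

lemma pullback_reflects:
  "reflects_principal_maximal_ideals (chain_product Y \<mu>) (chain_product X \<sigma>) (chain_pullback X \<sigma> Y \<mu> \<phi>)"
  unfolding reflects_principal_maximal_ideals_def
proof (intro allI impI)
  fix J assume "mv_principal_maximal_ideal (chain_product X \<sigma>) J"
  then obtain x where x: "x \<in> X" "J = vanishing X \<sigma> x"
    using principal_maximal_ideal_chain_product[of X \<sigma>] \<sigma>_pos by auto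
  then show "mv_principal_maximal_ideal (chain_product Y \<mu>)
      {f \<in> carrier (chain_product Y \<mu>). chain_pullback X \<sigma> Y \<mu> \<phi> f \<in> J}"
    using principal_maximal_ideal_chain_product[of Y \<mu>] \<mu>_pos \<phi>_closed pullback_vanishing[OF x(1)] by auto
qed

end

lemma vanishing_inject:
  assumes "\<mu> y \<ge> 1" "y \<in> Y" "y' \<in> Y" "vanishing Y \<mu> y = vanishing Y \<mu> y'" shows "y = y'"
proof (rule ccontr)
  assume "y \<noteq> y'"
  moreover have "chain_idem Y \<mu> (Y - {y'}) \<in> vanishing Y \<mu> y'"
    using chain_idem_closed[of Y \<mu> "Y - {y'}"] assms by (simp add: vanishing_def chain_idem_def)
  then have "chain_idem Y \<mu> (Y - {y'}) \<in> vanishing Y \<mu> y" using assms by simp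
  ultimately show False using assms by (simp add: vanishing_def chain_idem_def)
qed

text \<open>The preimage of the kernel at \<open>x\<close> under the pullback is the kernel at
  \<open>\<phi> x\<close>, and a kernel determines its point.\<close>

lemma chain_pullback_inject:
  assumes "multiset_morphism X \<sigma> Y \<mu> \<phi>" "multiset_morphism X \<sigma> Y \<mu> \<psi>"
    and "chain_pullback X \<sigma> Y \<mu> \<phi> = chain_pullback X \<sigma> Y \<mu> \<psi>" and x: "x \<in> X"
  shows "\<phi> x = \<psi> x"
  using multiset_morphism.pullback_vanishing[OF assms(1) x] multiset_morphism.pullback_vanishing[OF assms(2) x]
    multiset_morphism.\<phi>_closed[OF assms(1) x] multiset_morphism.\<phi>_closed[OF assms(2) x]
    multiset_morphism.\<mu>_pos[OF assms(1)] assms(3)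
  by (intro vanishing_inject[of \<mu> _ Y]) auto

lemma chain_pullback_id:
  assumes "\<And>x. x \<in> X \<Longrightarrow> \<sigma> x \<ge> 1"
  shows "chain_pullback X \<sigma> X \<sigma> (\<lambda>x\<in>X. x) = (\<lambda>f\<in>carrier (chain_product X \<sigma>). f)"
proof -
  have "\<sigma> x div \<sigma> x = 1" if "x \<in> X" for x using assms[OF that] by simp
  then show ?thesis
    by (auto simp: chain_pullback_def fun_eq_iff restrict_def PiE_def extensional_def)
qed

lemma chain_pullback_compose:
  assumes "multiset_morphism X \<sigma> Y \<mu> \<phi>" "multiset_morphism Y \<mu> Z \<nu> \<psi>"
  shows "chain_pullback X \<sigma> Z \<nu> (compose X \<psi> \<phi>) =
    compose (carrier (chain_product Z \<nu>)) (chain_pullback X \<sigma> Y \<mu> \<phi>) (chain_pullback Y \<mu> Z \<nu> \<psi>)"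
proof (rule ext)
  fix f
  show "chain_pullback X \<sigma> Z \<nu> (compose X \<psi> \<phi>) f =
    compose (carrier (chain_product Z \<nu>)) (chain_pullback X \<sigma> Y \<mu> \<phi>) (chain_pullback Y \<mu> Z \<nu> \<psi>) f"
  proof (cases "f \<in> carrier (chain_product Z \<nu>)")
    case f: True
    have "f (\<psi> (\<phi> x)) * (\<sigma> x div \<nu> (\<psi> (\<phi> x))) =
        f (\<psi> (\<phi> x)) * (\<mu> (\<phi> x) div \<nu> (\<psi> (\<phi> x))) * (\<sigma> x div \<mu> (\<phi> x))" if x: "x \<in> X" for x
    proof -
      have y: "\<phi> x \<in> Y" using multiset_morphism.\<phi>_closed[OF assms(1) x] .
      obtain c where c: "c \<ge> 1" "\<sigma> x = \<mu> (\<phi> x) * c" "\<sigma> x div \<mu> (\<phi> x) = c"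
        using multiset_morphism.factor[OF assms(1) x] .
      obtain d where d: "d \<ge> 1" "\<mu> (\<phi> x) = \<nu> (\<psi> (\<phi> x)) * d" "\<mu> (\<phi> x) div \<nu> (\<psi> (\<phi> x)) = d"
        using multiset_morphism.factor[OF assms(2) y] .
      have "\<sigma> x = \<nu> (\<psi> (\<phi> x)) * (d * c)" unfolding c(2) d(2) by simp
      moreover have "\<nu> (\<psi> (\<phi> x)) \<ge> 1"
        using multiset_morphism.\<mu>_pos[OF assms(2) multiset_morphism.\<phi>_closed[OF assms(2) y]] .
      ultimately have "\<sigma> x div \<nu> (\<psi> (\<phi> x)) = d * c" by simp
      then show ?thesis using c d by simp
    qed
    then show ?thesis
      using f mv_homD(1)[OF multiset_morphism.pullback_hom[OF assms(2)] f] multiset_morphism.\<phi>_closed[OF assms(1)]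
      unfolding compose_def chain_pullback_def by (auto simp: fun_eq_iff)
  qed (simp add: chain_pullback_def compose_def)
qed

text \<open>Reflection makes the preimage of the kernel at \<open>x\<close> the kernel at some
  point; this point is \<open>\<phi> x\<close>. It remains to see that the coordinate of
  \<open>h\<close> at \<open>x\<close> depends on the argument at \<open>\<phi> x\<close> only and
  is a homomorphism of chains there.\<close>

lemma chain_pullback_surj:
  assumes \<sigma>: "\<And>x. x \<in> X \<Longrightarrow> \<sigma> x \<ge> 1" and \<mu>: "\<And>y. y \<in> Y \<Longrightarrow> \<mu> y \<ge> 1"
    and h: "h \<in> mv_hom (chain_product Y \<mu>) (chain_product X \<sigma>)"
    and refl: "reflects_principal_maximal_ideals (chain_product Y \<mu>) (chain_product X \<sigma>) h"
  obtains \<phi> where "\<phi> \<in> X \<rightarrow>\<^sub>E Y" "multiset_morphism X \<sigma> Y \<mu> \<phi>" "h = chain_pullback X \<sigma> Y \<mu> \<phi>"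
proof -
  let ?P = "chain_product X \<sigma>" and ?Q = "chain_product Y \<mu>"
  have "\<exists>y\<in>Y. {f \<in> carrier ?Q. h f \<in> vanishing X \<sigma> x} = vanishing Y \<mu> y" if "x \<in> X" for x
    using refl principal_maximal_ideal_chain_product[of X \<sigma>] principal_maximal_ideal_chain_product[of Y \<mu>] \<sigma> \<mu> that
    unfolding reflects_principal_maximal_ideals_def by auto
  then have "\<forall>x\<in>X. \<exists>y. y \<in> Y \<and> {f \<in> carrier ?Q. h f \<in> vanishing X \<sigma> x} = vanishing Y \<mu> y" by blast
  from bchoice[OF this] obtain \<phi>0 where \<phi>0: "\<And>x. x \<in> X \<Longrightarrow> \<phi>0 x \<in> Y"
    "\<And>x. x \<in> X \<Longrightarrow> {f \<in> carrier ?Q. h f \<in> vanishing X \<sigma> x} = vanishing Y \<mu> (\<phi>0 x)"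
    by blast
  define \<phi> where "\<phi> = restrict \<phi>0 X"
  note hom = mv_homD[OF h]
  have key: "\<mu> (\<phi> x) dvd \<sigma> x \<and> (\<forall>f\<in>carrier ?Q. h f x = f (\<phi> x) * (\<sigma> x div \<mu> (\<phi> x)))" if x: "x \<in> X" for x
  proof -
    let ?y = "\<phi> x"
    have y: "?y \<in> Y" and van: "\<And>f. f \<in> carrier ?Q \<Longrightarrow> h f x = 0 \<longleftrightarrow> f ?y = 0"
      using \<phi>0[OF x] x hom(1) unfolding \<phi>_def vanishing_def by auto
    \<comment> \<open>\<open>?u\<close> is the top away from \<open>?y\<close> and zero at
      \<open>?y\<close>, so its image vanishes at \<open>x\<close>. Adding it erases all coordinates
      of \<open>f\<close> other than \<open>?y\<close> and leaves the value of \<open>h f\<close> at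
      \<open>x\<close> unchanged.\<close>
    have agree: "h f x = h f' x" if f: "f \<in> carrier ?Q" "f' \<in> carrier ?Q" "f ?y = f' ?y" for f f'
    proof -
      let ?u = "chain_idem Y \<mu> (Y - {?y})"
      have u: "?u \<in> carrier ?Q" "h ?u x = 0" using chain_idem_closed van[of ?u] y by (auto simp: chain_idem_def)
      have "f \<boxplus>\<^bsub>?Q\<^esub> ?u = f' \<boxplus>\<^bsub>?Q\<^esub> ?u" using f by (auto simp: chain_idem_def fun_eq_iff)
      then have "h f \<boxplus>\<^bsub>?P\<^esub> h ?u = h f' \<boxplus>\<^bsub>?P\<^esub> h ?u" using hom(3) f u(1) by metis
      then have "(h f \<boxplus>\<^bsub>?P\<^esub> h ?u) x = (h f' \<boxplus>\<^bsub>?P\<^esub> h ?u) x" by simp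
      then have "min (\<sigma> x) (h f x) = min (\<sigma> x) (h f' x)" using x u by simp
      then show ?thesis
        using chain_product_le[OF _ x, of "h f" \<sigma>] chain_product_le[OF _ x, of "h f'" \<sigma>] hom(1) f by simp
    qed
    \<comment> \<open>A set-theoretic section of the projection to \<open>?y\<close>. It does not
      commute with negation, since \<open>neg\<close> of \<open>s k\<close> is nonzero away from
      \<open>?y\<close>; \<open>agree\<close> repairs this after composing with \<open>h\<close> at
      \<open>x\<close>.\<close>
    define s where "s k = (\<lambda>z\<in>Y. if z = ?y then k else 0)" for k :: nat
    have s: "s k \<in> carrier ?Q" "s k ?y = k" if "k \<le> \<mu> ?y" for k using that y by (auto simp: s_def)
    have g: "restrict (\<lambda>k. h (s k) x) (carrier (mv_chain (\<mu> ?y))) \<in> mv_hom (mv_chain (\<mu> ?y)) (mv_chain (\<sigma> x))"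
    proof (rule mv_homI[OF mv_algebra_mv_chain])
      fix k assume k: "k \<in> carrier (mv_chain (\<mu> ?y))"
      then show "h (s k) x \<in> carrier (mv_chain (\<sigma> x))"
        using s hom(1)[of "s k"] chain_product_le[OF _ x, of "h (s k)" \<sigma>] by simp
      have "h (s (\<mu> ?y - k)) x = h (mv_neg ?Q (s k)) x"
        using s[of k] s[of "\<mu> ?y - k"] k y mv_algebra.neg_closed[OF mv_algebra_chain_product, of "s k" Y \<mu>]
        by (intro agree) auto
      then show "h (s (mv_neg (mv_chain (\<mu> ?y)) k)) x = mv_neg (mv_chain (\<sigma> x)) (h (s k) x)"
        using hom(4) s k x by simp
      fix l assume l: "l \<in> carrier (mv_chain (\<mu> ?y))"
      have "s (min (\<mu> ?y) (k + l)) = s k \<boxplus>\<^bsub>?Q\<^esub> s l" by (auto simp: s_def fun_eq_iff)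
      then show "h (s (k \<boxplus>\<^bsub>mv_chain (\<mu> ?y)\<^esub> l)) x = h (s k) x \<boxplus>\<^bsub>mv_chain (\<sigma> x)\<^esub> h (s l) x"
        using hom(3)[of "s k" "s l"] s k l x by simp
    next
      show "h (s (mv_zero (mv_chain (\<mu> ?y)))) x = mv_zero (mv_chain (\<sigma> x))"
        using van[of "s 0"] s[of 0] by simp
    qed
    note ch = mv_chain_hom[OF g \<mu>[OF y] \<sigma>[OF x]]
    have "h f x = f ?y * (\<sigma> x div \<mu> ?y)" if f: "f \<in> carrier ?Q" for f
    proof -
      have fy: "f ?y \<le> \<mu> ?y" using chain_product_le[OF _ y] f by simp
      have "h f x = h (s (f ?y)) x" using agree[OF f] s[OF fy] by simp
      then show ?thesis using ch(2)[OF fy] fy by simp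
    qed
    with ch(1) show ?thesis by blast
  qed
  have "multiset_morphism X \<sigma> Y \<mu> \<phi>"
    by standard (use \<sigma> \<mu> key \<phi>0 in \<open>auto simp: \<phi>_def\<close>)
  moreover have "h = chain_pullback X \<sigma> Y \<mu> \<phi>"
  proof (rule mv_hom_ext[OF h multiset_morphism.pullback_hom[OF calculation]])
    fix f assume f: "f \<in> carrier ?Q"
    then have "h f \<in> extensional X" using hom(1) by (auto simp: PiE_def)
    then show "h f = chain_pullback X \<sigma> Y \<mu> \<phi> f"
      using key f by (intro extensionalityI[of _ X]) (simp_all add: chain_pullback_def)
  qed
  moreover have "\<phi> \<in> X \<rightarrow>\<^sub>E Y" using \<phi>0 by (auto simp: \<phi>_def)
  ultimately show ?thesis using that by blast
qed

section \<open>Profinite MV-algebras are products of finite chains\<close>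

lemma mv_chain_multiple: "a \<le> n \<Longrightarrow> mv_multiple (mv_chain n) k a = min n (k * a)"
proof (induction k)
  case (Suc k)
  have "mv_multiple (mv_chain n) (Suc k) a = mv_multiple (mv_chain n) k a \<boxplus>\<^bsub>mv_chain n\<^esub> a"
    by (simp add: mv_multiple_def)
  then show ?case using Suc by (simp add: add_ac)
qed (simp add: mv_multiple_def)

section \<open>Characters: homomorphisms onto finite chains\<close>

text \<open>The length of the chain is recovered as the value at the top instead of being a
  parameter, so that characters of all lengths form one set of functions.\<close>

definition chain_char :: "'a mv_algebra \<Rightarrow> ('a \<Rightarrow> nat) \<Rightarrow> bool" where
  "chain_char A h \<longleftrightarrow> (let n = h (mv_neg A (mv_zero A)) in
    n \<ge> 1 \<and> h \<in> mv_hom A (mv_chain n) \<and> h ` carrier A = {..n})"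

context mv_algebra
begin

text \<open>Kept folded: written as \<open>neg zro\<close>, the right side of
  \<open>h (neg x) = h unity - h x\<close> would contain another instance of its left side.\<close>

definition "unity = neg zro"

lemma unity_closed [simp]: "unity \<in> carrier A"
  by (simp add: unity_def)

lemma chain_charI:
  assumes "n \<ge> 1" "h \<in> mv_hom A (mv_chain n)" "h ` carrier A = {..n}" shows "chain_char A h"
proof -
  have "h (neg zro) = n" using mv_homD[OF assms(2)] by simp
  then show ?thesis using assms by (simp add: chain_char_def)
qed

lemma chain_charD:
  assumes "chain_char A h"
  shows "h unity \<ge> 1" "h \<in> mv_hom A (mv_chain (h unity))" "h ` carrier A = {..h unity}"
    "x \<in> carrier A \<Longrightarrow> h x \<le> h unity" "h zro = 0"
    "x \<in> carrier A \<Longrightarrow> y \<in> carrier A \<Longrightarrow> h (x \<boxplus> y) = min (h unity) (h x + h y)"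
    "x \<in> carrier A \<Longrightarrow> h (neg x) = h unity - h x"
proof -
  show h: "h unity \<ge> 1" "h \<in> mv_hom A (mv_chain (h unity))" "h ` carrier A = {..h unity}"
    using assms by (simp_all add: chain_char_def Let_def unity_def)
  note hom = mv_homD[OF h(2), simplified]
  show "x \<in> carrier A \<Longrightarrow> h x \<le> h unity" by (rule hom(1))
  show "h zro = 0" by (rule hom(2))
  show "x \<in> carrier A \<Longrightarrow> y \<in> carrier A \<Longrightarrow> h (x \<boxplus> y) = min (h unity) (h x + h y)" by (rule hom(3))
  show "x \<in> carrier A \<Longrightarrow> h (neg x) = h unity - h x" by (rule hom(4))
qed

lemma chain_char_minus:
  assumes "chain_char A h" "x \<in> carrier A" "y \<in> carrier A" shows "h (x \<ominus> y) = h x - h y"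
proof -
  have "h (x \<ominus> y) = h unity - min (h unity) ((h unity - h x) + h y)"
    using chain_charD(6,7)[OF assms(1)] assms(2,3) by simp
  then show ?thesis using chain_charD(4)[OF assms(1,2)] by linarith
qed

text \<open>Inclusion of kernels makes \<open>h\<close> constant on the fibres of \<open>h'\<close>,
  because both truncated differences of two elements in a fibre lie in the kernel. Hence
  \<open>h\<close> factors through a homomorphism between chains and is a multiple of
  \<open>h'\<close>; since \<open>h\<close> is onto, the factor is 1.\<close>

lemma chain_char_eqI:
  assumes h: "chain_char A h" and h': "chain_char A h'"
    and ker: "\<And>a. a \<in> carrier A \<Longrightarrow> h' a = 0 \<Longrightarrow> h a = 0"
  shows "h = h'"
proof -
  note H = chain_charD[OF h] and H' = chain_charD[OF h']
  define s where "s k = (SOME a. a \<in> carrier A \<and> h' a = k)" for k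
  have s: "s k \<in> carrier A" "h' (s k) = k" if "k \<le> h' unity" for k
  proof -
    have "k \<in> h' ` carrier A" using H'(3) that by simp
    then have "\<exists>a. a \<in> carrier A \<and> h' a = k" by auto
    from someI_ex[OF this] show "s k \<in> carrier A" "h' (s k) = k" unfolding s_def by auto
  qed
  have le: "h a \<le> h b" if ab: "a \<in> carrier A" "b \<in> carrier A" "h' a = h' b" for a b
    using ker[of "a \<ominus> b"] chain_char_minus[OF h ab(1,2)] chain_char_minus[OF h' ab(1,2)] ab by simp
  then have eq: "h a = h b" if "a \<in> carrier A" "b \<in> carrier A" "h' a = h' b" for a b
    using that by (metis order_antisym)
  have g: "restrict (\<lambda>k. h (s k)) (carrier (mv_chain (h' unity))) \<in> mv_hom (mv_chain (h' unity)) (mv_chain (h unity))"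
  proof (rule mv_homI[OF mv_algebra_mv_chain])
    show "h (s (mv_zero (mv_chain (h' unity)))) = mv_zero (mv_chain (h unity))"
      using ker[of "s 0"] s[of 0] by simp
  next
    fix k assume k: "k \<in> carrier (mv_chain (h' unity))"
    then show "h (s k) \<in> carrier (mv_chain (h unity))" using H(4) s by simp
    have "h (s (h' unity - k)) = h (neg (s k))"
      using s[of k] s[of "h' unity - k"] k H'(7)[of "s k"] by (intro eq) auto
    then show "h (s (mv_neg (mv_chain (h' unity)) k)) = mv_neg (mv_chain (h unity)) (h (s k))"
      using H(7) s k by simp
    fix l assume l: "l \<in> carrier (mv_chain (h' unity))"
    have "h (s (min (h' unity) (k + l))) = h (s k \<boxplus> s l)"
      using s[of k] s[of l] s[of "min (h' unity) (k + l)"] k l H'(6)[of "s k" "s l"] by (intro eq) auto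
    then show "h (s (k \<boxplus>\<^bsub>mv_chain (h' unity)\<^esub> l)) = h (s k) \<boxplus>\<^bsub>mv_chain (h unity)\<^esub> h (s l)"
      using H(6) s k l by simp
  qed
  have fac: "h a = h' a * (h unity div h' unity)" if a: "a \<in> carrier A" for a
    using mv_chain_hom(2)[OF g H'(1) H(1) H'(4)[OF a]] H'(4)[OF a] eq[OF a s(1)[OF H'(4)[OF a]]] s(2)[OF H'(4)[OF a]]
    by simp
  \<comment> \<open>The value 1 is attained by \<open>h\<close> and is a multiple of the quotient,
    which is therefore 1.\<close>
  have "1 \<in> h ` carrier A" using H(1,3) by simp
  then obtain a where "a \<in> carrier A" "h a = 1" by (metis imageE)
  then have "h unity div h' unity = 1" using fac[of a] by simp
  then have "h x = h' x" if "x \<in> carrier A" for x using fac[OF that] by (metis mult_1_right)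
  then show ?thesis by (rule mv_hom_ext[OF H(2) H'(2)])
qed

text \<open>Some \<open>a\<close> is in the kernel of \<open>h'\<close> but not of \<open>h\<close>;
  since \<open>h a \<ge> 1\<close>, \<open>h unity\<close> copies of it reach the top under
  \<open>h\<close> and still vanish under \<open>h'\<close>.\<close>

lemma chain_char_separate:
  assumes h: "chain_char A h" and h': "chain_char A h'" and ne: "h \<noteq> h'"
  obtains a where "a \<in> carrier A" "h a = h unity" "h' a = 0"
proof -
  obtain a where a: "a \<in> carrier A" "h' a = 0" "h a \<noteq> 0"
    using chain_char_eqI[OF h h'] ne by blast
  have "h (mul (h unity) a) = h unity"
    using mv_hom_multiple[OF mv_algebra_axioms chain_charD(2)[OF h] a(1), of "h unity"]
      mv_chain_multiple[OF chain_charD(4)[OF h a(1)], of "h unity"] a(3) by simp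
  moreover have "h' (mul (h unity) a) = 0"
    using mv_hom_multiple[OF mv_algebra_axioms chain_charD(2)[OF h'] a(1), of "h unity"]
      mv_chain_multiple[of 0 "h' unity" "h unity"] a(2) by simp
  ultimately show ?thesis using that[of "mul (h unity) a"] a by simp
qed

text \<open>The Lukasiewicz product, a truncated \<open>x + y - 1\<close>. The top is neutral and
  zero is absorbing, so a factor with only these values under given characters acts as a
  switch.\<close>

abbreviation otimes where "otimes x y \<equiv> neg (neg x \<boxplus> neg y)"

lemma chain_char_otimes:
  "chain_char A h \<Longrightarrow> x \<in> carrier A \<Longrightarrow> y \<in> carrier A \<Longrightarrow>
    h (otimes x y) = h unity - min (h unity) ((h unity - h x) + (h unity - h y))"
  using chain_charD[of h] by simp

text \<open>The Lukasiewicz product of the elements that separate \<open>h\<close> from each member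
  of \<open>F\<close>.\<close>

lemma chain_char_separate_finite:
  assumes h: "chain_char A h" and "finite F" "\<And>k. k \<in> F \<Longrightarrow> chain_char A k" "h \<notin> F"
  shows "\<exists>e\<in>carrier A. h e = h unity \<and> (\<forall>k\<in>F. k e = 0)"
  using assms(2-)
proof (induction F rule: finite_induct)
  case empty
  then show ?case by (intro bexI[of _ unity]) auto
next
  case (insert k F)
  then obtain e where e: "e \<in> carrier A" "h e = h unity" "\<forall>k\<in>F. k e = 0" by auto
  obtain a where a: "a \<in> carrier A" "h a = h unity" "k a = 0"
    using chain_char_separate[OF h, of k] insert by blast
  have "h (otimes e a) = h unity" using chain_char_otimes[OF h] e a by simp
  moreover have "k' (otimes e a) = 0" if k': "k' \<in> insert k F" for k'
    using chain_char_otimes[OF insert.prems(1)[OF k'] e(1) a(1)] k' e a by auto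
  ultimately show ?case using e a by (intro bexI[of _ "otimes e a"]) auto
qed

text \<open>A Chinese remainder argument, extending the prescribed values by one character at a
  time.\<close>

lemma chain_char_interpolate:
  assumes "finite F" "\<And>h. h \<in> F \<Longrightarrow> chain_char A h" "\<And>h. h \<in> F \<Longrightarrow> v h \<le> h unity"
  shows "\<exists>a\<in>carrier A. \<forall>h\<in>F. h a = v h"
  using assms
proof (induction F rule: finite_induct)
  case empty
  then show ?case using zero_closed by blast
next
  case (insert h F)
  then obtain a where a: "a \<in> carrier A" "\<forall>k\<in>F. k a = v k" by auto
  have h: "chain_char A h" using insert by simp
  obtain e where e: "e \<in> carrier A" "h e = h unity" "\<forall>k\<in>F. k e = 0"
    using chain_char_separate_finite[OF h insert.hyps(1) _ insert.hyps(2)] insert.prems(1) by auto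
  have "v h \<in> h ` carrier A" using chain_charD(3)[OF h] insert.prems(2)[of h] by simp
  then obtain b where b: "b \<in> carrier A" "h b = v h" by auto
  \<comment> \<open>Under \<open>h\<close> the switch \<open>e\<close> is the top and selects
    \<open>b\<close>; under the characters in \<open>F\<close> it is zero and selects
    \<open>a\<close>.\<close>
  let ?a = "otimes a (neg e) \<boxplus> otimes b e"
  have "h ?a = v h"
    using chain_charD(4)[OF h b(1)] chain_charD(4)[OF h a(1)] a b e
    by (simp add: chain_charD(6)[OF h] chain_charD(7)[OF h])
  moreover have "k ?a = v k" if k: "k \<in> F" for k
  proof -
    have kc: "chain_char A k" using insert k by simp
    show ?thesis
    proof -
      have v: "k e = 0" "k a = v k" using a e k by auto
      have "k (otimes a (neg e)) = k a"
        using chain_charD(4)[OF kc a(1)] a e v(1)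
        by (simp add: chain_charD(6)[OF kc] chain_charD(7)[OF kc])
      moreover have "k (otimes b e) = 0"
        using b e v(1) by (simp add: chain_charD(6)[OF kc] chain_charD(7)[OF kc])
      moreover have "k ?a = min (k unity) (k (otimes a (neg e)) + k (otimes b e))"
        using chain_charD(6)[OF kc] a b e by simp
      ultimately show ?thesis using chain_charD(4)[OF kc a(1)] v by simp
    qed
  qed
  ultimately show ?case using a b e by (intro bexI[of _ ?a]) auto
qed

end

section \<open>Inverse limits and their characters\<close>

text \<open>An inverse limit described from inside \<open>A\<close>. The transition maps survive
  only in the fact that \<open>p j\<close> determines \<open>p i\<close>, and threads are given by
  representatives \<open>a i\<close> in \<open>A\<close>, so they run through the images of the
  projections.\<close>

locale mv_cone = mv_algebra +
  fixes I :: "'i set" and r :: "'i rel" and B :: "'i \<Rightarrow> nat mv_algebra" and p :: "'i \<Rightarrow> 'a \<Rightarrow> nat"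
  assumes p_hom: "i \<in> I \<Longrightarrow> p i \<in> mv_hom A (B i)"
    and fin: "i \<in> I \<Longrightarrow> finite (carrier (B i))"
    and r_sub: "r \<subseteq> I \<times> I"
    and p_mono: "(i, j) \<in> r \<Longrightarrow> x \<in> carrier A \<Longrightarrow> y \<in> carrier A \<Longrightarrow> p j x = p j y \<Longrightarrow> p i x = p i y"
    and p_inj: "x \<in> carrier A \<Longrightarrow> y \<in> carrier A \<Longrightarrow> (\<And>i. i \<in> I \<Longrightarrow> p i x = p i y) \<Longrightarrow> x = y"
    and p_complete: "(\<And>i. i \<in> I \<Longrightarrow> a i \<in> carrier A) \<Longrightarrow>
      (\<And>i j. (i, j) \<in> r \<Longrightarrow> p i (a j) = p i (a i)) \<Longrightarrow> \<exists>x\<in>carrier A. \<forall>i\<in>I. p i x = p i (a i)"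

lemma mv_profinite_cone:
  assumes "mv_profinite TYPE('i) A"
  obtains I :: "'i set" and r B p where "mv_cone A I r B p"
proof -
  from assms have A: "mv_algebra A" unfolding mv_profinite_def by blast
  from assms obtain I :: "'i set" and r and B :: "'i \<Rightarrow> nat mv_algebra" and \<phi> where sys: "mv_inverse_system I r B \<phi>"
    and fin: "\<forall>i\<in>I. finite (carrier (B i))" and iso: "mv_isomorphic A (mv_inverse_limit I r B \<phi>)"
    unfolding mv_profinite_def by blast
  let ?L = "mv_inverse_limit I r B \<phi>"
  obtain k where k: "k \<in> mv_iso A ?L" using iso unfolding mv_isomorphic_def mv_iso_def by blast
  note kom = mv_homD[OF mv_isoD(1)[OF k]]
  interpret mv_algebra A by fact
  define p where "p i = (\<lambda>x\<in>carrier A. k x i)" for i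
  have r: "r \<subseteq> I \<times> I" using sys unfolding mv_inverse_system_def partial_order_on_def preorder_on_def by blast
  have L: "k x \<in> (\<Pi>\<^sub>E i\<in>I. carrier (B i))" "\<And>i j. (i, j) \<in> r \<Longrightarrow> \<phi> i j (k x j) = k x i" if "x \<in> carrier A" for x
    using kom(1)[OF that] by (auto simp: mv_inverse_limit_def)
  have "mv_cone A I r B p"
  proof
    fix i assume i: "i \<in> I"
    show "p i \<in> mv_hom A (B i)"
      unfolding p_def
    proof (rule mv_homI[OF A])
      show "k x i \<in> carrier (B i)" if "x \<in> carrier A" for x using L(1)[OF that] i by (auto simp: PiE_def)
    qed (use kom i in \<open>simp_all add: mv_inverse_limit_def\<close>)
    show "finite (carrier (B i))" using fin i by blast
  next
    show "r \<subseteq> I \<times> I" by (rule r)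
  next
    fix i j x y assume "(i, j) \<in> r" "x \<in> carrier A" "y \<in> carrier A" "p j x = p j y"
    then show "p i x = p i y" using L(2)[of x i j] L(2)[of y i j] by (simp add: p_def)
  next
    fix x y assume xy: "x \<in> carrier A" "y \<in> carrier A" "\<And>i. i \<in> I \<Longrightarrow> p i x = p i y"
    then have "k x = k y" using L(1) by (intro PiE_ext[of "k x" I _ "k y"]) (auto simp: p_def)
    then show "x = y" using mv_isoD(2)[OF k] xy by (auto simp: bij_betw_def inj_on_def)
  next
    fix a assume a: "\<And>i. i \<in> I \<Longrightarrow> a i \<in> carrier A" "\<And>i j. (i, j) \<in> r \<Longrightarrow> p i (a j) = p i (a i)"
    define b where "b = (\<lambda>i\<in>I. k (a i) i)"
    have "\<phi> i j (b j) = b i" if ij: "(i, j) \<in> r" for i j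
    proof -
      have "i \<in> I" "j \<in> I" using ij r by auto
      then show ?thesis using L(2)[OF a(1) ij, of j] a(2)[OF ij] a(1) by (simp add: b_def p_def)
    qed
    moreover have "b \<in> (\<Pi>\<^sub>E i\<in>I. carrier (B i))" using L(1)[OF a(1)] by (auto simp: b_def PiE_def Pi_def)
    ultimately have "b \<in> carrier ?L" by (auto simp: mv_inverse_limit_def)
    then obtain x where x: "x \<in> carrier A" "k x = b"
      using bij_betw_imp_surj_on[OF mv_isoD(2)[OF k]] by (metis imageE)
    then show "\<exists>x\<in>carrier A. \<forall>i\<in>I. p i x = p i (a i)"
      using a(1) by (intro bexI[of _ x]) (auto simp: p_def b_def)
  qed
  then show ?thesis by (rule that)
qed

context mv_cone
begin

text \<open>Factoring through \<open>p i\<close> is expressed as constancy on its fibres, since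
  \<open>p i\<close> need not be onto \<open>B i\<close>.\<close>

definition chars :: "'i \<Rightarrow> ('a \<Rightarrow> nat) set" where
  "chars i = {h. chain_char A h \<and> (\<forall>x\<in>carrier A. \<forall>y\<in>carrier A. p i x = p i y \<longrightarrow> h x = h y)}"

lemma chars_char: "h \<in> chars i \<Longrightarrow> chain_char A h"
  unfolding chars_def by blast

lemma chars_factor:
  "h \<in> chars i \<Longrightarrow> x \<in> carrier A \<Longrightarrow> y \<in> carrier A \<Longrightarrow> p i x = p i y \<Longrightarrow> h x = h y"
  unfolding chars_def by blast

lemma chars_mono: "(i, j) \<in> r \<Longrightarrow> chars i \<subseteq> chars j"
  unfolding chars_def using p_mono by blast

text \<open>A character that factors through \<open>p i\<close> comes from a function on the finite
  set \<open>B i\<close>. Being onto \<open>{..h unity}\<close>, it has \<open>h unity\<close>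
  bounded by the number of elements of \<open>B i\<close>, so only finitely many such functions are
  possible.\<close>

lemma finite_chars:
  assumes i: "i \<in> I" shows "finite (chars i)"
proof -
  let ?G = "carrier (B i) \<rightarrow>\<^sub>E {..card (carrier (B i))}"
  have "h \<in> (\<lambda>g. \<lambda>x\<in>carrier A. g (p i x)) ` ?G" if h: "h \<in> chars i" for h
  proof -
    note hc = chars_char[OF h] and fac = chars_factor[OF h]
    define s where "s = inv_into (carrier A) (p i)"
    have s: "s b \<in> carrier A" "p i (s b) = b" if "b \<in> p i ` carrier A" for b
      using that unfolding s_def by (simp_all add: inv_into_into f_inv_into_f)
    \<comment> \<open>The value 0 outside the image of \<open>p i\<close> is a dummy that stays
      within the bound.\<close>
    define g where "g = (\<lambda>b\<in>carrier (B i). if b \<in> p i ` carrier A then h (s b) else 0)"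
    have pc: "p i x \<in> carrier (B i)" if "x \<in> carrier A" for x using mv_homD(1)[OF p_hom[OF i] that] .
    have gp: "g (p i x) = h x" if x: "x \<in> carrier A" for x
      using fac[OF s(1) x s(2)] pc[OF x] x by (simp add: g_def)
    have "{..h unity} \<subseteq> g ` carrier (B i)"
      unfolding chain_charD(3)[OF hc, symmetric] using gp pc by (auto simp: image_iff) metis
    then have "card {..h unity} \<le> card (carrier (B i))"
      by (rule surj_card_le[OF fin[OF i]])
    then have bound: "h unity \<le> card (carrier (B i))" by simp
    have "g \<in> ?G"
      using chain_charD(4)[OF hc s(1)] bound by (fastforce simp: g_def)
    moreover have "h = (\<lambda>x\<in>carrier A. g (p i x))"
      using gp mv_homD(5)[OF chain_charD(2)[OF hc]] by (intro extensionalityI[of _ "carrier A"]) auto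
    ultimately show ?thesis by blast
  qed
  then have "chars i \<subseteq> (\<lambda>g. \<lambda>x\<in>carrier A. g (p i x)) ` ?G" by blast
  then show ?thesis using fin[OF i] by (meson finite_PiE finite_atMost finite_imageI finite_subset)
qed

text \<open>The image \<open>C\<close> of \<open>p i\<close> is a finite MV-algebra, so a nonzero
  element of \<open>C\<close> is detected by a homomorphism onto a chain; composing with
  \<open>p i\<close> gives a character in \<open>chars i\<close>.\<close>

lemma chars_separate:
  assumes i: "i \<in> I" and x: "x \<in> carrier A" and y: "y \<in> carrier A" and ne: "p i x \<noteq> p i y"
  shows "\<exists>h\<in>chars i. h x \<noteq> h y"
proof -
  define C where "C = (B i)\<lparr>carrier := p i ` carrier A\<rparr>"
  have C_simps [simp]: "carrier C = p i ` carrier A" "mv_plus C = mv_plus (B i)" "mv_zero C = mv_zero (B i)"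
    "mv_neg C = mv_neg (B i)" by (simp_all add: C_def)
  have pC: "p i \<in> mv_hom A C"
    using p_hom[OF i] unfolding mv_hom_def by (auto simp: PiE_def)
  have Calg: "mv_algebra C" by (rule mv_algebra_hom_image[OF mv_algebra_axioms pC]) simp
  have finC: "finite (carrier C)"
    using mv_homD(1)[OF p_hom[OF i]] fin[OF i] by (metis C_simps(1) finite_subset image_subsetI)
  have main: "\<exists>h\<in>chars i. h u \<noteq> h v"
    if u: "u \<in> carrier A" and v: "v \<in> carrier A" and d: "p i (u \<ominus> v) \<noteq> mv_zero C" for u v
  proof -
    have "p i (u \<ominus> v) \<in> carrier C" using u v by simp
    then obtain n g where n: "n \<ge> 1" and g: "g \<in> mv_hom C (mv_chain n)" "g ` carrier C = {..n}"
      "g (p i (u \<ominus> v)) \<noteq> 0"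
      using mv_algebra.finite_separating_hom[OF Calg finC _ d] by blast
    let ?h = "compose (carrier A) g (p i)"
    have "?h ` carrier A = {..n}" using g(2) by (simp add: image_comp compose_eq cong: image_cong)
    then have hc: "chain_char A ?h" using chain_charI[OF n mv_hom_compose[OF mv_algebra_axioms pC g(1)]] by simp
    then have "?h \<in> chars i" by (simp add: chars_def compose_eq)
    moreover have "?h (u \<ominus> v) \<noteq> 0" using g(3) u v by (simp add: compose_eq)
    then have "?h u \<noteq> ?h v" using chain_char_minus[OF hc u v] by simp
    ultimately show ?thesis by blast
  qed
  have c: "p i x \<in> carrier C" "p i y \<in> carrier C" using x y by auto
  have "p i (a \<ominus> b) = mv_neg C (mv_neg C (p i a) \<boxplus>\<^bsub>C\<^esub> p i b)" if "a \<in> carrier A" "b \<in> carrier A" for a b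
    using mv_homD[OF p_hom[OF i]] that by simp
  \<comment> \<open>Antisymmetry in \<open>C\<close>: if both truncated differences were zero, the
    two projections would coincide.\<close>
  then have "p i (x \<ominus> y) \<noteq> mv_zero C \<or> p i (y \<ominus> x) \<noteq> mv_zero C"
    using mv_algebra.minus_eq_zero_iff[OF Calg] mv_algebra.le_antisym[OF Calg c] c x y ne by metis
  then show ?thesis using main[OF x y] main[OF y x] by metis
qed

lemma chars_complete:
  assumes v: "\<And>h. h \<in> (\<Union>i\<in>I. chars i) \<Longrightarrow> v h \<le> h unity"
  obtains a where "a \<in> carrier A" "\<And>h. h \<in> (\<Union>i\<in>I. chars i) \<Longrightarrow> h a = v h"
proof -
  have "\<forall>i\<in>I. \<exists>b. b \<in> carrier A \<and> (\<forall>h\<in>chars i. h b = v h)"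
  proof
    fix i assume i: "i \<in> I"
    have "\<exists>b\<in>carrier A. \<forall>h\<in>chars i. h b = v h"
    proof (rule chain_char_interpolate[OF finite_chars[OF i]])
      fix h assume h: "h \<in> chars i"
      then show "chain_char A h" by (rule chars_char)
      show "v h \<le> h unity" using v[of h] h i by blast
    qed
    then show "\<exists>b. b \<in> carrier A \<and> (\<forall>h\<in>chars i. h b = v h)" by blast
  qed
  from bchoice[OF this] obtain b where b: "\<And>i. i \<in> I \<Longrightarrow> b i \<in> carrier A" "\<And>i h. i \<in> I \<Longrightarrow> h \<in> chars i \<Longrightarrow> h (b i) = v h"
    by blast
  \<comment> \<open>A character in \<open>chars i\<close> also belongs to \<open>chars j\<close>, so
    it takes the prescribed value at both \<open>b i\<close> and \<open>b j\<close>; distinct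
    projections would be told apart by one of these characters.\<close>
  have "p i (b j) = p i (b i)" if ij: "(i, j) \<in> r" for i j
  proof (rule ccontr)
    assume ne: "p i (b j) \<noteq> p i (b i)"
    have I: "i \<in> I" "j \<in> I" using ij r_sub by auto
    obtain h where h: "h \<in> chars i" "h (b j) \<noteq> h (b i)" using chars_separate[OF I(1) b(1) b(1) ne] I by blast
    then show False using b(2)[OF I(1) h(1)] b(2)[OF I(2)] chars_mono[OF ij] by auto
  qed
  then obtain a where a: "a \<in> carrier A" "\<forall>i\<in>I. p i a = p i (b i)" using p_complete[of b] b(1) by blast
  have "h a = v h" if "h \<in> (\<Union>i\<in>I. chars i)" for h
  proof -
    obtain i where i: "i \<in> I" "h \<in> chars i" using \<open>h \<in> (\<Union>i\<in>I. chars i)\<close> by blast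
    then have "h a = h (b i)" using a b(1) by (intro chars_factor) auto
    then show ?thesis using b(2) i by simp
  qed
  then show ?thesis using that a(1) by blast
qed

text \<open>All characters of the cone serve as coordinates. Each index contributes finitely many,
  so an infinite \<open>'i\<close> has room for names of all of them. Separation gives injectivity
  and \<open>chars_complete\<close> surjectivity.\<close>

lemma iso_chain_product:
  assumes inf: "infinite (UNIV :: 'i set)"
  obtains X :: "'i set" and \<sigma> k where "\<sigma> \<in> X \<rightarrow>\<^sub>E {1..}" "k \<in> mv_iso A (chain_product X \<sigma>)"
proof -
  let ?Z = "\<Union>i\<in>I. chars i"
  have "|?Z| \<le>o |UNIV :: 'i set|"
  proof (rule card_of_UNION_ordLeq_infinite[OF inf])
    show "|I| \<le>o |UNIV :: 'i set|" by (simp add: card_of_mono1)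
    show "\<forall>i\<in>I. |chars i| \<le>o |UNIV :: 'i set|"
      using finite_lepoll_infinite[OF inf finite_chars] unfolding lepoll_def card_of_ordLeq by blast
  qed
  then obtain e :: "('a \<Rightarrow> nat) \<Rightarrow> 'i" where e: "inj_on e ?Z" unfolding card_of_ordLeq[symmetric] by blast
  define X where "X = e ` ?Z"
  define d where "d = inv_into ?Z e"
  define \<sigma> where "\<sigma> = (\<lambda>x\<in>X. d x unity)"
  have d: "d x \<in> ?Z" "e (d x) = x" if "x \<in> X" for x
    using that inv_into_into[of x e ?Z] f_inv_into_f[of x e ?Z] unfolding X_def d_def by blast+
  have de: "d (e h) = h" "e h \<in> X" if "h \<in> ?Z" for h
    using that e by (simp_all add: X_def d_def)
  have dc: "chain_char A (d x)" if "x \<in> X" for x using d(1)[OF that] chars_char by blast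
  define k where "k = restrict (\<lambda>a. \<lambda>x\<in>X. d x a) (carrier A)"
  have "k \<in> mv_hom A (chain_product X \<sigma>)"
    unfolding k_def
    by (rule mv_homI[OF mv_algebra_axioms])
      (auto simp: \<sigma>_def fun_eq_iff chain_charD(4-7)[OF dc])
  moreover have "inj_on k (carrier A)"
  proof (rule inj_onI)
    fix a b assume ab: "a \<in> carrier A" "b \<in> carrier A" "k a = k b"
    have "h a = h b" if "h \<in> ?Z" for h
      using de[OF that] fun_cong[OF ab(3), of "e h"] ab(1,2) by (simp add: k_def)
    then show "a = b" using p_inj[OF ab(1,2)] chars_separate ab(1,2) by blast
  qed
  moreover have "carrier (chain_product X \<sigma>) \<subseteq> k ` carrier A"
  proof
    fix f assume f: "f \<in> carrier (chain_product X \<sigma>)"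
    have "f (e h) \<le> h unity" if "h \<in> ?Z" for h
      using chain_product_le[of f X \<sigma> "e h"] f de[OF that] by (simp add: \<sigma>_def)
    then obtain a where a: "a \<in> carrier A" "\<And>h. h \<in> ?Z \<Longrightarrow> h a = f (e h)"
      using chars_complete[of "\<lambda>h. f (e h)"] by blast
    have "k a x = f x" if "x \<in> X" for x
      using a(2)[OF d(1)[OF that]] d(2)[OF that] a(1) that by (simp add: k_def)
    then have "k a = f"
      using a(1) f by (intro extensionalityI[of _ X]) (auto simp: k_def PiE_def)
    then show "f \<in> k ` carrier A" using a(1) by blast
  qed
  ultimately have "k \<in> mv_iso A (chain_product X \<sigma>)"
    unfolding mv_iso_def bij_betw_def using mv_homD(1)[of k A "chain_product X \<sigma>"] by blast
  moreover have "\<sigma> \<in> X \<rightarrow>\<^sub>E {1..}" using chain_charD(1)[OF dc] by (auto simp: \<sigma>_def)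
  ultimately show ?thesis using that by blast
qed

end

section \<open>The duality\<close>

lemma mv_profinite_iso:
  assumes A: "mv_algebra A" and h: "h \<in> mv_iso A B" and B: "mv_profinite TYPE('i) B"
  shows "mv_profinite TYPE('i) A"
proof -
  from B obtain I :: "'i set" and r and C :: "'i \<Rightarrow> nat mv_algebra" and \<phi> where
    sys: "mv_inverse_system I r C \<phi>" "\<forall>i\<in>I. finite (carrier (C i))"
    and iso: "mv_isomorphic B (mv_inverse_limit I r C \<phi>)"
    unfolding mv_profinite_def by blast
  from iso obtain k where "k \<in> mv_iso B (mv_inverse_limit I r C \<phi>)"
    unfolding mv_isomorphic_def mv_iso_def by blast
  then have "mv_isomorphic A (mv_inverse_limit I r C \<phi>)"
    using mv_iso_compose[OF A h] unfolding mv_isomorphic_def mv_iso_def by blast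
  then show ?thesis unfolding mv_profinite_def using A sys by blast
qed

text \<open>The product is the limit of the products over finite subsets of \<open>X\<close>,
  directed by inclusion with restrictions as transition maps. Since indices must be in
  \<open>'i\<close> and the algebras on \<open>nat\<close>, finite subsets are named through
  \<open>e\<close> and finite products numbered through \<open>enc\<close>.\<close>

lemma mv_profinite_chain_product:
  assumes inf: "infinite (UNIV :: 'i set)"
  shows "mv_profinite TYPE('i) (chain_product (X :: 'i set) \<sigma>)"
proof -
  let ?P = "chain_product X \<sigma>"
  have "Fpow (UNIV :: 'i set) \<lesssim> (UNIV :: 'i set)" using eqpoll_Fpow[OF inf] eqpoll_imp_lepoll by blast
  then obtain e :: "'i set \<Rightarrow> 'i" where e: "inj_on e (Fpow UNIV)" unfolding lepoll_def by blast
  define F where "F = Fpow X"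
  have einj: "S = T" if "e S = e T" "S \<in> F" "T \<in> F" for S T
    using e that unfolding inj_on_def F_def Fpow_def by blast
  define I where "I = e ` F"
  define r where "r = {(e S, e T) | S T. S \<in> F \<and> T \<in> F \<and> S \<subseteq> T}"
  define d where "d = inv_into F e"
  have de [simp]: "d (e S) = S" if "S \<in> F" for S
    unfolding d_def using that einj by (intro inv_into_f_f inj_onI) auto
  define C where "C S = carrier (chain_product S \<sigma>)" for S
  define enc where "enc S = restrict (to_nat_on (C S)) (C S)" for S
  define B where "B i = mv_transport (to_nat_on (C (d i))) (chain_product (d i) \<sigma>)" for i
  have finC: "finite (C S)" if "S \<in> F" for S
    using that by (auto simp: C_def F_def Fpow_def intro!: finite_PiE)
  have enc_iso: "enc S \<in> mv_iso (chain_product S \<sigma>) (B (e S))" if "S \<in> F" for S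
    using mv_transport_iso[OF mv_algebra_chain_product, of "to_nat_on (C S)" S \<sigma>]
      inj_on_to_nat_on[OF countable_finite[OF finC[OF that]]] that
    by (simp only: B_def enc_def de C_def)
  define dec where "dec S = mv_inverse (chain_product S \<sigma>) (B (e S)) (enc S)" for S
  have dec_iso: "dec S \<in> mv_iso (B (e S)) (chain_product S \<sigma>)" if "S \<in> F" for S
    unfolding dec_def by (rule mv_inverse_iso[OF mv_algebra_chain_product enc_iso[OF that]])
  have Balg: "mv_algebra (B (e S))" if "S \<in> F" for S
    by (rule mv_algebra_iso_image[OF mv_algebra_chain_product enc_iso[OF that]])
  note encdec = mv_inverse_apply[OF enc_iso, folded dec_def]
  note ehom = mv_homD[OF mv_isoD(1)[OF enc_iso]] and dhom = mv_homD[OF mv_isoD(1)[OF dec_iso]]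
  define res where "res T S = (\<lambda>f\<in>C T. restrict f S)" for S T
  have res_hom: "res T S \<in> mv_hom (chain_product T \<sigma>) (chain_product S \<sigma>)" if "S \<subseteq> T" for S T
    unfolding res_def C_def
    by (rule mv_homI[OF mv_algebra_chain_product]) (use that in \<open>auto simp: fun_eq_iff\<close>)
  \<comment> \<open>Restriction conjugated by the numberings. The laws of an inverse system are
    checked through \<open>\<phi>_enc\<close>, where the conjugation has disappeared.\<close>
  define \<phi> where "\<phi> i j = compose (carrier (B j)) (compose (C (d j)) (enc (d i)) (res (d j) (d i))) (dec (d j))" for i j
  have \<phi>_eq: "\<phi> (e S) (e T) = compose (carrier (B (e T))) (compose (C T) (enc S) (res T S)) (dec T)"
    if "S \<in> F" "T \<in> F" for S T using that by (simp add: \<phi>_def)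
  have \<phi>_hom: "\<phi> (e S) (e T) \<in> mv_hom (B (e T)) (B (e S))" if "S \<in> F" "T \<in> F" "S \<subseteq> T" for S T
    unfolding \<phi>_eq[OF that(1,2)] C_def
    by (intro mv_hom_compose[OF Balg[OF that(2)] mv_isoD(1)[OF dec_iso[OF that(2)]]]
        mv_hom_compose[OF mv_algebra_chain_product res_hom[OF that(3)] mv_isoD(1)[OF enc_iso[OF that(1)]]])
  have \<phi>_enc: "\<phi> (e S) (e T) (enc T f) = enc S (restrict f S)" if "S \<in> F" "T \<in> F" "f \<in> C T" for S T f
    using that ehom(1)[OF that(2)] encdec(1)[OF that(2)] by (simp add: \<phi>_eq compose_eq res_def C_def)
  have surj: "\<exists>f\<in>C S. x = enc S f" if "x \<in> carrier (B (e S))" "S \<in> F" for x S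
    using encdec(2)[OF that(2,1)] encdec(3)[OF that(2,1)] unfolding C_def by metis
  have resC: "restrict f S \<in> C S" if "f \<in> C T" "S \<subseteq> T" for f S T
    using that by (auto simp: C_def)
  have rE: "\<exists>S T. i = e S \<and> j = e T \<and> S \<in> F \<and> T \<in> F \<and> S \<subseteq> T" if "(i, j) \<in> r" for i j
    using that unfolding r_def by blast
  have r_iff: "(e S, e T) \<in> r \<longleftrightarrow> S \<subseteq> T" if "S \<in> F" "T \<in> F" for S T
    unfolding r_def using that by (auto dest: einj)
  have sys: "mv_inverse_system I r B \<phi>"
    unfolding mv_inverse_system_def
  proof (intro conjI ballI allI impI)
    have "r \<subseteq> I \<times> I" by (auto simp: r_def I_def)
    moreover have "refl_on I r" unfolding refl_on_def by (auto simp: I_def r_iff)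
    moreover have "trans r" by (auto simp: trans_def r_def dest!: einj)
    moreover have "antisym r" by (auto simp: antisym_def r_def dest!: einj)
    ultimately show "partial_order_on I r" by (simp add: partial_order_on_def preorder_on_def)
    show "I \<noteq> {}" by (auto simp: I_def F_def Fpow_def)
  next
    fix i j assume "i \<in> I" "j \<in> I"
    then obtain S T where ST: "S \<in> F" "T \<in> F" "i = e S" "j = e T" by (auto simp: I_def)
    have U: "S \<union> T \<in> F" using ST by (auto simp: F_def Fpow_def)
    then show "\<exists>k\<in>I. (i, k) \<in> r \<and> (j, k) \<in> r"
      using ST by (intro bexI[of _ "e (S \<union> T)"]) (auto simp: r_iff I_def)
  next
    fix i assume "i \<in> I"
    then obtain S where S: "S \<in> F" "i = e S" by (auto simp: I_def)
    then show "mv_algebra (B i)" using Balg by simp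
    show "\<phi> i i = (\<lambda>x\<in>carrier (B i). x)"
    proof (rule extensionalityI[of _ "carrier (B i)"])
      show "\<phi> i i \<in> extensional (carrier (B i))" by (simp add: \<phi>_def compose_def)
      fix x assume x: "x \<in> carrier (B i)"
      then obtain f where f: "f \<in> C S" "x = enc S f" using surj S by blast
      moreover have "restrict f S = f" using f(1) by (auto simp: C_def PiE_def extensional_restrict)
      ultimately show "\<phi> i i x = (\<lambda>x\<in>carrier (B i). x) x" using \<phi>_enc[OF S(1) S(1) f(1)] x S by simp
    qed simp
  next
    fix x assume "x \<in> r"
    then obtain S T where "x = (e S, e T)" "S \<in> F" "T \<in> F" "S \<subseteq> T" unfolding r_def by blast
    then show "case x of (i, j) \<Rightarrow> \<phi> i j \<in> mv_hom (B j) (B i)" using \<phi>_hom by simp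
  next
    fix i j k assume ij: "(i, j) \<in> r" and jk: "(j, k) \<in> r"
    obtain S T where ST: "i = e S" "j = e T" "S \<in> F" "T \<in> F" "S \<subseteq> T" using rE[OF ij] by blast
    obtain T' U where TU: "j = e T'" "k = e U" "T' \<in> F" "U \<in> F" "T' \<subseteq> U" using rE[OF jk] by blast
    have T: "T' = T" using einj ST TU by blast
    have TU': "T \<subseteq> U" "U \<in> F" using T TU by auto
    show "\<phi> i k = compose (carrier (B k)) (\<phi> i j) (\<phi> j k)"
    proof (rule extensionalityI[of _ "carrier (B k)"])
      show "\<phi> i k \<in> extensional (carrier (B k))" by (simp add: \<phi>_def compose_def)
      show "compose (carrier (B k)) (\<phi> i j) (\<phi> j k) \<in> extensional (carrier (B k))" by (simp add: compose_def)
      fix x assume x: "x \<in> carrier (B k)"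
      then obtain f where f: "f \<in> C U" "x = enc U f" using surj[of x U] TU by blast
      have "restrict (restrict f T) S = restrict f S"
        using ST(5) by (simp add: Int_absorb1)
      then show "\<phi> i k x = compose (carrier (B k)) (\<phi> i j) (\<phi> j k) x"
        using \<phi>_enc[OF ST(3) TU'(2) f(1)] \<phi>_enc[OF ST(4) TU'(2) f(1)]
          \<phi>_enc[OF ST(3,4) resC[OF f(1) TU'(1)]] x f(2) ST(1,2) TU(2)
        by (simp add: compose_eq)
    qed
  qed
  let ?L = "mv_inverse_limit I r B \<phi>"
  define k where "k f = (\<lambda>i\<in>I. enc (d i) (restrict f (d i)))" for f
  have SX: "S \<subseteq> X" if "S \<in> F" for S using that by (auto simp: F_def Fpow_def)
  have k_app: "k f (e S) = enc S (restrict f S)" if "S \<in> F" for f S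
    using that by (simp add: k_def I_def)
  have P: "carrier ?P = C X" by (simp add: C_def)
  have resP: "restrict f S \<in> carrier (chain_product S \<sigma>)" if "f \<in> carrier ?P" "S \<in> F" for f S
    using resC[of f X S] that SX P by (simp add: C_def)
  have Ieq: "f = g" if "f \<in> extensional I" "g \<in> extensional I" "\<And>S. S \<in> F \<Longrightarrow> f (e S) = g (e S)" for f g :: "'i \<Rightarrow> nat"
    using that by (intro extensionalityI[of _ I]) (auto simp: I_def)
  have k_hom: "restrict k (carrier ?P) \<in> mv_hom ?P ?L"
  proof (rule mv_homI[OF mv_algebra_chain_product])
    fix f assume f: "f \<in> carrier ?P"
    have "\<phi> i j (k f j) = k f i" if ij: "(i, j) \<in> r" for i j
    proof -
      obtain S T where ST: "i = e S" "j = e T" "S \<in> F" "T \<in> F" "S \<subseteq> T" using rE[OF ij] by blast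
      have "restrict (restrict f T) S = restrict f S" using ST(5) by (simp add: Int_absorb1)
      then show ?thesis
        using \<phi>_enc[OF ST(3,4), of "restrict f T"] resP[OF f ST(4)] k_app ST by (simp add: C_def)
    qed
    moreover have "k f \<in> (\<Pi>\<^sub>E i\<in>I. carrier (B i))"
      unfolding k_def I_def using ehom(1) resP[OF f] by auto
    ultimately show "k f \<in> carrier ?L" by (auto simp: mv_inverse_limit_def)
    have "restrict (mv_neg ?P f) S = mv_neg (chain_product S \<sigma>) (restrict f S)" if "S \<in> F" for S
      using SX[OF that] by (auto simp: fun_eq_iff)
    then show "k (mv_neg ?P f) = mv_neg ?L (k f)"
      using ehom(4) resP[OF f] k_app
      by (intro Ieq) (simp_all add: mv_inverse_limit_def k_def I_def del: chain_product_simps)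
    fix g assume g: "g \<in> carrier ?P"
    have "restrict (f \<boxplus>\<^bsub>?P\<^esub> g) S = restrict f S \<boxplus>\<^bsub>chain_product S \<sigma>\<^esub> restrict g S" if "S \<in> F" for S
      using SX[OF that] by (auto simp: fun_eq_iff)
    then show "k (f \<boxplus>\<^bsub>?P\<^esub> g) = k f \<boxplus>\<^bsub>?L\<^esub> k g"
      using ehom(3) resP[OF f] resP[OF g] k_app
      by (intro Ieq) (simp_all add: mv_inverse_limit_def k_def I_def del: chain_product_simps)
  next
    have "restrict (mv_zero ?P) S = mv_zero (chain_product S \<sigma>)" if "S \<in> F" for S
      using SX[OF that] by (auto simp: fun_eq_iff)
    then show "k (mv_zero ?P) = mv_zero ?L"
      using ehom(2) k_app
      by (intro Ieq) (simp_all add: mv_inverse_limit_def k_def I_def del: chain_product_simps)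
  qed
  have single: "{x} \<in> F" if "x \<in> X" for x using that by (auto simp: F_def Fpow_def)
  have enc_inj: "f = g" if "S \<in> F" "f \<in> C S" "g \<in> C S" "enc S f = enc S g" for S f g
    using encdec(1)[OF that(1)] that(2-) unfolding C_def by metis
  have "inj_on k (carrier ?P)"
  proof (rule inj_onI)
    fix f g assume fg: "f \<in> carrier ?P" "g \<in> carrier ?P" "k f = k g"
    have "f x = g x" if x: "x \<in> X" for x
    proof -
      have "restrict f {x} = restrict g {x}"
        using enc_inj[OF single[OF x]] resP[OF fg(1) single[OF x]] resP[OF fg(2) single[OF x]]
          k_app[OF single[OF x], of f] k_app[OF single[OF x], of g] fg(3) unfolding C_def by metis
      then show ?thesis by (metis restrict_apply' singletonI)
    qed
    then show "f = g" using fg by (intro extensionalityI[of _ X]) (auto simp: PiE_def)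
  qed
  moreover have "carrier ?L \<subseteq> k ` carrier ?P"
  proof
    fix b assume "b \<in> carrier ?L"
    then have b: "b \<in> extensional I" "\<And>S. S \<in> F \<Longrightarrow> b (e S) \<in> carrier (B (e S))"
      "\<And>i j. (i, j) \<in> r \<Longrightarrow> \<phi> i j (b j) = b i"
      by (auto simp: mv_inverse_limit_def I_def PiE_def)
    define c where "c S = dec S (b (e S))" for S
    have c: "c S \<in> C S" "enc S (c S) = b (e S)" if "S \<in> F" for S
      using encdec(2,3)[OF that b(2)[OF that]] by (simp_all add: c_def C_def)
    have c_res: "restrict (c T) S = c S" if "S \<in> F" "T \<in> F" "S \<subseteq> T" for S T
      using \<phi>_enc[OF that(1,2) c(1)[OF that(2)]] c(2)[OF that(1)] c(2)[OF that(2)] b(3)[of "e S" "e T"] that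
        resC[OF c(1)[OF that(2)] that(3)] c(1)[OF that(1)]
      by (intro enc_inj[OF that(1)]) (simp_all add: r_iff)
    \<comment> \<open>Gluing: the value at \<open>x\<close> is read from the component at the
      singleton \<open>{x}\<close>. Compatibility with restrictions shows that every other component
      has the same value there.\<close>
    define f where "f = (\<lambda>x\<in>X. c {x} x)"
    have fx: "c S x = f x" if "S \<in> F" "x \<in> S" for S x
    proof -
      have x: "x \<in> X" using SX that by blast
      have "restrict (c S) {x} = c {x}" using c_res[OF single[OF x] that(1)] that(2) by simp
      then have "restrict (c S) {x} x = c {x} x" by simp
      then show ?thesis using x by (simp add: f_def)
    qed
    have "f \<in> carrier ?P" using c(1)[OF single] by (auto simp: f_def C_def PiE_def)
    moreover have "k f = b"
    proof (rule Ieq)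
      fix S assume S: "S \<in> F"
      have "restrict f S = c S"
        using c(1)[OF S] fx[OF S] by (intro extensionalityI[of _ S]) (auto simp: C_def PiE_def)
      then show "k f (e S) = b (e S)" using k_app[OF S] c(2)[OF S] by simp
    qed (use b(1) in \<open>simp_all add: k_def\<close>)
    ultimately show "b \<in> k ` carrier ?P" by blast
  qed
  ultimately have "bij_betw (restrict k (carrier ?P)) (carrier ?P) (carrier ?L)"
    using mv_homD(1)[OF k_hom] unfolding bij_betw_def by (auto simp: inj_on_def)
  then have "mv_isomorphic ?P ?L" using k_hom unfolding mv_isomorphic_def by blast
  moreover have "finite (carrier (B i))" if "i \<in> I" for i
    using that finC bij_betw_finite[OF mv_isoD(2)[OF enc_iso]] by (auto simp: I_def C_def)
  ultimately show ?thesis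
    unfolding mv_profinite_def using sys mv_algebra_chain_product by blast
qed

section \<open>Category laws on both sides\<close>

lemma is_category_multiset: "is_category multiset_category"
  unfolding is_category_def
proof (intro conjI ballI)
  fix x :: "'a mset_obj" assume "x \<in> Obj multiset_category"
  then show "Id multiset_category x \<in> Hom multiset_category x x"
    by (auto simp: multiset_category_def)
next
  fix x y z :: "'a mset_obj" and f g
  assume "x \<in> Obj multiset_category" "y \<in> Obj multiset_category" "z \<in> Obj multiset_category"
    and f: "f \<in> Hom multiset_category x y" and g: "g \<in> Hom multiset_category y z"
  obtain X \<sigma> Y \<mu> Z \<nu> where [simp]: "x = (X, \<sigma>)" "y = (Y, \<mu>)" "z = (Z, \<nu>)" by (metis surj_pair)
  have "\<nu> (g (f u)) dvd \<sigma> u" if "u \<in> X" for u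
  proof -
    have "f u \<in> Y" "\<mu> (f u) dvd \<sigma> u" "\<forall>v\<in>Y. \<nu> (g v) dvd \<mu> v"
      using f g that by (auto simp: multiset_category_def)
    then show ?thesis using dvd_trans by blast
  qed
  then show "Comp multiset_category x y z g f \<in> Hom multiset_category x z"
    using f g by (auto simp: multiset_category_def compose_def)
next
  fix x y :: "'a mset_obj" and f
  assume "f \<in> Hom multiset_category x y"
  then show "Comp multiset_category x x y f (Id multiset_category x) = f"
    and "Comp multiset_category x y y (Id multiset_category y) f = f"
    by (auto simp: multiset_category_def compose_def fun_eq_iff PiE_def extensional_def Pi_def split: prod.splits)
next
  fix w x y z :: "'a mset_obj" and f g h
  assume "f \<in> Hom multiset_category w x" "g \<in> Hom multiset_category x y" "h \<in> Hom multiset_category y z"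
  then show "Comp multiset_category w x z (Comp multiset_category x y z h g) f =
      Comp multiset_category w y z h (Comp multiset_category w x y g f)"
    by (auto simp: multiset_category_def compose_def fun_eq_iff PiE_def Pi_def split: prod.splits)
qed

lemma profinite_mv_category_simps [simp]:
  "Obj (profinite_mv_category TYPE('i)) = {A. mv_profinite TYPE('i) A}"
  "Hom (profinite_mv_category TYPE('i)) A B = {h \<in> mv_hom A B. reflects_principal_maximal_ideals A B h}"
  "Comp (profinite_mv_category TYPE('i)) A B C g f = compose (carrier A) g f"
  "Id (profinite_mv_category TYPE('i)) A = (\<lambda>x\<in>carrier A. x)"
  by (simp_all add: profinite_mv_category_def)

lemma mv_profinite_mv_algebra: "mv_profinite TYPE('i) A \<Longrightarrow> mv_algebra A"
  unfolding mv_profinite_def by blast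

lemma is_category_profinite_mv: "is_category (profinite_mv_category TYPE('i))"
  unfolding is_category_def
proof (intro conjI ballI)
  fix A :: "'c mv_algebra" assume "A \<in> Obj (profinite_mv_category TYPE('i))"
  then show "Id (profinite_mv_category TYPE('i)) A \<in> Hom (profinite_mv_category TYPE('i)) A A"
    using mv_hom_id mv_profinite_mv_algebra reflects_principal_maximal_ideals_id by auto
next
  fix A B C :: "'c mv_algebra" and f g
  assume "A \<in> Obj (profinite_mv_category TYPE('i))"
    "f \<in> Hom (profinite_mv_category TYPE('i)) A B" "g \<in> Hom (profinite_mv_category TYPE('i)) B C"
  then show "Comp (profinite_mv_category TYPE('i)) A B C g f \<in> Hom (profinite_mv_category TYPE('i)) A C"
    using mv_hom_compose[of A f B g C] mv_profinite_mv_algebra reflects_principal_maximal_ideals_compose[of f A B C g]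
    by auto
next
  fix A B :: "'c mv_algebra" and f assume "f \<in> Hom (profinite_mv_category TYPE('i)) A B"
  then have f: "f \<in> mv_hom A B" by simp
  show "Comp (profinite_mv_category TYPE('i)) A A B f (Id (profinite_mv_category TYPE('i)) A) = f"
    using mv_homD(5)[OF f] by (auto simp: compose_def fun_eq_iff extensional_def)
  show "Comp (profinite_mv_category TYPE('i)) A B B (Id (profinite_mv_category TYPE('i)) B) f = f"
    using mv_homD(1,5)[OF f] by (auto simp: compose_def fun_eq_iff extensional_def)
next
  fix A B C D :: "'c mv_algebra" and f g h assume "f \<in> Hom (profinite_mv_category TYPE('i)) A B"
  then have f: "f \<in> mv_hom A B" by simp
  show "Comp (profinite_mv_category TYPE('i)) A B D (Comp (profinite_mv_category TYPE('i)) B C D h g) f =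
    Comp (profinite_mv_category TYPE('i)) A C D h (Comp (profinite_mv_category TYPE('i)) A B C g f)"
    using mv_homD(1)[OF f] by (auto simp: compose_def fun_eq_iff)
qed

section \<open>The product functor and the equivalence\<close>

text \<open>One injection of the whole function type serves all multisets at once; each product uses
  its restriction to the carrier.\<close>

locale chain_product_encoding =
  fixes e :: "('a \<Rightarrow> nat) \<Rightarrow> 'c"
  assumes inj_e: "inj e" and infinite_a: "infinite (UNIV :: 'a set)"
begin

definition encoded_product :: "'a mset_obj \<Rightarrow> 'c mv_algebra" where
  "encoded_product x = mv_transport e (chain_product (fst x) (snd x))"

definition encode :: "'a mset_obj \<Rightarrow> ('a \<Rightarrow> nat) \<Rightarrow> 'c" where
  "encode x = restrict e (carrier (chain_product (fst x) (snd x)))"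

definition decode :: "'a mset_obj \<Rightarrow> 'c \<Rightarrow> 'a \<Rightarrow> nat" where
  "decode x = mv_inverse (chain_product (fst x) (snd x)) (encoded_product x) (encode x)"

text \<open>The pullback conjugated by the encodings. It runs from the product of \<open>y\<close>
  to that of \<open>x\<close>, against the direction of \<open>\<phi>\<close>.\<close>

definition encoded_pullback :: "'a mset_obj \<Rightarrow> 'a mset_obj \<Rightarrow> ('a \<Rightarrow> 'a) \<Rightarrow> 'c \<Rightarrow> 'c" where
  "encoded_pullback x y \<phi> = compose (carrier (encoded_product y))
    (compose (carrier (chain_product (fst y) (snd y))) (encode x)
      (chain_pullback (fst x) (snd x) (fst y) (snd y) \<phi>))
    (decode y)"

lemma encode_iso: "encode x \<in> mv_iso (chain_product (fst x) (snd x)) (encoded_product x)"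
  unfolding encode_def encoded_product_def
  by (rule mv_transport_iso[OF mv_algebra_chain_product]) (metis inj_e inj_on_subset subset_UNIV)

lemma decode_iso: "decode x \<in> mv_iso (encoded_product x) (chain_product (fst x) (snd x))"
  unfolding decode_def by (rule mv_inverse_iso[OF mv_algebra_chain_product encode_iso])

lemmas decode_encode = mv_inverse_apply[OF encode_iso, folded decode_def]

lemma mv_algebra_encoded_product: "mv_algebra (encoded_product x)"
  by (rule mv_algebra_iso_image[OF mv_algebra_chain_product encode_iso])

lemma encoded_product_profinite: "mv_profinite TYPE('a) (encoded_product x)"
  by (rule mv_profinite_iso[OF mv_algebra_encoded_product decode_iso mv_profinite_chain_product[OF infinite_a]])

lemma encoded_pullback_encode:
  assumes "f \<in> carrier (chain_product (fst y) (snd y))"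
  shows "encoded_pullback x y \<phi> (encode y f) = encode x (chain_pullback (fst x) (snd x) (fst y) (snd y) \<phi> f)"
  using assms decode_encode(1)[OF assms] mv_homD(1)[OF mv_isoD(1)[OF encode_iso] assms]
  by (simp add: encoded_pullback_def compose_eq)

text \<open>Tests equality of maps on encoded elements only, where
  \<open>encoded_pullback_encode\<close> removes the decoding.\<close>

lemma encoded_extI:
  assumes "h \<in> extensional (carrier (encoded_product y))" "h' \<in> extensional (carrier (encoded_product y))"
    "\<And>f. f \<in> carrier (chain_product (fst y) (snd y)) \<Longrightarrow> h (encode y f) = h' (encode y f)"
  shows "h = h'"
  using assms(1,2)
proof (rule extensionalityI)
  fix z assume "z \<in> carrier (encoded_product y)"
  then show "h z = h' z" using assms(3)[OF decode_encode(3)] decode_encode(2) by metis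
qed

lemma multiset_hom_morphism:
  assumes "x \<in> Obj multiset_category" "y \<in> Obj multiset_category" "\<phi> \<in> Hom multiset_category x y"
  shows "multiset_morphism (fst x) (snd x) (fst y) (snd y) \<phi>"
  using assms by (auto simp: multiset_category_def multiset_morphism_def split: prod.splits)

definition product_functor where
  "product_functor = \<lparr> omap = encoded_product, amap = encoded_pullback \<rparr>"

lemma encoded_pullback_hom:
  assumes "multiset_morphism (fst x) (snd x) (fst y) (snd y) \<phi>"
  shows "encoded_pullback x y \<phi> \<in> Hom (profinite_mv_category TYPE('a)) (encoded_product y) (encoded_product x)"
proof -
  note pull = multiset_morphism.pullback_hom[OF assms] multiset_morphism.pullback_reflects[OF assms]
  note enc = mv_isoD(1)[OF encode_iso] reflects_principal_maximal_ideals_iso[OF mv_algebra_chain_product encode_iso]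
  note dec = mv_isoD(1)[OF decode_iso] reflects_principal_maximal_ideals_iso[OF mv_algebra_encoded_product decode_iso]
  show ?thesis
    unfolding encoded_pullback_def
    using mv_hom_compose[OF mv_algebra_encoded_product dec(1) mv_hom_compose[OF mv_algebra_chain_product pull(1) enc(1)]]
      reflects_principal_maximal_ideals_compose[OF dec reflects_principal_maximal_ideals_compose[OF pull enc(2)]]
    by simp
qed

lemma encoded_pullback_id:
  assumes "x \<in> Obj multiset_category"
  shows "encoded_pullback x x (Id multiset_category x) = (\<lambda>z\<in>carrier (encoded_product x). z)"
proof (rule encoded_extI)
  fix f assume f: "f \<in> carrier (chain_product (fst x) (snd x))"
  have "chain_pullback (fst x) (snd x) (fst x) (snd x) (\<lambda>u\<in>fst x. u) f = f"
  proof -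
    have "snd x u \<ge> 1" if "u \<in> fst x" for u using assms that by (auto simp: multiset_category_def)
    then show ?thesis using chain_pullback_id[of "fst x" "snd x"] f by simp
  qed
  then show "encoded_pullback x x (Id multiset_category x) (encode x f) = (\<lambda>z\<in>carrier (encoded_product x). z) (encode x f)"
    using encoded_pullback_encode[OF f] mv_homD(1)[OF mv_isoD(1)[OF encode_iso] f]
    by (simp add: multiset_category_def case_prod_unfold)
qed (simp_all add: encoded_pullback_def compose_def)

lemma encoded_pullback_compose:
  assumes "multiset_morphism (fst x) (snd x) (fst y) (snd y) \<phi>" "multiset_morphism (fst y) (snd y) (fst z) (snd z) \<psi>"
  shows "encoded_pullback x z (compose (fst x) \<psi> \<phi>) =
    compose (carrier (encoded_product z)) (encoded_pullback x y \<phi>) (encoded_pullback y z \<psi>)"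
proof (rule encoded_extI)
  fix f assume f: "f \<in> carrier (chain_product (fst z) (snd z))"
  have "chain_pullback (fst y) (snd y) (fst z) (snd z) \<psi> f \<in> carrier (chain_product (fst y) (snd y))"
    using mv_homD(1)[OF multiset_morphism.pullback_hom[OF assms(2)] f] .
  then show "encoded_pullback x z (compose (fst x) \<psi> \<phi>) (encode z f) =
    compose (carrier (encoded_product z)) (encoded_pullback x y \<phi>) (encoded_pullback y z \<psi>) (encode z f)"
    using f mv_homD(1)[OF mv_isoD(1)[OF encode_iso] f] chain_pullback_compose[OF assms]
    by (simp only: encoded_pullback_encode compose_eq)
qed (simp_all add: encoded_pullback_def compose_def)

lemma product_functor:
  "is_functor multiset_category (op_category (profinite_mv_category TYPE('a))) product_functor"
  unfolding is_functor_def
proof (intro conjI ballI)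
  fix x assume x: "x \<in> Obj (multiset_category :: ('a mset_obj, 'a \<Rightarrow> 'a) category)"
  show "omap product_functor x \<in> Obj (op_category (profinite_mv_category TYPE('a)))"
    by (simp add: product_functor_def op_category_def encoded_product_profinite)
  show "amap product_functor x x (Id multiset_category x) =
      Id (op_category (profinite_mv_category TYPE('a))) (omap product_functor x)"
    using encoded_pullback_id[OF x] by (simp add: product_functor_def op_category_def)
next
  fix x y \<phi> assume "x \<in> Obj (multiset_category :: ('a mset_obj, 'a \<Rightarrow> 'a) category)"
    "y \<in> Obj (multiset_category :: ('a mset_obj, 'a \<Rightarrow> 'a) category)" "\<phi> \<in> Hom multiset_category x y"
  then show "amap product_functor x y \<phi> \<in>
      Hom (op_category (profinite_mv_category TYPE('a))) (omap product_functor x) (omap product_functor y)"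
    using encoded_pullback_hom[OF multiset_hom_morphism]
    by (simp add: product_functor_def op_category_def del: profinite_mv_category_simps)
next
  fix x y z \<phi> \<psi> assume o: "x \<in> Obj (multiset_category :: ('a mset_obj, 'a \<Rightarrow> 'a) category)"
    "y \<in> Obj (multiset_category :: ('a mset_obj, 'a \<Rightarrow> 'a) category)"
    "z \<in> Obj (multiset_category :: ('a mset_obj, 'a \<Rightarrow> 'a) category)"
    and \<phi>: "\<phi> \<in> Hom multiset_category x y" and \<psi>: "\<psi> \<in> Hom multiset_category y z"
  have "Comp multiset_category x y z \<psi> \<phi> = compose (fst x) \<psi> \<phi>"
    by (simp add: multiset_category_def case_prod_unfold)
  then show "amap product_functor x z (Comp multiset_category x y z \<psi> \<phi>) =
      Comp (op_category (profinite_mv_category TYPE('a))) (omap product_functor x) (omap product_functor y)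
        (omap product_functor z) (amap product_functor y z \<psi>) (amap product_functor x y \<phi>)"
    using encoded_pullback_compose[OF multiset_hom_morphism[OF o(1,2) \<phi>] multiset_hom_morphism[OF o(2,3) \<psi>]]
    by (simp add: product_functor_def op_category_def)
qed

lemma encoded_pullback_bij:
  assumes x: "x \<in> Obj multiset_category" and y: "y \<in> Obj multiset_category"
  shows "bij_betw (encoded_pullback x y) (Hom multiset_category x y)
    (Hom (profinite_mv_category TYPE('a)) (encoded_product y) (encoded_product x))"
  unfolding bij_betw_def
proof (intro conjI inj_onI subset_antisym subsetI)
  let ?P = "chain_product (fst x) (snd x)" and ?Q = "chain_product (fst y) (snd y)"
  fix \<phi> \<psi> assume \<phi>: "\<phi> \<in> Hom multiset_category x y" and \<psi>: "\<psi> \<in> Hom multiset_category x y"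
    and eq: "encoded_pullback x y \<phi> = encoded_pullback x y \<psi>"
  note m = multiset_hom_morphism[OF x y]
  note hom = multiset_morphism.pullback_hom[OF m]
  have "chain_pullback (fst x) (snd x) (fst y) (snd y) \<phi> f = chain_pullback (fst x) (snd x) (fst y) (snd y) \<psi> f"
    if f: "f \<in> carrier ?Q" for f
    using encoded_pullback_encode[OF f, of x \<phi>] encoded_pullback_encode[OF f, of x \<psi>] eq
      decode_encode(1)[OF mv_homD(1)[OF hom[OF \<phi>] f]] decode_encode(1)[OF mv_homD(1)[OF hom[OF \<psi>] f]] by metis
  then have "chain_pullback (fst x) (snd x) (fst y) (snd y) \<phi> = chain_pullback (fst x) (snd x) (fst y) (snd y) \<psi>"
    by (rule mv_hom_ext[OF hom[OF \<phi>] hom[OF \<psi>]])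
  then have "\<phi> u = \<psi> u" if "u \<in> fst x" for u
    using chain_pullback_inject[OF m[OF \<phi>] m[OF \<psi>] _ that] by simp
  moreover have "\<phi> \<in> extensional (fst x)" "\<psi> \<in> extensional (fst x)"
    using \<phi> \<psi> by (auto simp: multiset_category_def PiE_def case_prod_unfold)
  ultimately show "\<phi> = \<psi>" using extensionalityI by metis
next
  fix h assume "h \<in> encoded_pullback x y ` Hom multiset_category x y"
  then show "h \<in> Hom (profinite_mv_category TYPE('a)) (encoded_product y) (encoded_product x)"
    using encoded_pullback_hom[OF multiset_hom_morphism[OF x y]] by blast
next
  let ?P = "chain_product (fst x) (snd x)" and ?Q = "chain_product (fst y) (snd y)"
  fix h assume "h \<in> Hom (profinite_mv_category TYPE('a)) (encoded_product y) (encoded_product x)"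
  then have h: "h \<in> mv_hom (encoded_product y) (encoded_product x)"
    "reflects_principal_maximal_ideals (encoded_product y) (encoded_product x) h" by simp_all
  note enc = mv_isoD(1)[OF encode_iso] reflects_principal_maximal_ideals_iso[OF mv_algebra_chain_product encode_iso]
  note dec = mv_isoD(1)[OF decode_iso] reflects_principal_maximal_ideals_iso[OF mv_algebra_encoded_product decode_iso]
  \<comment> \<open>Undoing the encodings gives a homomorphism of products that still reflects, so
    it is a pullback; its \<open>\<phi>\<close> is the required preimage of
    \<open>h\<close>.\<close>
  define g where "g = compose (carrier ?Q) (compose (carrier (encoded_product y)) (decode x) h) (encode y)"
  have g: "g \<in> mv_hom ?Q ?P" "reflects_principal_maximal_ideals ?Q ?P g"
    unfolding g_def
    using mv_hom_compose[OF mv_algebra_chain_product enc(1) mv_hom_compose[OF mv_algebra_encoded_product h(1) dec(1)]]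
      reflects_principal_maximal_ideals_compose[OF enc reflects_principal_maximal_ideals_compose[OF h dec(2)]]
    by auto
  obtain \<phi> where \<phi>: "\<phi> \<in> fst x \<rightarrow>\<^sub>E fst y" "multiset_morphism (fst x) (snd x) (fst y) (snd y) \<phi>"
    "g = chain_pullback (fst x) (snd x) (fst y) (snd y) \<phi>"
  proof (rule chain_pullback_surj[OF _ _ g])
    show "1 \<le> snd x u" if "u \<in> fst x" for u using x that by (auto simp: multiset_category_def)
    show "1 \<le> snd y u" if "u \<in> fst y" for u using y that by (auto simp: multiset_category_def)
  qed
  have "\<phi> \<in> Hom multiset_category x y"
    using \<phi>(1) multiset_morphism.\<phi>_dvd[OF \<phi>(2)] by (auto simp: multiset_category_def case_prod_unfold)
  moreover have "h = encoded_pullback x y \<phi>"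
  proof (rule encoded_extI)
    fix f assume f: "f \<in> carrier ?Q"
    have ef: "encode y f \<in> carrier (encoded_product y)" using mv_homD(1)[OF enc(1) f] .
    have "g f = decode x (h (encode y f))" using f ef by (simp only: g_def compose_eq)
    then have "encode x (g f) = h (encode y f)" using decode_encode(2) mv_homD(1)[OF h(1) ef] by metis
    then show "h (encode y f) = encoded_pullback x y \<phi> (encode y f)"
      using encoded_pullback_encode[OF f, of x \<phi>] \<phi>(3) by simp
  qed (use mv_homD(5)[OF h(1)] in \<open>simp_all add: encoded_pullback_def compose_def\<close>)
  ultimately show "h \<in> encoded_pullback x y ` Hom multiset_category x y" by blast
qed

text \<open>A bijective homomorphism and its inverse both reflect principal maximal ideals, so the
  inverse is a morphism of the category as well.\<close>

lemma mv_iso_arrow: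
  assumes "mv_algebra A" "h \<in> mv_iso A B"
  shows "iso_arrow (profinite_mv_category TYPE('i)) A B h"
proof -
  let ?g = "mv_inverse A B h"
  have g: "?g \<in> mv_iso B A" using mv_inverse_iso[OF assms] .
  have "compose (carrier A) ?g h = (\<lambda>x\<in>carrier A. x)" "compose (carrier B) h ?g = (\<lambda>x\<in>carrier B. x)"
    using mv_inverse_apply[OF assms(2)] by (auto simp: compose_def fun_eq_iff)
  then show ?thesis
    unfolding iso_arrow_def
    using mv_isoD(1)[OF assms(2)] mv_isoD(1)[OF g] reflects_principal_maximal_ideals_iso[OF assms]
      reflects_principal_maximal_ideals_iso[OF mv_algebra_iso_image[OF assms] g]
    by auto
qed

theorem duality:
  "dually_equivalent (multiset_category :: ('a mset_obj, 'a \<Rightarrow> 'a) category)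
    (profinite_mv_category TYPE('a) :: ('c mv_algebra, 'c \<Rightarrow> 'c) category)"
  unfolding dually_equivalent_def
proof (rule fully_faithful_essentially_surjective_imp_equivalent[OF is_category_multiset
      is_category_op[OF is_category_profinite_mv] product_functor])
  fix x y assume "x \<in> Obj (multiset_category :: ('a mset_obj, 'a \<Rightarrow> 'a) category)"
    "y \<in> Obj (multiset_category :: ('a mset_obj, 'a \<Rightarrow> 'a) category)"
  then show "bij_betw (amap product_functor x y) (Hom multiset_category x y)
      (Hom (op_category (profinite_mv_category TYPE('a))) (omap product_functor x) (omap product_functor y))"
    using encoded_pullback_bij[of x y]
    by (simp add: product_functor_def op_category_def del: profinite_mv_category_simps)
next
  fix A :: "'c mv_algebra" assume "A \<in> Obj (op_category (profinite_mv_category TYPE('a)))"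
  then have pro: "mv_profinite TYPE('a) A" by (simp add: op_category_def)
  then have A: "mv_algebra A" by (rule mv_profinite_mv_algebra)
  obtain I :: "'a set" and r B p where "mv_cone A I r B p" using mv_profinite_cone[OF pro] .
  then obtain X :: "'a set" and \<sigma> k where \<sigma>: "\<sigma> \<in> X \<rightarrow>\<^sub>E {1..}" and k: "k \<in> mv_iso A (chain_product X \<sigma>)"
    using mv_cone.iso_chain_product[OF _ infinite_a] by metis
  have "compose (carrier A) (encode (X, \<sigma>)) k \<in> mv_iso A (encoded_product (X, \<sigma>))"
    using mv_iso_compose[OF A k] encode_iso[of "(X, \<sigma>)"] by simp
  \<comment> \<open>Passing to the opposite category reverses the isomorphism from \<open>A\<close>
    to the product, which is the direction that essential surjectivity asks for.\<close>
  then have "iso_arrow (op_category (profinite_mv_category TYPE('a))) (omap product_functor (X, \<sigma>)) A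
      (compose (carrier A) (encode (X, \<sigma>)) k)"
    using mv_iso_arrow[OF A] by (simp add: iso_arrow_op product_functor_def)
  moreover have "(X, \<sigma>) \<in> Obj multiset_category" using \<sigma> by (simp add: multiset_category_def)
  ultimately show "\<exists>x\<in>Obj (multiset_category :: ('a mset_obj, 'a \<Rightarrow> 'a) category).
      \<exists>f. iso_arrow (op_category (profinite_mv_category TYPE('a))) (omap product_functor x) A f"
    by blast
qed

end

section \<open>Cardinality of the carrier type\<close>

text \<open>A function is determined by its graph, a subset of \<open>'a \<times> nat\<close>. As
  \<open>'a\<close> is infinite, this product embeds into \<open>'a\<close> through \<open>m\<close>
  and \<open>t\<close>, and the graph becomes a subset of \<open>'a\<close>.\<close>

lemma nat_functions_lepoll:
  assumes "infinite (UNIV :: 'a set)"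
  shows "(UNIV :: ('a \<Rightarrow> nat) set) \<lesssim> (UNIV :: 'a set set)"
proof -
  obtain m :: "nat \<Rightarrow> 'a" where m: "inj m"
    using assms infinite_countable_subset by blast
  have "|UNIV \<times> UNIV :: ('a \<times> 'a) set| \<le>o |UNIV :: 'a set|"
    using card_of_Times_same_infinite[OF assms] ordIso_iff_ordLeq by blast
  then obtain t :: "'a \<times> 'a \<Rightarrow> 'a" where t: "inj t"
    unfolding card_of_ordLeq[symmetric] by auto
  have "inj (\<lambda>f :: 'a \<Rightarrow> nat. range (\<lambda>x. t (x, m (f x))))"
  proof (rule injI, rule ext)
    fix f g :: "'a \<Rightarrow> nat" and x
    assume "range (\<lambda>x. t (x, m (f x))) = range (\<lambda>x. t (x, m (g x)))"
    then obtain y where "t (x, m (f x)) = t (y, m (g y))" by blast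
    then have "(x, m (f x)) = (y, m (g y))" by (rule injD[OF t])
    then have "x = y" "f x = g y" using injD[OF m] by auto
    then show "f x = g x" by simp
  qed
  then show ?thesis unfolding lepoll_def by blast
qed

theorem corollary4p6:
  assumes "infinite (UNIV :: 'a set)"
    and "(UNIV :: 'a set set) \<lesssim> (UNIV :: 'c set)"
  shows "dually_equivalent
    (multiset_category :: ('a mset_obj, 'a \<Rightarrow> 'a) category)
    (profinite_mv_category TYPE('a) :: ('c mv_algebra, 'c \<Rightarrow> 'c) category)"
proof -
  obtain e :: "('a \<Rightarrow> nat) \<Rightarrow> 'c" where "inj e"
    using lepoll_trans[OF nat_functions_lepoll[OF assms(1)] assms(2)] unfolding lepoll_def by blast
  then interpret chain_product_encoding e using assms(1) by unfold_locales
  show ?thesis by (rule duality)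
qed

end
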